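(* Let $A$ be a uniform algebra on a compact Hausdorff space $\Omega$, and let $X$ be a Banach $A$-module. The following are equivalent: (i) $X$ is an algebraically singly generated, faithful function $A$-module, and $X$ and $A$ are almost isometric (linearly, as Banach spaces); (ii) $X$ and $A$ are almost $A$-isometric; (iii) there exists $f\in\overline{Q}^{+}$ such that $X$ is $A$-isometric to $Af$.
   Context: A uniform algebra on a compact Hausdorff space $\Omega$ is a closed subalgebra of $C(\Omega)$ (complex continuous functions, sup norm) which contains the constants and separates points. For strictly positive $f\in C(\Omega)$, $Af=\{af:a\in A\}\subset C(\Omega)$ with sup norm, an $A$-module under multiplication. $Q=\{|g|: g\in A^{-1}\}\subset C(\Omega)$ where $A^{-1}$ is the set of invertible elements of $A$; $\overline{Q}^{+}$ is the set of strictly positive functions in the uniform closure of $Q$ in $C(\Omega)$. Two Banach $A$-modules are $A$-isometric if there is a surjective isometric $A$-module isomorphism between them; almost $A$-isometric if for every $\epsilon>0$ there is an $A$-module isomorphism $T$ from one onto the other with $\|T\|\|T^{-1}\|<1+\epsilon$; almost isometric if the same holds with $T$ only required to be a linear isomorphism. A concrete function $A$-module is a closed linear subspace of $C(K)$, $K$ compact Hausdorff, which is closed under multiplication by $\pi(A)$, where $\pi:A\to C(K)$ is a unital homomorphism (and $A$ acts through $\pi$). A function $A$-module is a Banach $A$-module which is $A$-isometric to a concrete function $A$-module. $X$ is algebraically singly generated if $X=Ax$ for some $x\in X$, and faithful if $aX=0$ implies $a=0$. *)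

theory Defs
  imports "HOL-Analysis.Analysis" "HOL-Algebra.Subrings"
begin

text \<open>
  For compact \<open>K\<close>, the carrier of \<open>C_ring K\<close> is the algebra of all continuous complex
  functions on \<open>K\<close>. As in \<^const>\<open>cfunspace\<close>, functions on \<open>K\<close> are represented by functions
  that are \<^const>\<open>undefined\<close> off \<^term>\<open>topspace K\<close>, so that equality of functions is
  equality on \<open>K\<close>; hence the restricted abstractions below.
\<close>

definition C_ring :: "'k topology \<Rightarrow> ('k \<Rightarrow> complex) ring" where
  "C_ring K =
    \<lparr>carrier = mspace (cfunspace K euclidean_metric),
     mult = (\<lambda>f g. \<lambda>x\<in>topspace K. f x * g x),
     one = (\<lambda>x\<in>topspace K. 1),
     zero = (\<lambda>x\<in>topspace K. 0),
     add = (\<lambda>f g. \<lambda>x\<in>topspace K. f x + g x)\<rparr>"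

definition const_fun :: "'k topology \<Rightarrow> complex \<Rightarrow> 'k \<Rightarrow> complex" where
  "const_fun K c = (\<lambda>x\<in>topspace K. c)"

abbreviation sup_topology :: "'k topology \<Rightarrow> ('k \<Rightarrow> complex) topology" where
  "sup_topology K \<equiv> mtopology_of (cfunspace K euclidean_metric)"

text \<open>The metric of \<^const>\<open>cfunspace\<close> is the supremum distance (and \<open>0\<close> on empty \<open>K\<close>).\<close>

definition sup_norm :: "'k topology \<Rightarrow> ('k \<Rightarrow> complex) \<Rightarrow> real" where
  "sup_norm K f = mdist (cfunspace K euclidean_metric) f (const_fun K 0)"

text \<open>
  Closure under scalar multiplication follows from closure under multiplication by the
  constant functions.
\<close>

definition uniform_algebra :: "'w topology \<Rightarrow> ('w \<Rightarrow> complex) set \<Rightarrow> bool" where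
  "uniform_algebra \<Omega> A \<longleftrightarrow>
     compact_space \<Omega> \<and> Hausdorff_space \<Omega> \<and>
     subring A (C_ring \<Omega>) \<and>
     (\<forall>c. const_fun \<Omega> c \<in> A) \<and>
     closedin (sup_topology \<Omega>) A \<and>
     (\<forall>x\<in>topspace \<Omega>. \<forall>y\<in>topspace \<Omega>. x \<noteq> y \<longrightarrow> (\<exists>a\<in>A. a x \<noteq> a y))"

abbreviation alg_ring :: "'w topology \<Rightarrow> ('w \<Rightarrow> complex) set \<Rightarrow> ('w \<Rightarrow> complex) ring" where
  "alg_ring \<Omega> A \<equiv> C_ring \<Omega>\<lparr>carrier := A\<rparr>"

text \<open>
  The record \<^type>\<open>module\<close> of HOL-Algebra extends \<^type>\<open>ring\<close>; the fields
  \<^const>\<open>mult\<close> and \<^const>\<open>one\<close> of a module are never used.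
\<close>

record ('a, 'm) normed_module = "('a, 'm) module" +
  nrm :: "'m \<Rightarrow> real"

text \<open>
  A Banach module is a unital module with contractive action. Its complex scalar
  multiplication is the action of the constant functions, which is forced by
  \<open>(c a) x = c (a x)\<close> and \<open>1 x = x\<close>.
\<close>

definition banach_module ::
  "'w topology \<Rightarrow> ('w \<Rightarrow> complex) set \<Rightarrow> ('w \<Rightarrow> complex, 'm) normed_module \<Rightarrow> bool" where
  "banach_module \<Omega> A X \<longleftrightarrow>
     Module.module (alg_ring \<Omega> A) X \<and>
     (\<forall>x\<in>carrier X. 0 \<le> nrm X x \<and> (nrm X x = 0 \<longleftrightarrow> x = \<zero>\<^bsub>X\<^esub>)) \<and>
     (\<forall>x\<in>carrier X. \<forall>y\<in>carrier X. nrm X (x \<oplus>\<^bsub>X\<^esub> y) \<le> nrm X x + nrm X y) \<and>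
     (\<forall>c. \<forall>x\<in>carrier X. nrm X (const_fun \<Omega> c \<odot>\<^bsub>X\<^esub> x) = cmod c * nrm X x) \<and>
     (\<forall>a\<in>A. \<forall>x\<in>carrier X. nrm X (a \<odot>\<^bsub>X\<^esub> x) \<le> sup_norm \<Omega> a * nrm X x) \<and>
     (\<forall>s::nat \<Rightarrow> 'm. range s \<subseteq> carrier X \<and>
        (\<forall>e>0. \<exists>N. \<forall>m\<ge>N. \<forall>n\<ge>N. nrm X (s m \<ominus>\<^bsub>X\<^esub> s n) < e) \<longrightarrow>
        (\<exists>l\<in>carrier X. (\<lambda>n. nrm X (s n \<ominus>\<^bsub>X\<^esub> l)) \<longlonglongrightarrow> 0))"

text \<open>
  Bijective additive maps commuting with the scalars in \<open>S\<close>: with \<open>S = A\<close> these are the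
  \<open>A\<close>-module isomorphisms, with \<open>S\<close> the constant functions the complex-linear isomorphisms.
\<close>

definition scalar_iso ::
  "'a set \<Rightarrow> ('a, 'm) normed_module \<Rightarrow> ('a, 'n) normed_module \<Rightarrow> ('m \<Rightarrow> 'n) \<Rightarrow> bool" where
  "scalar_iso S X Y T \<longleftrightarrow>
     bij_betw T (carrier X) (carrier Y) \<and>
     (\<forall>x\<in>carrier X. \<forall>y\<in>carrier X. T (x \<oplus>\<^bsub>X\<^esub> y) = T x \<oplus>\<^bsub>Y\<^esub> T y) \<and>
     (\<forall>a\<in>S. \<forall>x\<in>carrier X. T (a \<odot>\<^bsub>X\<^esub> x) = a \<odot>\<^bsub>Y\<^esub> T x)"

definition isometric_modules ::
  "'a set \<Rightarrow> ('a, 'm) normed_module \<Rightarrow> ('a, 'n) normed_module \<Rightarrow> bool" where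
  "isometric_modules A X Y \<longleftrightarrow>
     (\<exists>T. scalar_iso A X Y T \<and> (\<forall>x\<in>carrier X. nrm Y (T x) = nrm X x))"

definition bounded_op ::
  "('a, 'm) normed_module \<Rightarrow> ('a, 'n) normed_module \<Rightarrow> ('m \<Rightarrow> 'n) \<Rightarrow> bool" where
  "bounded_op X Y T \<longleftrightarrow> (\<exists>B. \<forall>x\<in>carrier X. nrm Y (T x) \<le> B * nrm X x)"

definition op_norm ::
  "('a, 'm) normed_module \<Rightarrow> ('a, 'n) normed_module \<Rightarrow> ('m \<Rightarrow> 'n) \<Rightarrow> real" where
  "op_norm X Y T = (SUP x\<in>{x \<in> carrier X. nrm X x \<le> 1}. nrm Y (T x))"

text \<open>
  Boundedness is required separately because \<^const>\<open>op_norm\<close> is a real supremum and carries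
  no information for unbounded maps.
\<close>

definition almost_isometric_over ::
  "'a set \<Rightarrow> ('a, 'm) normed_module \<Rightarrow> ('a, 'n) normed_module \<Rightarrow> bool" where
  "almost_isometric_over S X Y \<longleftrightarrow>
     (\<forall>\<epsilon>>0. \<exists>T. scalar_iso S X Y T \<and>
        bounded_op X Y T \<and> bounded_op Y X (inv_into (carrier X) T) \<and>
        op_norm X Y T * op_norm Y X (inv_into (carrier X) T) < 1 + \<epsilon>)"

definition almost_isometric_modules ::
  "('w \<Rightarrow> complex) set \<Rightarrow> ('w \<Rightarrow> complex, 'm) normed_module \<Rightarrow>
    ('w \<Rightarrow> complex, 'n) normed_module \<Rightarrow> bool" where
  "almost_isometric_modules A X Y \<longleftrightarrow> almost_isometric_over A X Y"

definition almost_isometric_spaces ::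
  "'w topology \<Rightarrow> ('w \<Rightarrow> complex, 'm) normed_module \<Rightarrow>
    ('w \<Rightarrow> complex, 'n) normed_module \<Rightarrow> bool" where
  "almost_isometric_spaces \<Omega> X Y \<longleftrightarrow> almost_isometric_over (range (const_fun \<Omega>)) X Y"

text \<open>The space \<open>Y\<close> of functions on \<open>K\<close>, with sup norm and scalars acting through \<open>\<pi>\<close>.\<close>

definition fun_module ::
  "'k topology \<Rightarrow> ('a \<Rightarrow> 'k \<Rightarrow> complex) \<Rightarrow> ('k \<Rightarrow> complex) set \<Rightarrow>
    ('a, 'k \<Rightarrow> complex) normed_module" where
  "fun_module K \<pi> Y =
    \<lparr>carrier = Y, mult = mult (C_ring K), one = one (C_ring K),
     zero = zero (C_ring K), add = add (C_ring K),
     smult = (\<lambda>a y. \<pi> a \<otimes>\<^bsub>C_ring K\<^esub> y), nrm = sup_norm K\<rparr>"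

definition concrete_function_module ::
  "'w topology \<Rightarrow> ('w \<Rightarrow> complex) set \<Rightarrow> 'k topology \<Rightarrow>
    (('w \<Rightarrow> complex) \<Rightarrow> 'k \<Rightarrow> complex) \<Rightarrow> ('k \<Rightarrow> complex) set \<Rightarrow> bool" where
  "concrete_function_module \<Omega> A K \<pi> Y \<longleftrightarrow>
     compact_space K \<and> Hausdorff_space K \<and>
     \<pi> \<in> ring_hom (alg_ring \<Omega> A) (C_ring K) \<and>
     (\<forall>c. \<pi> (const_fun \<Omega> c) = const_fun K c) \<and>
     subgroup Y (add_monoid (C_ring K)) \<and>
     (\<forall>c. \<forall>y\<in>Y. const_fun K c \<otimes>\<^bsub>C_ring K\<^esub> y \<in> Y) \<and>
     closedin (sup_topology K) Y \<and>
     (\<forall>a\<in>A. \<forall>y\<in>Y. \<pi> a \<otimes>\<^bsub>C_ring K\<^esub> y \<in> Y)"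

text \<open>
  A formula cannot quantify existentially over the point type of \<open>K\<close>. Points of \<open>K\<close> are
  therefore taken to be pairs of a function on \<open>X\<close> and a function on \<open>A\<close>. This loses nothing:
  a point \<open>k\<close> of an arbitrary \<open>K\<close> acts only through the evaluations \<open>x \<mapsto> (T x)(k)\<close> and
  \<open>a \<mapsto> \<pi>(a)(k)\<close>. The lemma \<open>function_moduleI\<close> below proves that a representation over a
  space \<open>K\<close> of any point type suffices.
\<close>

definition function_module ::
  "'w topology \<Rightarrow> ('w \<Rightarrow> complex) set \<Rightarrow> ('w \<Rightarrow> complex, 'm) normed_module \<Rightarrow> bool" where
  "function_module \<Omega> A X \<longleftrightarrow>
     banach_module \<Omega> A X \<and>
     (\<exists>(K :: (('m \<Rightarrow> complex) \<times> (('w \<Rightarrow> complex) \<Rightarrow> complex)) topology) \<pi> Y.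
        concrete_function_module \<Omega> A K \<pi> Y \<and> isometric_modules A X (fun_module K \<pi> Y))"

lemma C_ring_carrier:
  assumes "compact_space K"
  shows "f \<in> carrier (C_ring K) \<longleftrightarrow> f \<in> extensional (topspace K) \<and> continuous_map K euclidean f"
  using assms compactin_mspace_cfunspace[of K "euclidean_metric :: complex metric"]
  unfolding C_ring_def compact_space_def partial_object.simps by simp

lemma const_fun_in_C_ring:
  assumes "compact_space K"
  shows "const_fun K c \<in> carrier (C_ring K)"
proof -
  have "continuous_map K euclidean (const_fun K c)"
    by (rule continuous_map_eq[where f = "\<lambda>_. c"]) (simp_all add: const_fun_def)
  then show ?thesis using assms by (simp add: C_ring_carrier) (simp add: const_fun_def)
qed

lemma mdist_cfunspace_pullback:
  fixes F G :: "'l \<Rightarrow> complex"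
  assumes K: "compact_space K" "compact_space L" and e: "e ` topspace K = topspace L"
    and F: "F \<in> carrier (C_ring L)" "restrict (F \<circ> e) (topspace K) \<in> carrier (C_ring K)"
    and G: "G \<in> carrier (C_ring L)" "restrict (G \<circ> e) (topspace K) \<in> carrier (C_ring K)"
  shows "mdist (cfunspace K euclidean_metric)
           (restrict (F \<circ> e) (topspace K)) (restrict (G \<circ> e) (topspace K)) =
         mdist (cfunspace L euclidean_metric) F G"
proof (cases "topspace K = {}")
  case True
  then have "topspace L = {}" using e by simp
  with True show ?thesis
    by (simp add: mdist_cfunspace_eq_mdist_funspace Metric_space.fdist_empty)
next
  case False
  then have ne: "topspace L \<noteq> {}" using e by blast
  let ?m = "euclidean_metric :: complex metric"
  have F': "F \<in> mspace (cfunspace L ?m)" "G \<in> mspace (cfunspace L ?m)"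
       "restrict (F \<circ> e) (topspace K) \<in> mspace (cfunspace K ?m)"
       "restrict (G \<circ> e) (topspace K) \<in> mspace (cfunspace K ?m)"
    using F G by (simp_all only: C_ring_def partial_object.simps)
  have "(mdist (cfunspace K ?m) (restrict (F \<circ> e) (topspace K)) (restrict (G \<circ> e) (topspace K)) \<le> a)
      \<longleftrightarrow> (mdist (cfunspace L ?m) F G \<le> a)" for a
    unfolding cfunspace_mdist_le[OF F'(1,2) ne] cfunspace_mdist_le[OF F'(3,4) False]
    unfolding e[symmetric] by simp
  then show ?thesis by (meson order_antisym order_refl)
qed

lemma function_moduleI:
  fixes K :: "'k topology" and A :: "('w \<Rightarrow> complex) set"
    and X :: "('w \<Rightarrow> complex, 'm) normed_module"
  assumes X: "banach_module \<Omega> A X"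
    and Y: "concrete_function_module \<Omega> A K \<pi> Y"
    and iso: "isometric_modules A X (fun_module K \<pi> Y)"
  shows "function_module \<Omega> A X"
proof -
  obtain T where T: "scalar_iso A X (fun_module K \<pi> Y) T"
    and Tn: "\<And>x. x \<in> carrier X \<Longrightarrow> sup_norm K (T x) = nrm X x"
    using iso unfolding isometric_modules_def fun_module_def by auto
  have bij: "bij_betw T (carrier X) Y"
    and Tadd: "\<And>x y. x \<in> carrier X \<Longrightarrow> y \<in> carrier X \<Longrightarrow> T (x \<oplus>\<^bsub>X\<^esub> y) = T x \<oplus>\<^bsub>C_ring K\<^esub> T y"
    and Tsm: "\<And>a x. a \<in> A \<Longrightarrow> x \<in> carrier X \<Longrightarrow> T (a \<odot>\<^bsub>X\<^esub> x) = \<pi> a \<otimes>\<^bsub>C_ring K\<^esub> T x"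
    using T unfolding scalar_iso_def fun_module_def by auto
  have K: "compact_space K"
    and hom: "\<pi> \<in> ring_hom (alg_ring \<Omega> A) (C_ring K)"
    and pc: "\<And>c. \<pi> (const_fun \<Omega> c) = const_fun K c"
    and sub: "subgroup Y (add_monoid (C_ring K))"
    and Yc: "\<And>c y. y \<in> Y \<Longrightarrow> const_fun K c \<otimes>\<^bsub>C_ring K\<^esub> y \<in> Y"
    and Ycl: "closedin (sup_topology K) Y"
    and Ypi: "\<And>a y. a \<in> A \<Longrightarrow> y \<in> Y \<Longrightarrow> \<pi> a \<otimes>\<^bsub>C_ring K\<^esub> y \<in> Y"
    using Y unfolding concrete_function_module_def by auto

  define e :: "'k \<Rightarrow> ('m \<Rightarrow> complex) \<times> (('w \<Rightarrow> complex) \<Rightarrow> complex)" where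
    "e k = ((\<lambda>x. if x \<in> carrier X then T x k else 0),
            (\<lambda>a. if a \<in> A \<union> range (const_fun \<Omega>) then \<pi> a k else 0))" for k
  define P where "P = prod_topology (product_topology (\<lambda>_::'m. euclidean :: complex topology) UNIV)
       (product_topology (\<lambda>_::'w \<Rightarrow> complex. euclidean :: complex topology) UNIV)"
  define L where "L = subtopology P (e ` topspace K)"
  have topP: "topspace P = UNIV" unfolding P_def by simp
  have topL: "topspace L = e ` topspace K" unfolding L_def by (simp add: topP)
  have YC: "y \<in> carrier (C_ring K)" if "y \<in> Y" for y
    using subgroup.subset[OF sub] that by auto
  have TY: "T x \<in> Y" if "x \<in> carrier X" for x
    using bij that by (auto simp: bij_betw_def)
  have constC: "const_fun K c \<in> carrier (C_ring K)" for c
    by (rule const_fun_in_C_ring[OF K])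
  have piC: "\<pi> a \<in> carrier (C_ring K)" if "a \<in> A \<union> range (const_fun \<Omega>)" for a
    using that hom constC pc by (auto simp: ring_hom_def)
  have contY: "continuous_map K euclidean y" if "y \<in> carrier (C_ring K)" for y
    using K that by (simp add: C_ring_carrier)
  have conte: "continuous_map K P e"
    unfolding P_def e_def continuous_map_pairwise
    by (auto simp: o_def continuous_map_componentwise_UNIV intro!: contY YC TY piC)
  have compL: "compact_space L"
    unfolding L_def using image_compactin[OF _ conte] K
    by (simp add: compact_space_def compactin_subtopology topP)
  have hausL: "Hausdorff_space L"
    unfolding L_def P_def
    by (intro Hausdorff_space_subtopology)
       (simp add: Hausdorff_space_prod_topology Hausdorff_space_product_topology)
  have conteL: "continuous_map K L e"
    unfolding L_def using conte by (simp add: continuous_map_in_subtopology)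

  define push where "push F = restrict (F \<circ> e) (topspace K)" for F :: "_ \<Rightarrow> complex"
  have pushC: "push F \<in> carrier (C_ring K)" if "F \<in> carrier (C_ring L)" for F
  proof -
    have "continuous_map L euclidean F" using that compL by (simp add: C_ring_carrier)
    then have "continuous_map K euclidean (F \<circ> e)" by (rule continuous_map_compose[OF conteL])
    then have "continuous_map K euclidean (push F)"
      by (rule continuous_map_eq) (simp add: push_def)
    then show ?thesis using K by (simp add: C_ring_carrier push_def)
  qed
  have push_inj: "F = G" if "push F = push G" "F \<in> carrier (C_ring L)" "G \<in> carrier (C_ring L)" for F G
  proof (rule extensionalityI)
    show "F \<in> extensional (topspace L)" "G \<in> extensional (topspace L)"
      using that compL by (auto simp: C_ring_carrier)
    fix z assume "z \<in> topspace L"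
    then obtain k where "k \<in> topspace K" "z = e k" by (auto simp: topL)
    then show "F z = G z" using fun_cong[OF that(1), of k] by (simp add: push_def)
  qed
  have push_mult: "push (F \<otimes>\<^bsub>C_ring L\<^esub> G) = push F \<otimes>\<^bsub>C_ring K\<^esub> push G" for F G
    by (auto simp: push_def C_ring_def topL fun_eq_iff restrict_def)
  have push_add: "push (F \<oplus>\<^bsub>C_ring L\<^esub> G) = push F \<oplus>\<^bsub>C_ring K\<^esub> push G" for F G
    by (auto simp: push_def C_ring_def topL fun_eq_iff restrict_def)
  have push_const: "push (const_fun L c) = const_fun K c" for c
    by (auto simp: push_def const_fun_def topL fun_eq_iff restrict_def)
  have constL: "const_fun L c \<in> carrier (C_ring L)" for c
    by (rule const_fun_in_C_ring[OF compL])
  have multL: "F \<otimes>\<^bsub>C_ring L\<^esub> G \<in> carrier (C_ring L)" if "F \<in> carrier (C_ring L)" "G \<in> carrier (C_ring L)" for F G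
  proof -
    have "continuous_map L euclidean (\<lambda>x. F x * G x)"
      using that compL by (simp add: C_ring_carrier continuous_map_atin tendsto_mult)
    then have "continuous_map L euclidean (restrict (\<lambda>x. F x * G x) (topspace L))"
      by (rule continuous_map_eq) simp
    then show ?thesis using compL by (simp add: C_ring_carrier) (simp add: C_ring_def)
  qed
  have addL: "F \<oplus>\<^bsub>C_ring L\<^esub> G \<in> carrier (C_ring L)" if "F \<in> carrier (C_ring L)" "G \<in> carrier (C_ring L)" for F G
  proof -
    have "continuous_map L euclidean (\<lambda>x. F x + G x)"
      using that compL by (intro continuous_map_add) (auto simp: C_ring_carrier)
    then have "continuous_map L euclidean (restrict (\<lambda>x. F x + G x) (topspace L))"
      by (rule continuous_map_eq) simp
    then show ?thesis using compL by (simp add: C_ring_carrier) (simp add: C_ring_def)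
  qed
  have mdist_push: "mdist (cfunspace K euclidean_metric) (push F) (push G) =
      mdist (cfunspace L euclidean_metric) F G"
    if "F \<in> carrier (C_ring L)" "G \<in> carrier (C_ring L)" for F G
    using mdist_cfunspace_pullback[OF K compL topL[symmetric] that(1) _ that(2)]
      pushC[OF that(1)] pushC[OF that(2)] by (simp add: push_def)
  have norm_push: "sup_norm K (push F) = sup_norm L F" if "F \<in> carrier (C_ring L)" for F
    using mdist_push[OF that constL[of 0]] by (simp add: sup_norm_def push_const)

  define S where "S x = restrict (\<lambda>z. fst z x) (topspace L)" for x
  define \<rho> where "\<rho> a = restrict (\<lambda>z. snd z a) (topspace L)" for a
  define Z where "Z = {F \<in> carrier (C_ring L). push F \<in> Y}"
  have SC: "S x \<in> carrier (C_ring L)" for x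
  proof -
    have "continuous_map P euclidean ((\<lambda>q. q x) \<circ> fst)"
      unfolding P_def
      by (rule continuous_map_compose[OF continuous_map_fst continuous_map_product_projection]) simp
    then have "continuous_map L euclidean (\<lambda>z. fst z x)"
      unfolding L_def by (intro continuous_map_from_subtopology) (simp add: o_def)
    then have "continuous_map L euclidean (S x)"
      by (rule continuous_map_eq) (simp add: S_def)
    then show ?thesis using compL by (simp add: C_ring_carrier S_def)
  qed
  have RC: "\<rho> a \<in> carrier (C_ring L)" for a
  proof -
    have "continuous_map P euclidean ((\<lambda>q. q a) \<circ> snd)"
      unfolding P_def
      by (rule continuous_map_compose[OF continuous_map_snd continuous_map_product_projection]) simp
    then have "continuous_map L euclidean (\<lambda>z. snd z a)"
      unfolding L_def by (intro continuous_map_from_subtopology) (simp add: o_def)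
    then have "continuous_map L euclidean (\<rho> a)"
      by (rule continuous_map_eq) (simp add: \<rho>_def)
    then show ?thesis using compL by (simp add: C_ring_carrier \<rho>_def)
  qed
  have ext: "restrict y (topspace K) = y" if "y \<in> carrier (C_ring K)" for y
    using that K by (simp add: C_ring_carrier extensional_restrict)
  have pushS: "push (S x) = T x" if "x \<in> carrier X" for x
  proof -
    have "push (S x) = restrict (T x) (topspace K)"
      using that by (auto simp: push_def S_def topL e_def fun_eq_iff restrict_def)
    then show ?thesis using ext YC TY that by simp
  qed
  have pushR: "push (\<rho> a) = \<pi> a" if "a \<in> A \<union> range (const_fun \<Omega>)" for a
  proof -
    have "push (\<rho> a) = restrict (\<pi> a) (topspace K)"
      using that by (auto simp: push_def \<rho>_def topL e_def fun_eq_iff restrict_def)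
    then show ?thesis using ext piC that by simp
  qed

  interpret M: Module.module "alg_ring \<Omega> A" X
    using X by (simp add: banach_module_def)
  have closA: "a \<oplus>\<^bsub>C_ring \<Omega>\<^esub> b \<in> A" "a \<otimes>\<^bsub>C_ring \<Omega>\<^esub> b \<in> A" if "a \<in> A" "b \<in> A" for a b
    using M.R.a_closed[of a b] M.R.m_closed[of a b] that by auto
  have oneA: "\<one>\<^bsub>C_ring \<Omega>\<^esub> \<in> A" using M.R.one_closed by simp
  have one_const: "\<one>\<^bsub>C_ring J\<^esub> = const_fun J 1" for J :: "'j topology"
    by (simp add: C_ring_def const_fun_def)
  have rho_const: "\<rho> (const_fun \<Omega> c) = const_fun L c" for c
    by (rule push_inj[OF _ RC constL]) (simp add: pushR push_const pc)
  have hom': "\<rho> \<in> ring_hom (alg_ring \<Omega> A) (C_ring L)"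
  proof (rule ring_hom_memI)
    show "\<rho> \<one>\<^bsub>alg_ring \<Omega> A\<^esub> = \<one>\<^bsub>C_ring L\<^esub>"
      by (simp add: one_const rho_const)
  next
    fix a b assume ab: "a \<in> carrier (alg_ring \<Omega> A)" "b \<in> carrier (alg_ring \<Omega> A)"
    show "\<rho> (a \<otimes>\<^bsub>alg_ring \<Omega> A\<^esub> b) = \<rho> a \<otimes>\<^bsub>C_ring L\<^esub> \<rho> b"
      by (rule push_inj[OF _ RC multL[OF RC RC]])
         (use ab closA ring_hom_mult[OF hom ab] in \<open>simp add: pushR push_mult\<close>)
    show "\<rho> (a \<oplus>\<^bsub>alg_ring \<Omega> A\<^esub> b) = \<rho> a \<oplus>\<^bsub>C_ring L\<^esub> \<rho> b"
      by (rule push_inj[OF _ RC addL[OF RC RC]])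
         (use ab closA ring_hom_add[OF hom ab] in \<open>simp add: pushR push_add\<close>)
  qed (rule RC)
  have zero_const: "\<zero>\<^bsub>C_ring J\<^esub> = const_fun J 0" for J :: "'j topology"
    by (simp add: C_ring_def const_fun_def)
  have bijS: "bij_betw S (carrier X) Z"
  proof (rule bij_betwI')
    fix x y assume xy: "x \<in> carrier X" "y \<in> carrier X"
    show "(S x = S y) = (x = y)"
      using pushS[OF xy(1)] pushS[OF xy(2)] bij xy by (auto simp: bij_betw_def inj_on_def)
  next
    fix x assume "x \<in> carrier X" then show "S x \<in> Z"
      using SC pushS TY by (simp add: Z_def)
  next
    fix F assume F: "F \<in> Z"
    then obtain x where x: "x \<in> carrier X" "push F = T x"
      using bij by (auto simp: Z_def bij_betw_def)
    have "F = S x" by (rule push_inj[OF _ _ SC]) (use F x pushS in \<open>auto simp: Z_def\<close>)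
    then show "\<exists>x\<in>carrier X. F = S x" using x by blast
  qed
  have YaddC: "x \<oplus>\<^bsub>C_ring K\<^esub> y \<in> Y" if "x \<in> Y" "y \<in> Y" for x y
    using subgroup.m_closed[OF sub that] by simp
  have YzeroC: "\<zero>\<^bsub>C_ring K\<^esub> \<in> Y"
    using subgroup.one_closed[OF sub] by simp
  have minus: "const_fun L (-1) \<otimes>\<^bsub>C_ring L\<^esub> F \<oplus>\<^bsub>C_ring L\<^esub> F = \<zero>\<^bsub>C_ring L\<^esub>"
    "F \<oplus>\<^bsub>C_ring L\<^esub> const_fun L (-1) \<otimes>\<^bsub>C_ring L\<^esub> F = \<zero>\<^bsub>C_ring L\<^esub>" for F
    by (auto simp: C_ring_def const_fun_def fun_eq_iff)
  have scZ: "const_fun L c \<otimes>\<^bsub>C_ring L\<^esub> F \<in> Z" if "F \<in> Z" for c F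
    using that Yc by (auto simp: Z_def push_mult push_const intro!: multL constL)
  have monL: "monoid (add_monoid (C_ring L))"
  proof (rule monoidI)
    fix F G H assume *: "F \<in> carrier (add_monoid (C_ring L))" "G \<in> carrier (add_monoid (C_ring L))"
      "H \<in> carrier (add_monoid (C_ring L))"
    show "F \<otimes>\<^bsub>add_monoid (C_ring L)\<^esub> G \<in> carrier (add_monoid (C_ring L))"
      using * addL by simp
    show "F \<otimes>\<^bsub>add_monoid (C_ring L)\<^esub> G \<otimes>\<^bsub>add_monoid (C_ring L)\<^esub> H =
      F \<otimes>\<^bsub>add_monoid (C_ring L)\<^esub> (G \<otimes>\<^bsub>add_monoid (C_ring L)\<^esub> H)"
      by (auto simp: C_ring_def fun_eq_iff algebra_simps)
  next
    show "\<one>\<^bsub>add_monoid (C_ring L)\<^esub> \<in> carrier (add_monoid (C_ring L))"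
      using constL[of 0] by (simp add: zero_const)
  next
    fix F assume F: "F \<in> carrier (add_monoid (C_ring L))"
    then have E: "F \<in> extensional (topspace L)" using compL by (simp add: C_ring_carrier)
    show "\<one>\<^bsub>add_monoid (C_ring L)\<^esub> \<otimes>\<^bsub>add_monoid (C_ring L)\<^esub> F = F"
      "F \<otimes>\<^bsub>add_monoid (C_ring L)\<^esub> \<one>\<^bsub>add_monoid (C_ring L)\<^esub> = F"
      using E by (auto simp: C_ring_def fun_eq_iff extensional_def)
  qed
  have grpL: "group (add_monoid (C_ring L))"
  proof (rule monoid.group_l_invI[OF monL])
    fix F assume "F \<in> carrier (add_monoid (C_ring L))"
    then show "\<exists>G\<in>carrier (add_monoid (C_ring L)).
        G \<otimes>\<^bsub>add_monoid (C_ring L)\<^esub> F = \<one>\<^bsub>add_monoid (C_ring L)\<^esub>"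
      using minus(1)[of F] multL[OF constL[of "-1"], of F] by auto
  qed
  have subZ: "subgroup Z (add_monoid (C_ring L))"
  proof (rule group.subgroupI[OF grpL])
    show "Z \<subseteq> carrier (add_monoid (C_ring L))" by (auto simp: Z_def)
    have "\<zero>\<^bsub>C_ring L\<^esub> \<in> Z"
      using YzeroC constL[of 0] by (simp add: Z_def zero_const push_const)
    then show "Z \<noteq> {}" by blast
  next
    fix F assume F: "F \<in> Z"
    have "inv\<^bsub>add_monoid (C_ring L)\<^esub> F = const_fun L (-1) \<otimes>\<^bsub>C_ring L\<^esub> F"
      by (rule group.inv_equality[OF grpL])
         (use F minus(1) multL constL in \<open>auto simp: Z_def\<close>)
    then show "inv\<^bsub>add_monoid (C_ring L)\<^esub> F \<in> Z" using scZ[OF F] by simp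
  next
    fix F G assume "F \<in> Z" "G \<in> Z"
    then show "F \<otimes>\<^bsub>add_monoid (C_ring L)\<^esub> G \<in> Z"
      using addL YaddC by (auto simp: Z_def push_add)
  qed
  have carr: "carrier (C_ring J) = mspace (cfunspace J euclidean_metric)" for J :: "'j topology"
    by (simp only: C_ring_def partial_object.simps)
  let ?mK = "cfunspace K (euclidean_metric :: complex metric)"
  let ?mL = "cfunspace L (euclidean_metric :: complex metric)"
  interpret NK: Metric_space "mspace ?mK" "mdist ?mK" by (rule Metric_space_mspace_mdist)
  interpret NL: Metric_space "mspace ?mL" "mdist ?mL" by (rule Metric_space_mspace_mdist)
  have clZ: "closedin (sup_topology L) Z"
    unfolding mtopology_of_def NL.closedin_metric
  proof (intro conjI allI impI)
    show "Z \<subseteq> mspace ?mL" unfolding Z_def carr by blast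
    fix F assume F: "F \<in> mspace ?mL - Z"
    then have FC: "F \<in> carrier (C_ring L)" unfolding carr by blast
    then have "push F \<in> mspace ?mK - Y" using F pushC unfolding Z_def carr by blast
    then obtain r where r: "r > 0" "disjnt Y (NK.mball (push F) r)"
      using Ycl unfolding mtopology_of_def NK.closedin_metric by blast
    have "G \<notin> Z" if G: "G \<in> NL.mball F r" for G
    proof
      assume GZ: "G \<in> Z"
      then have GC: "G \<in> carrier (C_ring L)" "push G \<in> Y" by (auto simp: Z_def)
      have "push G \<in> NK.mball (push F) r"
        unfolding NK.in_mball mdist_push[OF FC GC(1)]
        using G pushC[OF FC] pushC[OF GC(1)] unfolding NL.in_mball carr by blast
      then show False using r GC(2) by (auto simp: disjnt_def)
    qed
    then show "\<exists>r>0. disjnt Z (NL.mball F r)" using r(1) by (auto simp: disjnt_def)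
  qed
  have conc: "concrete_function_module \<Omega> A L \<rho> Z"
    unfolding concrete_function_module_def
    using compL hausL hom' rho_const subZ scZ clZ Ypi
    by (auto simp: Z_def push_mult pushR intro!: multL RC)
  have "isometric_modules A X (fun_module L \<rho> Z)"
    unfolding isometric_modules_def
  proof (intro exI conjI ballI)
    show "scalar_iso A X (fun_module L \<rho> Z) S"
      unfolding scalar_iso_def
    proof (intro conjI ballI)
      show "bij_betw S (carrier X) (carrier (fun_module L \<rho> Z))"
        using bijS by (simp add: fun_module_def)
    next
      fix x y assume xy: "x \<in> carrier X" "y \<in> carrier X"
      have "S (x \<oplus>\<^bsub>X\<^esub> y) = S x \<oplus>\<^bsub>C_ring L\<^esub> S y"
        by (rule push_inj[OF _ SC addL[OF SC SC]]) (use xy in \<open>simp add: push_add pushS Tadd\<close>)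
      then show "S (x \<oplus>\<^bsub>X\<^esub> y) = S x \<oplus>\<^bsub>fun_module L \<rho> Z\<^esub> S y" by (simp add: fun_module_def)
    next
      fix a x assume ax: "a \<in> A" "x \<in> carrier X"
      have "a \<odot>\<^bsub>X\<^esub> x \<in> carrier X" using M.smult_closed[of a x] ax by simp
      then have "S (a \<odot>\<^bsub>X\<^esub> x) = \<rho> a \<otimes>\<^bsub>C_ring L\<^esub> S x"
        using ax by (intro push_inj[OF _ SC multL[OF RC SC]]) (simp add: push_mult pushS pushR Tsm)
      then show "S (a \<odot>\<^bsub>X\<^esub> x) = a \<odot>\<^bsub>fun_module L \<rho> Z\<^esub> S x" by (simp add: fun_module_def)
    qed
  next
    fix x assume "x \<in> carrier X"
    then show "nrm (fun_module L \<rho> Z) (S x) = nrm X x"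
      using norm_push[OF SC, of x] Tn pushS by (simp add: fun_module_def)
  qed
  with conc X show ?thesis unfolding function_module_def by blast
qed

definition singly_generated :: "'a set \<Rightarrow> ('a, 'm) normed_module \<Rightarrow> bool" where
  "singly_generated A X \<longleftrightarrow> (\<exists>x\<in>carrier X. carrier X = (\<lambda>a. a \<odot>\<^bsub>X\<^esub> x) ` A)"

definition faithful ::
  "'w topology \<Rightarrow> ('w \<Rightarrow> complex) set \<Rightarrow> ('w \<Rightarrow> complex, 'm) normed_module \<Rightarrow> bool" where
  "faithful \<Omega> A X \<longleftrightarrow>
     (\<forall>a\<in>A. (\<forall>x\<in>carrier X. a \<odot>\<^bsub>X\<^esub> x = \<zero>\<^bsub>X\<^esub>) \<longrightarrow> a = \<zero>\<^bsub>C_ring \<Omega>\<^esub>)"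

abbreviation self_module ::
  "'w topology \<Rightarrow> ('w \<Rightarrow> complex) set \<Rightarrow> ('w \<Rightarrow> complex, 'w \<Rightarrow> complex) normed_module" where
  "self_module \<Omega> A \<equiv> fun_module \<Omega> (\<lambda>a. a) A"

definition principal_module ::
  "'w topology \<Rightarrow> ('w \<Rightarrow> complex) set \<Rightarrow> ('w \<Rightarrow> complex) \<Rightarrow>
    ('w \<Rightarrow> complex, 'w \<Rightarrow> complex) normed_module" where
  "principal_module \<Omega> A f = fun_module \<Omega> (\<lambda>a. a) ((\<lambda>a. a \<otimes>\<^bsub>C_ring \<Omega>\<^esub> f) ` A)"

definition modulus_set :: "'w topology \<Rightarrow> ('w \<Rightarrow> complex) set \<Rightarrow> ('w \<Rightarrow> complex) set" where
  "modulus_set \<Omega> A =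
     (\<lambda>g. \<lambda>x\<in>topspace \<Omega>. complex_of_real (cmod (g x))) ` Units (alg_ring \<Omega> A)"

definition strictly_positive :: "'w topology \<Rightarrow> ('w \<Rightarrow> complex) \<Rightarrow> bool" where
  "strictly_positive \<Omega> f \<longleftrightarrow> (\<forall>x\<in>topspace \<Omega>. \<exists>r>0. f x = complex_of_real r)"

definition modulus_closure_pos ::
  "'w topology \<Rightarrow> ('w \<Rightarrow> complex) set \<Rightarrow> ('w \<Rightarrow> complex) set" where
  "modulus_closure_pos \<Omega> A =
     {f \<in> sup_topology \<Omega> closure_of modulus_set \<Omega> A. strictly_positive \<Omega> f}"

end

theory Submission
  imports Defs
begin

text \<open>
  (ii) to (iii): if \<open>T\<^sub>n : X \<rightarrow> A\<close> are \<open>A\<close>-isomorphisms with \<open>\<parallel>T\<^sub>n\<parallel> \<parallel>T\<^sub>n\<^sup>-\<^sup>1\<parallel> \<rightarrow> 1\<close> and \<open>x\<close> generates \<open>X\<close>, then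
  \<open>g\<^sub>n = T\<^sub>n x\<close> is invertible and, suitably scaled, \<open>\<parallel>a x\<parallel> \<le> \<parallel>a g\<^sub>n\<parallel> \<le> (1 + 1/n) \<parallel>a x\<parallel>\<close>. Taking \<open>a = 1/g\<^sub>m\<close> gives
  \<open>\<bar>g\<^sub>n\<bar> \<le> (1 + 1/n) \<bar>g\<^sub>m\<bar>\<close> pointwise, so \<open>\<bar>g\<^sub>n\<bar>\<close> converges uniformly to some \<open>f\<close>, and \<open>\<parallel>a x\<parallel> = \<parallel>a f\<parallel>\<close>.

  (i) to (ii): let \<open>L : X \<rightarrow> A\<close> be a linear almost isometry and \<open>b \<in> A\<close>. Since \<open>X\<close> consists of functions,
  \<open>\<parallel>\<bar>b x\<bar> + \<parallel>b\<parallel> \<bar>y\<bar>\<parallel> \<le> \<parallel>b\<parallel> \<parallel>\<bar>x\<bar> + \<bar>y\<bar>\<parallel>\<close> on \<open>X\<close>. These norms are suprema of norms of linear combinations, so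
  the inequality passes to \<open>R = L b L\<^sup>-\<^sup>1\<close> on \<open>A\<close> up to a factor \<open>1 + \<epsilon>\<close>. Testing it
  with functions peaking at a point shows that \<open>R\<close> is within \<open>4 \<epsilon> \<parallel>b\<parallel>\<close> of multiplication by \<open>R 1\<close>. It
  follows that \<open>b \<mapsto> b L\<^sup>-\<^sup>1 1\<close> is almost isometric and onto.
\<close>

subsection \<open>Continuous functions and uniform algebras\<close>

text \<open>A linear almost isometry knows nothing of products, and these maps have no limit as
  \<open>\<epsilon>\<close> tends to \<open>0\<close>, so one map must reveal the module structure
  quantitatively. For this the norm of \<open>X\<close>, carried to \<open>A\<close> by the
  generator, has to be compared with the sup norm. Banach's inverse theorem, applied to one crude
  isomorphism, gives constants that are fixed before \<open>\<epsilon>\<close> is chosen. Such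
  constants would spoil an almost isometry; they disappear when an estimate is applied to the powers
  of \<open>b\<close> and \<open>n\<close>-th roots are taken, because the sup norm of a power is
  the power of the sup norm. They survive only in the smallness of \<open>\<epsilon>\<close> that
  makes the generator correspond to an invertible element of \<open>A\<close>.

  (iii) to (ii): \<open>f\<close> is replaced by an invertible \<open>g\<close> with modulus close
  to \<open>f\<close>. (ii) to (i) passes through (iii), since \<open>A f\<close> is visibly a
  module of functions.\<close>

lemma C_ring_simps:
  "carrier (C_ring K) = mspace (cfunspace K euclidean_metric)"
  "f \<otimes>\<^bsub>C_ring K\<^esub> g = (\<lambda>x\<in>topspace K. f x * g x)"
  "f \<oplus>\<^bsub>C_ring K\<^esub> g = (\<lambda>x\<in>topspace K. f x + g x)"
  "\<one>\<^bsub>C_ring K\<^esub> = (\<lambda>x\<in>topspace K. 1)"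
  "\<zero>\<^bsub>C_ring K\<^esub> = (\<lambda>x\<in>topspace K. 0)"
  unfolding C_ring_def by (simp_all del: mspace_cfunspace)

lemma fun_module_simps:
  "carrier (fun_module K \<pi> Y) = Y"
  "x \<oplus>\<^bsub>fun_module K \<pi> Y\<^esub> y = (\<lambda>t\<in>topspace K. x t + y t)"
  "\<zero>\<^bsub>fun_module K \<pi> Y\<^esub> = (\<lambda>t\<in>topspace K. 0)"
  "a \<odot>\<^bsub>fun_module K \<pi> Y\<^esub> y = (\<lambda>t\<in>topspace K. \<pi> a t * y t)"
  "nrm (fun_module K \<pi> Y) = sup_norm K"
  by (simp_all add: fun_module_def C_ring_simps)

lemma C_ring_extensional: "f \<in> carrier (C_ring K) \<Longrightarrow> f \<in> extensional (topspace K)"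
  by (auto simp: C_ring_def Metric_space.fspace_def)

lemma C_ring_continuous: "f \<in> carrier (C_ring K) \<Longrightarrow> continuous_map K euclidean f"
  by (simp add: C_ring_def)

lemma C_ringI:
  assumes "compact_space K" "continuous_map K euclidean f" "f \<in> extensional (topspace K)"
  shows "f \<in> carrier (C_ring K)"
  using assms by (simp add: C_ring_carrier)

lemma C_ring_restrictI:
  assumes "compact_space K" "continuous_map K euclidean f"
  shows "restrict f (topspace K) \<in> carrier (C_ring K)"
  using assms by (intro C_ringI) (auto intro: continuous_map_eq)

lemma C_ring_eqI:
  assumes "f \<in> carrier (C_ring K)" "g \<in> carrier (C_ring K)" "\<And>x. x \<in> topspace K \<Longrightarrow> f x = g x"
  shows "f = g"
  using assms by (intro extensionalityI[of f "topspace K"] C_ring_extensional)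

lemma sup_dist_le:
  assumes "f \<in> carrier (C_ring K)" "g \<in> carrier (C_ring K)" "0 \<le> c"
    and "\<And>x. x \<in> topspace K \<Longrightarrow> cmod (f x - g x) \<le> c"
  shows "mdist (cfunspace K euclidean_metric) f g \<le> c"
  using assms(3,4) by (intro mdist_cfunspace_le) (auto simp: dist_norm)

lemma sup_dist_upper:
  assumes "f \<in> carrier (C_ring K)" "g \<in> carrier (C_ring K)" "x \<in> topspace K"
  shows "cmod (f x - g x) \<le> mdist (cfunspace K euclidean_metric) f g"
  using mdist_cfunspace_imp_mdist_le[OF _ _ order_refl assms(3), of f euclidean_metric g] assms
  by (simp add: C_ring_simps dist_norm del: mspace_cfunspace)

lemma sup_norm_le:
  assumes "compact_space K" "f \<in> carrier (C_ring K)" "0 \<le> c"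
    and "\<And>x. x \<in> topspace K \<Longrightarrow> cmod (f x) \<le> c"
  shows "sup_norm K f \<le> c"
  unfolding sup_norm_def using assms const_fun_in_C_ring[OF assms(1), of 0]
  by (intro sup_dist_le) (auto simp: const_fun_def)

lemma sup_norm_upper:
  assumes "compact_space K" "f \<in> carrier (C_ring K)" "x \<in> topspace K"
  shows "cmod (f x) \<le> sup_norm K f"
  using sup_dist_upper[OF assms(2) const_fun_in_C_ring[OF assms(1), of 0] assms(3)] assms(3)
  by (simp add: sup_norm_def const_fun_def)

lemma sup_norm_nonneg: "0 \<le> sup_norm K f"
  unfolding sup_norm_def by (rule Metric_space.nonneg[OF Metric_space_mspace_mdist])

lemma sup_norm_diff:
  assumes K: "compact_space K" and fg: "f \<in> carrier (C_ring K)" "g \<in> carrier (C_ring K)"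
  shows "sup_norm K (\<lambda>x\<in>topspace K. f x - g x) = mdist (cfunspace K euclidean_metric) f g"
proof (rule antisym)
  have mem: "(\<lambda>x\<in>topspace K. f x - g x) \<in> carrier (C_ring K)"
    using fg by (intro C_ring_restrictI[OF K] continuous_map_diff C_ring_continuous)
  show "sup_norm K (\<lambda>x\<in>topspace K. f x - g x) \<le> mdist (cfunspace K euclidean_metric) f g"
    using sup_dist_upper[OF fg] Metric_space.nonneg[OF Metric_space_mspace_mdist]
    by (intro sup_norm_le[OF K mem]) auto
  show "mdist (cfunspace K euclidean_metric) f g \<le> sup_norm K (\<lambda>x\<in>topspace K. f x - g x)"
    using sup_norm_upper[OF K mem] sup_norm_nonneg by (intro sup_dist_le[OF fg]) auto
qed

lemma uniform_limit_in_C_ring: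
  assumes K: "compact_space K" and s: "\<And>n. s n \<in> carrier (C_ring K)"
    and lim: "uniform_limit (topspace K) s f sequentially"
  shows "restrict f (topspace K) \<in> carrier (C_ring K)"
proof (rule C_ring_restrictI[OF K])
  have "continuous_map K Met_TC.mtopology f"
    using lim C_ring_continuous[OF s]
    by (intro Met_TC.continuous_map_uniform_limit[where F = sequentially and f = s]) (auto simp: uniform_limit_iff)
  then show "continuous_map K euclidean f" by simp
qed

text \<open>\<open>uniform_limit\<close> does not see the values of \<open>f\<close> off
  \<open>topspace K\<close>, whereas elements of \<open>Y\<close> are \<open>undefined\<close>
  there; hence the restriction of the limit.\<close>

lemma closedin_sup_topology_iff:
  assumes K: "compact_space K"
  shows "closedin (sup_topology K) Y \<longleftrightarrow> Y \<subseteq> carrier (C_ring K) \<and>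
    (\<forall>s f. (\<forall>n. s n \<in> Y) \<and> uniform_limit (topspace K) s f sequentially
       \<longrightarrow> restrict f (topspace K) \<in> Y)"
proof -
  let ?m = "cfunspace K (euclidean_metric :: complex metric)"
  interpret M: Metric_space "mspace ?m" "mdist ?m" by (rule Metric_space_mspace_mdist)
  have "limitin M.mtopology s f sequentially \<longleftrightarrow>
      f \<in> carrier (C_ring K) \<and> uniform_limit (topspace K) s f sequentially"
    if s: "\<And>n. s n \<in> carrier (C_ring K)" for s f
  proof -
    have "(\<forall>e>0. \<forall>\<^sub>F n in sequentially. mdist ?m (s n) f < e) \<longleftrightarrow>
        uniform_limit (topspace K) s f sequentially" if f: "f \<in> carrier (C_ring K)"
    proof
      assume *: "\<forall>e>0. \<forall>\<^sub>F n in sequentially. mdist ?m (s n) f < e"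
      show "uniform_limit (topspace K) s f sequentially"
      proof (rule uniform_limitI)
        fix e :: real assume "e > 0"
        with * have "\<forall>\<^sub>F n in sequentially. mdist ?m (s n) f < e" by blast
        then show "\<forall>\<^sub>F n in sequentially. \<forall>x\<in>topspace K. dist (s n x) (f x) < e"
          by eventually_elim (use sup_dist_upper[OF s f] in \<open>auto simp: dist_norm intro: le_less_trans\<close>)
      qed
    next
      assume *: "uniform_limit (topspace K) s f sequentially"
      show "\<forall>e>0. \<forall>\<^sub>F n in sequentially. mdist ?m (s n) f < e"
      proof (intro allI impI)
        fix e :: real assume e: "e > 0"
        with * have "\<forall>\<^sub>F n in sequentially. \<forall>x\<in>topspace K. dist (s n x) (f x) < e/2"
          by (intro uniform_limitD) simp_all
        then show "\<forall>\<^sub>F n in sequentially. mdist ?m (s n) f < e"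
        proof eventually_elim
          case (elim n)
          then have "mdist ?m (s n) f \<le> e/2"
            using e by (intro sup_dist_le[OF s f]) (auto simp: dist_norm intro: less_imp_le)
          then show ?case using e by simp
        qed
      qed
    qed
    then show ?thesis
      using s by (auto simp: M.limitin_metric C_ring_simps eventually_conj_iff simp del: mspace_cfunspace)
  qed
  note lim = this
  have carr: "carrier (C_ring K) = mspace ?m" by (rule C_ring_simps)
  show ?thesis
    unfolding mtopology_of_def M.metric_closedin_iff_sequentially_closed carr
  proof (intro conj_cong refl iffI allI impI)
    fix s f
    assume Y: "Y \<subseteq> mspace ?m"
      and *: "\<forall>\<sigma> l. range \<sigma> \<subseteq> Y \<and> limitin M.mtopology \<sigma> l sequentially \<longrightarrow> l \<in> Y"
      and s: "(\<forall>n. s n \<in> Y) \<and> uniform_limit (topspace K) s f sequentially"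
    have sC: "s n \<in> carrier (C_ring K)" for n unfolding carr using Y s by blast
    have "restrict f (topspace K) \<in> carrier (C_ring K)"
      by (rule uniform_limit_in_C_ring[OF K sC]) (use s in auto)
    moreover have "uniform_limit (topspace K) s (restrict f (topspace K)) sequentially"
      using s by (auto simp: uniform_limit_iff)
    ultimately have "limitin M.mtopology s (restrict f (topspace K)) sequentially"
      using lim[of s "restrict f (topspace K)"] sC by simp
    moreover have "range s \<subseteq> Y" using s by blast
    ultimately show "restrict f (topspace K) \<in> Y" using * by blast
  next
    fix s f
    assume Y: "Y \<subseteq> mspace ?m"
      and *: "\<forall>s f. (\<forall>n. s n \<in> Y) \<and> uniform_limit (topspace K) s f sequentially
       \<longrightarrow> restrict f (topspace K) \<in> Y"
      and s: "range s \<subseteq> Y \<and> limitin M.mtopology s f sequentially"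
    have sC: "s n \<in> carrier (C_ring K)" for n unfolding carr using Y s by blast
    have f: "f \<in> carrier (C_ring K)" "uniform_limit (topspace K) s f sequentially"
      using s lim[of s f] sC by simp_all
    have "\<forall>n. s n \<in> Y" using s by blast
    then have "restrict f (topspace K) \<in> Y" using * f(2) by blast
    then show "f \<in> Y" using C_ring_extensional[OF f(1)] by (simp add: extensional_restrict)
  qed
qed

section \<open>The algebra \<open>A\<close>: closure properties and the sup norm\<close>

locale unif_alg =
  fixes \<Omega> :: "'w topology" and A :: "('w \<Rightarrow> complex) set"
  assumes uniform_algebra: "uniform_algebra \<Omega> A"
begin

abbreviation "S \<equiv> topspace \<Omega>"
abbreviation "N \<equiv> sup_norm \<Omega>"

lemma compact: "compact_space \<Omega>" and subring: "subring A (C_ring \<Omega>)"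
  and closed: "closedin (sup_topology \<Omega>) A" and hausdorff: "Hausdorff_space \<Omega>"
  using uniform_algebra by (auto simp: uniform_algebra_def)

lemma mem_C: "a \<in> A \<Longrightarrow> a \<in> carrier (C_ring \<Omega>)"
  using closed closedin_sup_topology_iff[OF compact] by blast

lemma const_mem: "(\<lambda>x\<in>S. c) \<in> A"
  using uniform_algebra by (auto simp: uniform_algebra_def const_fun_def)

lemma add_mem: "a \<in> A \<Longrightarrow> b \<in> A \<Longrightarrow> (\<lambda>x\<in>S. a x + b x) \<in> A"
  using subgroup.m_closed[of A "add_monoid (C_ring \<Omega>)" a b] subring
  by (simp add: subring_def C_ring_simps)

lemma mult_mem: "a \<in> A \<Longrightarrow> b \<in> A \<Longrightarrow> (\<lambda>x\<in>S. a x * b x) \<in> A"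
  using submonoid.m_closed[of A "C_ring \<Omega>" a b] subring
  by (simp add: subring_def C_ring_simps)

text \<open>Elements of \<open>A\<close> are fixed by restriction to \<open>S\<close>, so membership
  passes from one lambda term to any other that agrees with it on \<open>S\<close>. This disposes of
  nested restrictions.\<close>

lemma mem_cong: "a \<in> A \<Longrightarrow> (\<And>x. x \<in> S \<Longrightarrow> a x = f x) \<Longrightarrow> restrict f S \<in> A"
  using C_ring_extensional[OF mem_C, of a] restrict_ext[of S a f]
  by (simp add: extensional_restrict)

lemma scale_mem: "a \<in> A \<Longrightarrow> (\<lambda>x\<in>S. c * a x) \<in> A"
  by (rule mem_cong[OF mult_mem[OF const_mem[of c]]]) auto

lemma diff_mem: "a \<in> A \<Longrightarrow> b \<in> A \<Longrightarrow> (\<lambda>x\<in>S. a x - b x) \<in> A"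
  by (rule mem_cong[OF add_mem[OF _ scale_mem[of b "-1"]]]) auto

lemma mem_eqI:
  assumes "a \<in> A" "b \<in> A" "\<And>x. x \<in> S \<Longrightarrow> a x = b x"
  shows "a = b"
  using C_ring_eqI[OF mem_C mem_C] assms by blast

lemma restrict_mem: "a \<in> A \<Longrightarrow> restrict a S = a"
  using C_ring_extensional[OF mem_C] by (simp add: extensional_restrict)

lemma sum_mem: "(\<And>i. i < n \<Longrightarrow> b i \<in> A) \<Longrightarrow> (\<lambda>x\<in>S. \<Sum>i<(n::nat). b i x) \<in> A"
proof (induction n)
  case 0
  show ?case by (rule mem_cong[OF const_mem[of 0]]) auto
next
  case (Suc n)
  show ?case
    by (rule mem_cong[OF add_mem[OF Suc.IH[OF Suc.prems] Suc.prems[of n]]]) auto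
qed

lemma power_mem: "a \<in> A \<Longrightarrow> (\<lambda>x\<in>S. a x ^ n) \<in> A"
proof (induction n)
  case 0
  show ?case by (rule mem_cong[OF const_mem[of 1]]) auto
next
  case (Suc n)
  show ?case by (rule mem_cong[OF mult_mem[OF Suc.prems Suc.IH[OF Suc.prems]]]) auto
qed

lemma uniform_limit_mem:
  assumes "\<And>n. s n \<in> A" "uniform_limit S s f sequentially"
  shows "restrict f S \<in> A"
  using closed assms unfolding closedin_sup_topology_iff[OF compact] by blast

lemma N_upper: "a \<in> A \<Longrightarrow> x \<in> S \<Longrightarrow> cmod (a x) \<le> N a"
  using sup_norm_upper[OF compact mem_C] .

lemma N_le: "a \<in> A \<Longrightarrow> 0 \<le> c \<Longrightarrow> (\<And>x. x \<in> S \<Longrightarrow> cmod (a x) \<le> c) \<Longrightarrow> N a \<le> c"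
  using sup_norm_le[OF compact mem_C] .

lemma N_nonneg: "0 \<le> N a"
  by (rule sup_norm_nonneg)

lemma N_add: "a \<in> A \<Longrightarrow> b \<in> A \<Longrightarrow> N (\<lambda>x\<in>S. a x + b x) \<le> N a + N b"
  by (rule N_le[OF add_mem])
     (auto intro!: add_mono N_nonneg add_nonneg_nonneg norm_triangle_le N_upper)

lemma N_diff: "a \<in> A \<Longrightarrow> b \<in> A \<Longrightarrow> N (\<lambda>x\<in>S. a x - b x) \<le> N a + N b"
  by (rule N_le[OF diff_mem])
     (auto intro!: add_mono N_nonneg add_nonneg_nonneg norm_triangle_le_diff N_upper)

lemma N_mult: "a \<in> A \<Longrightarrow> b \<in> A \<Longrightarrow> N (\<lambda>x\<in>S. a x * b x) \<le> N a * N b"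
  by (rule N_le[OF mult_mem]) (auto simp: norm_mult intro!: mult_mono mult_nonneg_nonneg N_nonneg N_upper)

lemma N_scale:
  assumes "a \<in> A"
  shows "N (\<lambda>x\<in>S. c * a x) = cmod c * N a"
proof (rule antisym)
  have le: "N (\<lambda>x\<in>S. c * a x) \<le> cmod c * N a" if "a \<in> A" for c a
    by (rule N_le[OF scale_mem[OF that]])
       (auto simp: norm_mult intro!: mult_left_mono mult_nonneg_nonneg N_nonneg N_upper that)
  show "N (\<lambda>x\<in>S. c * a x) \<le> cmod c * N a" using le assms .
  \<comment> \<open>The reverse inequality is the first one for the factor \<open>inverse c\<close>,
    applied to \<open>c\<close> times \<open>a\<close>.\<close>
  show "cmod c * N a \<le> N (\<lambda>x\<in>S. c * a x)"
  proof (cases "c = 0")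
    case False
    have "(\<lambda>x\<in>S. inverse c * (\<lambda>x\<in>S. c * a x) x) = (\<lambda>x\<in>S. a x)"
      using False by (intro restrict_ext) simp
    then have "N a \<le> cmod (inverse c) * N (\<lambda>x\<in>S. c * a x)"
      using le[OF scale_mem[OF assms], of "inverse c" c] assms by (simp add: restrict_mem)
    then show ?thesis using False by (simp only: norm_inverse) (simp add: divide_simps mult.commute)
  qed (auto simp: N_nonneg)
qed

text \<open>Equality fails for empty \<open>S\<close>, where every function has norm
  \<open>0\<close>.\<close>

lemma N_const_le: "N (\<lambda>x\<in>S. c) \<le> cmod c"
  by (rule N_le[OF const_mem]) auto

lemma N_eq_0: "a \<in> A \<Longrightarrow> N a = 0 \<longleftrightarrow> a = (\<lambda>x\<in>S. 0)"
proof
  assume a: "a \<in> A" "N a = 0"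
  show "a = (\<lambda>x\<in>S. 0)" using N_upper[OF a(1)] a(2) by (intro mem_eqI[OF a(1) const_mem]) simp
next
  assume "a = (\<lambda>x\<in>S. 0)"
  then show "N a = 0" using N_const_le[of 0] N_nonneg[of a] by simp
qed

text \<open>The partial sums of the exponential series are polynomials in \<open>q\<close>, and they
  converge uniformly by the M-test with majorants \<open>N q ^ n / fact n\<close>. Exponentials
  provide the peaking functions.\<close>

lemma exp_mem:
  assumes "q \<in> A"
  shows "(\<lambda>x\<in>S. exp (q x)) \<in> A"
proof -
  have "uniform_limit S (\<lambda>n x. \<Sum>i<n. q x ^ i /\<^sub>R fact i) (\<lambda>x. \<Sum>i. q x ^ i /\<^sub>R fact i) sequentially"
  proof (rule Weierstrass_m_test)
    show "norm (q x ^ n /\<^sub>R fact n) \<le> N q ^ n /\<^sub>R fact n" if "x \<in> S" for n x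
      using N_upper[OF assms that] by (simp add: norm_power power_mono divide_inverse mult_left_mono)
    show "summable (\<lambda>n. N q ^ n /\<^sub>R fact n)" by (rule summable_exp_generic)
  qed
  then have lim: "uniform_limit S (\<lambda>n. \<lambda>x\<in>S. \<Sum>i<n. q x ^ i /\<^sub>R fact i) (\<lambda>x. exp (q x)) sequentially"
    by (auto simp: exp_def uniform_limit_iff)
  have "(\<lambda>x\<in>S. \<Sum>i<n. (\<lambda>x\<in>S. of_real (inverse (fact i)) * (\<lambda>x\<in>S. q x ^ i) x) x) \<in> A" for n
    by (intro sum_mem scale_mem power_mem assms)
  then have "(\<lambda>x\<in>S. \<Sum>i<n. q x ^ i /\<^sub>R fact i) \<in> A" for n
    by (rule mem_cong) (auto simp: scaleR_conv_of_real)
  with lim show ?thesis by (rule uniform_limit_mem[rotated])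
qed

end

subsection \<open>Approximate multipliers and bounded inverses\<close>

context unif_alg
begin

definition linear_map :: "(('w \<Rightarrow> complex) \<Rightarrow> 'w \<Rightarrow> complex) \<Rightarrow> bool" where
  "linear_map L \<longleftrightarrow> (\<forall>a\<in>A. L a \<in> A) \<and>
     (\<forall>a\<in>A. \<forall>b\<in>A. L (\<lambda>x\<in>S. a x + b x) = (\<lambda>x\<in>S. L a x + L b x)) \<and>
     (\<forall>c. \<forall>a\<in>A. L (\<lambda>x\<in>S. c * a x) = (\<lambda>x\<in>S. c * L a x))"

lemma linear_mapD:
  assumes "linear_map L"
  shows "a \<in> A \<Longrightarrow> L a \<in> A"
    and "a \<in> A \<Longrightarrow> b \<in> A \<Longrightarrow> L (\<lambda>x\<in>S. a x + b x) = (\<lambda>x\<in>S. L a x + L b x)"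
    and "a \<in> A \<Longrightarrow> L (\<lambda>x\<in>S. c * a x) = (\<lambda>x\<in>S. c * L a x)"
  using assms by (auto simp: linear_map_def)

lemma linear_map_diff:
  assumes L: "linear_map L" and a: "a \<in> A" "b \<in> A"
  shows "L (\<lambda>x\<in>S. a x - b x) = (\<lambda>x\<in>S. L a x - L b x)"
proof -
  have "(\<lambda>x\<in>S. a x - b x) = (\<lambda>x\<in>S. a x + (\<lambda>x\<in>S. (- 1) * b x) x)"
    by (intro restrict_ext) simp
  then have "L (\<lambda>x\<in>S. a x - b x) = L (\<lambda>x\<in>S. a x + (\<lambda>x\<in>S. (- 1) * b x) x)"
    by (rule arg_cong)
  also have "\<dots> = (\<lambda>x\<in>S. L a x + (\<lambda>x\<in>S. (- 1) * L b x) x)"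
    unfolding linear_mapD(2)[OF L a(1) scale_mem[OF a(2)]] linear_mapD(3)[OF L a(2)] ..
  also have "\<dots> = (\<lambda>x\<in>S. L a x - L b x)"
    by (intro restrict_ext) simp
  finally show ?thesis .
qed

lemma linear_map_0:
  assumes L: "linear_map L"
  shows "L (\<lambda>x\<in>S. 0) = (\<lambda>x\<in>S. 0)"
proof -
  have "(\<lambda>x\<in>S. 0 * (\<lambda>x\<in>S. 0) x) = (\<lambda>x\<in>S. (0::complex))" by (intro restrict_ext) simp
  then show ?thesis using linear_mapD(3)[OF L const_mem[of 0], of 0] by simp
qed

section \<open>Peaking functions and approximate multipliers\<close>

lemma attains_sup:
  assumes "continuous_map \<Omega> euclideanreal f" "S \<noteq> {}"
  obtains x0 where "x0 \<in> S" "\<And>x. x \<in> S \<Longrightarrow> f x \<le> f x0"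
proof -
  have "compactin euclideanreal (f ` S)"
    using image_compactin[OF _ assms(1)] compact by (simp add: compact_space_def)
  then have "compact (f ` S)" by simp
  then obtain y where "y \<in> f ` S" "\<forall>t\<in>f ` S. t \<le> y"
    using compact_attains_sup[of "f ` S"] assms(2) by auto
  then show thesis using that by auto
qed

text \<open>
  Since \<open>x\<^sub>0\<close> maximises
  \<open>Re u + \<bar>a\<bar>\<^sup>2\<close>, the function \<open>q = u - u x\<^sub>0 + 2 cnj (a x\<^sub>0) (a - a x\<^sub>0)\<close> satisfies
  \<open>Re q \<le> - \<bar>a - a x\<^sub>0\<bar>\<^sup>2\<close>, and \<open>f = exp (n q)\<close> for large \<open>n\<close>.
\<close>

lemma peaking_function:
  assumes u: "u \<in> A" and a: "a \<in> A" and x0: "x0 \<in> S" and \<theta>: "\<theta> > 0"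
    and max: "\<And>x. x \<in> S \<Longrightarrow> Re (u x) + (cmod (a x))\<^sup>2 \<le> Re (u x0) + (cmod (a x0))\<^sup>2"
  obtains f where "f \<in> A" "f x0 = 1" "\<And>x. x \<in> S \<Longrightarrow> cmod (f x) \<le> 1"
    "\<And>x. x \<in> S \<Longrightarrow> \<theta> \<le> cmod (a x - a x0) \<Longrightarrow> cmod (f x) \<le> 1/2"
proof
  define q where "q = (\<lambda>x\<in>S. (u x - u x0) + 2 * cnj (a x0) * (a x - a x0))"
  have "q \<in> A"
    unfolding q_def
    by (rule mem_cong[OF add_mem[OF diff_mem[OF u const_mem[of "u x0"]]
            scale_mem[OF diff_mem[OF a const_mem[of "a x0"]], of "2 * cnj (a x0)"]]]) auto
  \<comment> \<open>Maximality bounds \<open>Re (u x - u x0)\<close> by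
    \<open>|a x0|^2 - |a x|^2\<close>, which equals
    \<open>- 2 Re (cnj (a x0) (a x - a x0)) - |a x - a x0|^2\<close>; the second summand of
    \<open>q\<close> cancels the linear term.\<close>
  have Req: "Re (q x) \<le> - (cmod (a x - a x0))\<^sup>2" if "x \<in> S" for x
    using max[OF that] that unfolding q_def cmod_power2
    by (simp add: power2_eq_square algebra_simps)
  \<comment> \<open>A real multiple will do under \<open>exp\<close>. With this one
    \<open>n * \<theta>\<^sup>2 = 1\<close>, and the required \<open>1/2\<close> comes from
    \<open>exp (-1) \<le> 1/2\<close>.\<close>
  define n where "n = 1 / \<theta>\<^sup>2"
  have n: "n \<ge> 0" by (simp add: n_def)
  define f where "f = (\<lambda>x\<in>S. exp ((\<lambda>x\<in>S. of_real n * q x) x))"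
  show "f \<in> A" unfolding f_def by (intro exp_mem scale_mem \<open>q \<in> A\<close>)
  show "f x0 = 1" using x0 by (simp add: f_def q_def)
  have cf: "cmod (f x) = exp (n * Re (q x))" if "x \<in> S" for x using that by (simp add: f_def)
  fix x assume x: "x \<in> S"
  have "Re (q x) \<le> 0" using Req[OF x] by (smt (verit) zero_le_power2)
  then show "cmod (f x) \<le> 1" using cf[OF x] n by (simp add: mult_nonneg_nonpos)
  assume "\<theta> \<le> cmod (a x - a x0)"
  then have "\<theta>\<^sup>2 \<le> (cmod (a x - a x0))\<^sup>2" using \<theta> by (intro power_mono) auto
  then have "Re (q x) \<le> - \<theta>\<^sup>2" using Req[OF x] by linarith
  then have "n * Re (q x) \<le> n * (- \<theta>\<^sup>2)" using n by (rule mult_left_mono)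
  also have "\<dots> = -1" using \<theta> by (simp add: n_def)
  finally have "cmod (f x) \<le> exp (-1)" using cf[OF x] by simp
  also have "\<dots> \<le> 1/2" using exp_ge_add_one_self[of "1::real"] by (simp add: exp_minus field_simps)
  finally show "cmod (f x) \<le> 1/2" .
qed

text \<open>
  For \<open>\<epsilon> = 0\<close> the inequality says that \<open>\<bar>R a\<bar> + \<kappa> \<bar>v\<bar>\<close> is dominated in sup norm by
  \<open>\<kappa> (\<bar>a\<bar> + \<bar>v\<bar>)\<close>, which characterises multiplications by functions of norm at most \<open>\<kappa>\<close>.
\<close>

lemma approximate_multiplier:
  assumes R: "linear_map R" and \<epsilon>: "\<epsilon> \<ge> 0" and \<kappa>: "\<kappa> \<ge> 0"
    and ineq: "\<And>a v x B. a \<in> A \<Longrightarrow> v \<in> A \<Longrightarrow> x \<in> S \<Longrightarrow>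
      (\<And>t. t \<in> S \<Longrightarrow> cmod (a t) + cmod (v t) \<le> B) \<Longrightarrow>
      cmod (R a x) + \<kappa> * cmod (v x) \<le> (1 + \<epsilon>) * \<kappa> * B"
    and a: "a \<in> A"
  shows "N (\<lambda>x\<in>S. R a x - R (\<lambda>x\<in>S. 1) x * a x) \<le> 4 * \<epsilon> * \<kappa> * N a"
proof -
  define u where "u = (\<lambda>x\<in>S. R a x - R (\<lambda>x\<in>S. 1) x * a x)"
  have one: "(\<lambda>x\<in>S. 1) \<in> A" by (rule const_mem)
  have u: "u \<in> A"
    unfolding u_def
    by (rule mem_cong[OF diff_mem[OF linear_mapD(1)[OF R a] mult_mem[OF linear_mapD(1)[OF R one] a]]]) auto
  define M where "M = N a"
  have M: "M \<ge> 0" and aM: "\<And>x. x \<in> S \<Longrightarrow> cmod (a x) \<le> M"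
    using N_nonneg N_upper[OF a] by (auto simp: M_def)
  have bound: "cmod (u x1) \<le> 4 * \<epsilon> * \<kappa> * M + ((1 + \<epsilon>) * \<kappa> + 1) * \<theta>" if x1: "x1 \<in> S" and \<theta>: "\<theta> > 0" for x1 \<theta>
  proof -
    \<comment> \<open>The weight makes \<open>Re w\<close> dominate in the maximisation: the term
      \<open>(cmod (a x))\<^sup>2\<close> is at most \<open>M\<^sup>2\<close>, so it costs at most
      \<open>M\<^sup>2 / l \<le> \<theta>\<close> when \<open>u x1\<close> is compared with
      \<open>u x0\<close>. The \<open>1\<close> keeps \<open>l\<close> positive when
      \<open>M = 0\<close>.\<close>
    define l where "l = (M\<^sup>2 + 1) / \<theta>"
    have l: "l > 0" using \<theta> by (simp add: l_def add_nonneg_pos)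
    define \<alpha> where "\<alpha> = cnj (sgn (u x1))"
    have \<alpha>1: "cmod \<alpha> \<le> 1" by (simp add: \<alpha>_def norm_sgn)
    have \<alpha>u: "Re (\<alpha> * u x1) = cmod (u x1)"
      by (simp add: \<alpha>_def sgn_div_norm scaleR_conv_of_real cmod_def power2_eq_square field_simps)
         (metis real_sqrt_mult_self abs_of_nonneg sum_squares_ge_zero add_divide_distrib real_div_sqrt)
    define w where "w = (\<lambda>x\<in>S. (of_real l * \<alpha>) * u x)"
    have w: "w \<in> A" unfolding w_def by (rule scale_mem[OF u])
    have "continuous_map \<Omega> euclideanreal (\<lambda>x. Re (w x) + (cmod (a x))\<^sup>2)"
      using C_ring_continuous[OF mem_C[OF w]] C_ring_continuous[OF mem_C[OF a]]
      by (intro continuous_map_add continuous_map_real_pow continuous_map_norm)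
         (auto simp: continuous_map_atin intro: tendsto_Re)
    then obtain x0 where x0: "x0 \<in> S"
      and max: "\<And>x. x \<in> S \<Longrightarrow> Re (w x) + (cmod (a x))\<^sup>2 \<le> Re (w x0) + (cmod (a x0))\<^sup>2"
      using attains_sup x1 by blast
    obtain f where f: "f \<in> A" "f x0 = 1" "\<And>x. x \<in> S \<Longrightarrow> cmod (f x) \<le> 1"
      "\<And>x. x \<in> S \<Longrightarrow> \<theta> \<le> cmod (a x - a x0) \<Longrightarrow> cmod (f x) \<le> 1/2"
      using peaking_function[OF w a x0 \<theta> max] by blast
    \<comment> \<open>Linearity gives \<open>R d x0 = u x0\<close>. Always
      \<open>cmod d \<le> 2 M\<close>; where \<open>cmod d \<ge> \<theta>\<close> also
      \<open>cmod v \<le> 2 M\<close>, and elsewhere \<open>cmod d < \<theta>\<close> and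
      \<open>cmod v \<le> 4 M\<close>. So the sum of the moduli is at most
      \<open>4 M + \<theta>\<close>, and since \<open>cmod (v x0) = 4 M\<close>, the inequality
      leaves only terms with \<open>\<epsilon>\<close> or \<open>\<theta>\<close> for
      \<open>u x0\<close>.\<close>
    define d where "d = (\<lambda>x\<in>S. a x - (\<lambda>x\<in>S. a x0 * (\<lambda>x\<in>S. 1) x) x)"
    define v where "v = (\<lambda>x\<in>S. of_real (4 * M) * f x)"
    have d: "d \<in> A" unfolding d_def by (intro diff_mem scale_mem a one)
    have v: "v \<in> A" unfolding v_def by (intro scale_mem f)
    have "cmod (d t) + cmod (v t) \<le> 4 * M + \<theta>" if t: "t \<in> S" for t
    proof (cases "\<theta> \<le> cmod (a t - a x0)")
      case True
      have "cmod (a t - a x0) \<le> M + M"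
        using aM[OF t] aM[OF x0] by (intro norm_triangle_le_diff) simp
      moreover have "4 * M * cmod (f t) \<le> 4 * M * (1/2)"
        using f(4)[OF t True] M by (intro mult_left_mono) auto
      ultimately show ?thesis using t M \<theta> by (simp add: d_def v_def norm_mult)
    next
      case False
      moreover have "4 * M * cmod (f t) \<le> 4 * M * 1"
        using f(3)[OF t] M by (intro mult_left_mono) auto
      ultimately show ?thesis using t M by (simp add: d_def v_def norm_mult)
    qed
    then have "cmod (R d x0) + \<kappa> * cmod (v x0) \<le> (1 + \<epsilon>) * \<kappa> * (4 * M + \<theta>)"
      by (rule ineq[OF d v x0])
    moreover have "cmod (v x0) = 4 * M" using x0 M f(2) by (simp add: v_def)
    moreover have "R d x0 = u x0"
      unfolding d_def linear_map_diff[OF R a scale_mem[OF one]] linear_mapD(3)[OF R one]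
      using x0 by (simp add: u_def)
    ultimately have ux0: "cmod (u x0) \<le> 4 * \<epsilon> * \<kappa> * M + (1 + \<epsilon>) * \<kappa> * \<theta>"
      by (simp add: algebra_simps)
    have "Re (\<alpha> * u x0) \<le> cmod (\<alpha> * u x0)" by (rule complex_Re_le_cmod)
    also have "\<dots> \<le> 1 * cmod (u x0)" unfolding norm_mult using \<alpha>1 by (intro mult_right_mono) auto
    finally have "l * Re (\<alpha> * u x0) \<le> l * cmod (u x0)" using l by simp
    moreover have "Re (w x) = l * Re (\<alpha> * u x)" if "x \<in> S" for x
      using that by (simp add: w_def mult.assoc)
    moreover have "(cmod (a x0))\<^sup>2 \<le> M\<^sup>2" using aM[OF x0] by (intro power_mono) auto
    ultimately have "l * cmod (u x1) \<le> l * cmod (u x0) + M\<^sup>2"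
      using max[OF x1] x0 x1 \<alpha>u by (smt (verit) zero_le_power2)
    also have "\<dots> \<le> l * (cmod (u x0) + \<theta>)"
      using \<theta> by (simp add: l_def distrib_left)
    finally have "cmod (u x1) \<le> cmod (u x0) + \<theta>" using l by simp
    then show ?thesis using ux0 by (simp add: algebra_simps)
  qed
  have "cmod (u x1) \<le> 4 * \<epsilon> * \<kappa> * M" if x1: "x1 \<in> S" for x1
  proof (rule field_le_epsilon)
    fix e :: real assume e: "e > 0"
    define m where "m = (1 + \<epsilon>) * \<kappa> + 1"
    have m: "m > 0" using \<epsilon> \<kappa> by (simp add: m_def add_nonneg_pos)
    have "cmod (u x1) \<le> 4 * \<epsilon> * \<kappa> * M + m * (e / m)"
      unfolding m_def using m e by (intro bound[OF x1]) (simp add: m_def)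
    then show "cmod (u x1) \<le> 4 * \<epsilon> * \<kappa> * M + e" using m by simp
  qed
  then show ?thesis
    unfolding u_def[symmetric] M_def[symmetric] using M \<epsilon> \<kappa> by (intro N_le[OF u]) auto
qed

section \<open>Successive approximation and the bounded inverse theorem\<close>

lemma geometric_series_mem:
  assumes b: "\<And>n. b n \<in> A" and bound: "\<And>n. N (b n) \<le> C * (1/2) ^ n"
  obtains s where "s \<in> A" "\<And>n. N (\<lambda>x\<in>S. s x - (\<Sum>i<n. b i x)) \<le> 2 * C * (1/2) ^ n"
proof
  have C: "C \<ge> 0" using bound[of 0] N_nonneg[of "b 0"] by simp
  have sm: "summable (\<lambda>n. C * (1/2) ^ n)" by (intro summable_mult summable_geometric) simp
  have bx: "cmod (b n x) \<le> C * (1/2) ^ n" if "x \<in> S" for n x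
    using N_upper[OF b that] bound order_trans by blast
  define s where "s = (\<lambda>x\<in>S. \<Sum>i. b i x)"
  have "uniform_limit S (\<lambda>n x. \<Sum>i<n. b i x) (\<lambda>x. \<Sum>i. b i x) sequentially"
    by (rule Weierstrass_m_test[OF bx sm])
  then have "uniform_limit S (\<lambda>n. \<lambda>x\<in>S. \<Sum>i<n. b i x) (\<lambda>x. \<Sum>i. b i x) sequentially"
    by (auto simp: uniform_limit_iff)
  then show "s \<in> A"
    unfolding s_def by (rule uniform_limit_mem[rotated]) (intro sum_mem b)
  then have mem: "(\<lambda>x\<in>S. s x - (\<Sum>i<n. b i x)) \<in> A" for n
    by (rule mem_cong[OF diff_mem[OF _ sum_mem[of n b]]]) (auto intro: b)
  \<comment> \<open>The tail from \<open>n\<close> on is again geometric. Later the case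
    \<open>n = 0\<close> bounds the norm of the sum, and large \<open>n\<close> lets a bounded
    linear map pass through the series.\<close>
  show "N (\<lambda>x\<in>S. s x - (\<Sum>i<n. b i x)) \<le> 2 * C * (1/2) ^ n" for n
  proof (rule N_le[OF mem])
    fix x assume x: "x \<in> S"
    have sb: "summable (\<lambda>i. cmod (b i x))"
      using bx[OF x] by (intro summable_comparison_test'[OF sm]) auto
    have "s x - (\<Sum>i<n. b i x) = (\<Sum>i. b (i + n) x)"
      using x suminf_minus_initial_segment[OF summable_norm_cancel[OF sb]] by (simp add: s_def)
    also have "cmod \<dots> \<le> (\<Sum>i. C * (1/2) ^ n * (1/2) ^ i)"
    proof (rule order_trans[OF summable_norm suminf_le])
      show "summable (\<lambda>i. cmod (b (i + n) x))" using sb by (rule summable_ignore_initial_segment)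
      then show "summable (\<lambda>i. cmod (b (i + n) x))" .
      show "cmod (b (i + n) x) \<le> C * (1/2) ^ n * (1/2) ^ i" for i
        using bx[OF x, of "i + n"] by (simp add: power_add mult_ac)
      show "summable (\<lambda>i. C * (1/2) ^ n * (1/2::real) ^ i)"
        by (intro summable_mult summable_geometric) simp
    qed
    also have "\<dots> = 2 * C * (1/2) ^ n"
      by (subst suminf_mult) (auto simp: suminf_geometric summable_geometric)
    finally show "cmod ((\<lambda>x\<in>S. s x - (\<Sum>i<n. b i x)) x) \<le> 2 * C * (1/2) ^ n" using x by simp
  qed (use C in auto)
qed

lemma linear_map_sum:
  assumes L: "linear_map L" and b: "\<And>i. b i \<in> A"
  shows "L (\<lambda>x\<in>S. \<Sum>i<(n::nat). b i x) = (\<lambda>x\<in>S. \<Sum>i<n. L (b i) x)"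
proof (induction n)
  case 0
  show ?case using linear_map_0[OF L] by (simp only: lessThan_0 sum.empty)
next
  case (Suc n)
  have "(\<lambda>x\<in>S. \<Sum>i<Suc n. b i x) = (\<lambda>x\<in>S. (\<lambda>x\<in>S. \<Sum>i<n. b i x) x + b n x)"
    by (intro restrict_ext) simp
  then have "L (\<lambda>x\<in>S. \<Sum>i<Suc n. b i x) = L (\<lambda>x\<in>S. (\<lambda>x\<in>S. \<Sum>i<n. b i x) x + b n x)"
    by (rule arg_cong)
  also have "\<dots> = (\<lambda>x\<in>S. (\<lambda>x\<in>S. \<Sum>i<n. L (b i) x) x + L (b n) x)"
    unfolding linear_mapD(2)[OF L sum_mem[OF b] b] Suc ..
  also have "\<dots> = (\<lambda>x\<in>S. \<Sum>i<Suc n. L (b i) x)" by (intro restrict_ext) simp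
  finally show ?case .
qed

text \<open>Solving approximately for the remainder, again and again, halves the remainder each
  time, so the corrections form a geometric series whose sum is an exact solution; the factor
  \<open>2\<close> sums that series. It serves both the open mapping argument and a map close to the
  identity.\<close>

lemma approximately_surjective:
  assumes L: "linear_map L" and bdd: "\<And>a. a \<in> A \<Longrightarrow> N (L a) \<le> B * N a"
    and approx: "\<And>u. u \<in> A \<Longrightarrow> \<exists>b\<in>A. N b \<le> C * N u \<and> N (\<lambda>x\<in>S. u x - L b x) \<le> N u / 2"
    and u: "u \<in> A"
  shows "\<exists>b\<in>A. L b = u \<and> N b \<le> 2 * C * N u"
proof -
  obtain g where g: "\<And>u. u \<in> A \<Longrightarrow> g u \<in> A" "\<And>u. u \<in> A \<Longrightarrow> N (g u) \<le> C * N u"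
    "\<And>u. u \<in> A \<Longrightarrow> N (\<lambda>x\<in>S. u x - L (g u) x) \<le> N u / 2"
    using approx by metis
  define r where "r = rec_nat u (\<lambda>_ v. \<lambda>x\<in>S. v x - L (g v) x)"
  have r0: "r 0 = u" and rS: "r (Suc n) = (\<lambda>x\<in>S. r n x - L (g (r n)) x)" for n
    by (simp_all add: r_def)
  have rA: "r n \<in> A" for n
  proof (induction n)
    case (Suc n)
    show ?case unfolding rS by (intro diff_mem linear_mapD(1)[OF L] g Suc)
  qed (simp add: r0 u)
  have rN: "N (r n) \<le> N u * (1/2) ^ n" for n
  proof (induction n)
    case (Suc n)
    have "N (r (Suc n)) \<le> N (r n) / 2" unfolding rS by (rule g(3)[OF rA])
    also have "\<dots> \<le> N u * (1/2) ^ Suc n" using Suc by simp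
    finally show ?case .
  qed (simp add: r0)
  define b where "b n = g (r n)" for n
  have bA: "b n \<in> A" for n unfolding b_def by (intro g rA)
  \<comment> \<open>The sign of \<open>C\<close> follows from
    \<open>0 \<le> N (g u) \<le> C * N u\<close>, unless \<open>N u = 0\<close>; then every
    remainder has norm \<open>0\<close>.\<close>
  have C: "0 \<le> C \<or> N u = 0"
    using g(2)[OF u] N_nonneg[of "g u"] N_nonneg[of u] by (metis le_less_trans mult_neg_pos not_le order_less_le)
  have bN: "N (b n) \<le> C * N u * (1/2) ^ n" for n
  proof -
    have "N (b n) \<le> C * N (r n)" unfolding b_def by (intro g rA)
    also have "\<dots> \<le> C * (N u * (1/2) ^ n)"
      using C rN[of n] N_nonneg[of "r n"] by (auto intro: mult_left_mono)
    finally show ?thesis by simp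
  qed
  obtain s where s: "s \<in> A" "\<And>n. N (\<lambda>x\<in>S. s x - (\<Sum>i<n. b i x)) \<le> 2 * (C * N u) * (1/2) ^ n"
    using geometric_series_mem[OF bA bN] by blast
  have tail: "(\<lambda>x\<in>S. s x - (\<Sum>i<n. b i x)) \<in> A" for n
    by (rule mem_cong[OF diff_mem[OF s(1) sum_mem[of n b]]]) (auto intro: bA)
  have sum: "(\<Sum>i<n. L (b i) x) = u x - r n x" if "x \<in> S" for n x
    using that by (induction n) (simp_all add: r0 rS b_def)
  have "L s = u"
  proof (rule mem_eqI[OF linear_mapD(1)[OF L s(1)] u])
    fix x assume x: "x \<in> S"
    have "cmod (L s x - u x) \<le> (\<bar>B\<bar> * (2 * (C * N u)) + N u) * (1/2) ^ n" for n
    proof -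
      have tail_eq: "(\<lambda>x\<in>S. s x - (\<Sum>i<n. b i x)) = (\<lambda>x\<in>S. s x - (\<lambda>x\<in>S. \<Sum>i<n. b i x) x)"
        by (intro restrict_ext) simp
      have "L (\<lambda>x\<in>S. s x - (\<Sum>i<n. b i x)) x = L s x - (\<Sum>i<n. L (b i) x)"
        unfolding tail_eq linear_map_diff[OF L s(1) sum_mem[OF bA]] linear_map_sum[OF L bA]
        using x by simp
      then have "L s x - u x = L (\<lambda>x\<in>S. s x - (\<Sum>i<n. b i x)) x - r n x"
        using sum[OF x] by simp
      also have "cmod \<dots> \<le> N (L (\<lambda>x\<in>S. s x - (\<Sum>i<n. b i x))) + N (r n)"
        by (intro norm_triangle_le_diff add_mono N_upper x rA linear_mapD(1)[OF L] tail)
      also have "\<dots> \<le> \<bar>B\<bar> * (2 * (C * N u) * (1/2) ^ n) + N u * (1/2) ^ n"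
      proof (intro add_mono rN order_trans[OF bdd[OF tail]] mult_mono s)
      qed (auto simp: N_nonneg)
      finally show ?thesis by (simp add: algebra_simps)
    qed
    moreover have "(\<lambda>n. (\<bar>B\<bar> * (2 * (C * N u)) + N u) * (1/2) ^ n) \<longlonglongrightarrow> 0"
      by (intro tendsto_mult_right_zero LIMSEQ_realpow_zero) auto
    ultimately have "cmod (L s x - u x) \<le> 0"
      by (intro tendsto_lowerbound[of _ 0 sequentially]) auto
    then show "L s x = u x" by simp
  qed
  moreover have "(\<lambda>x\<in>S. s x - (\<Sum>i<(0::nat). b i x)) = s"
    using restrict_mem[OF s(1)] by simp
  ultimately show ?thesis using s(1) s(2)[of 0] by (intro bexI[of _ s]) auto
qed

lemma N_scale_real:
  "a \<in> A \<Longrightarrow> 0 \<le> c \<Longrightarrow> N (\<lambda>x\<in>S. complex_of_real c * a x) = c * N a"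
  unfolding N_scale by simp

text \<open>Banach's inverse theorem on \<open>A\<close>, which is complete because it is closed. By
  Baire's theorem the closure \<open>F n\<close> of the image of some ball contains a ball about
  some \<open>a0\<close>; taking differences moves it to the origin, and
  \<open>approximately_surjective\<close> replaces the closure by the image itself.\<close>

lemma bounded_inverse:
  assumes L: "linear_map L" and bdd: "\<And>a. a \<in> A \<Longrightarrow> N (L a) \<le> B * N a"
    and bij: "bij_betw L A A"
  obtains C where "C > 0" "\<And>a. a \<in> A \<Longrightarrow> N a \<le> C * N (L a)"
proof -
  let ?m = "cfunspace \<Omega> (euclidean_metric :: complex metric)"
  have carr: "carrier (C_ring \<Omega>) = mspace ?m" by (rule C_ring_simps)
  have img: "L ` A = A" using bij by (simp add: bij_betw_def)
  interpret M: Submetric "mspace ?m" "mdist ?m" A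
    using mem_C carr by (intro Submetric.intro Metric_space_mspace_mdist Submetric_axioms.intro) auto
  have dist: "mdist ?m a b = N (\<lambda>x\<in>S. a x - b x)" if "a \<in> A" "b \<in> A" for a b
    using sup_norm_diff[OF compact mem_C mem_C] that by simp
  have "mcomplete_of ?m"
    using Met_TC.mcomplete_cfunspace[where 'a = complex] complete_UNIV
    by (simp add: euclidean_metric_def Met_TC.Self_def)
  then have "M.sub.mcomplete"
    using closed unfolding mtopology_of_def mcomplete_of_def
    by (simp add: M.closedin_eq_mcomplete[symmetric])
  define F where "F n = M.sub.mtopology closure_of (L ` {a \<in> A. N a \<le> real n})" for n :: nat
  have FA: "F n \<subseteq> A" for n
    unfolding F_def using closure_of_subset_topspace[of M.sub.mtopology] by auto
  have "A \<subseteq> \<Union> (range F)"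
  proof
    fix a assume "a \<in> A"
    then obtain b where b: "b \<in> A" "a = L b" using img by blast
    obtain n where "N b \<le> real n" using real_arch_simple by blast
    then have "a \<in> L ` {a \<in> A. N a \<le> real n}" using b by blast
    moreover have "L ` {a \<in> A. N a \<le> real n} \<subseteq> F n"
      unfolding F_def using linear_mapD(1)[OF L] by (intro closure_of_subset) auto
    ultimately show "a \<in> \<Union> (range F)" by blast
  qed
  then have "\<Union> (range F) = topspace M.sub.mtopology" using FA by auto
  then have "M.sub.mtopology interior_of \<Union> (range F) \<noteq> {}"
    using const_mem[of 0] by (simp only: interior_of_topspace) auto
  moreover have "M.sub.mtopology interior_of \<Union> (range F) = {}"
    if "\<And>n. M.sub.mtopology interior_of F n = {}"
    using that by (intro M.sub.metric_Baire_category_alt \<open>M.sub.mcomplete\<close>) (auto simp: F_def)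
  ultimately obtain n where "M.sub.mtopology interior_of F n \<noteq> {}" by blast
  then obtain a0 where "a0 \<in> M.sub.mtopology interior_of F n" by blast
  moreover have "openin M.sub.mtopology (M.sub.mtopology interior_of F n)" by simp
  ultimately obtain r where r: "r > 0" "M.sub.mball a0 r \<subseteq> M.sub.mtopology interior_of F n"
    unfolding M.sub.openin_mtopology by blast
  have ball: "M.sub.mball a0 r \<subseteq> F n" using r(2) interior_of_subset[of M.sub.mtopology] by blast
  have a0: "a0 \<in> A" using \<open>a0 \<in> M.sub.mtopology interior_of F n\<close> FA interior_of_subset[of M.sub.mtopology] by blast
  \<comment> \<open>\<open>u\<close> is the difference of \<open>a0 + u\<close> and
    \<open>a0\<close>, both in the ball and hence both within \<open>r/8\<close> of images of
    functions of norm at most \<open>n\<close>. The difference doubles both bounds.\<close>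
  have small: "\<exists>b\<in>A. N b \<le> 2 * real n \<and> N (\<lambda>x\<in>S. u x - L b x) \<le> r/4"
    if u: "u \<in> A" and ur: "N u < r" for u
  proof -
    have near: "\<exists>b\<in>A. N b \<le> real n \<and> N (\<lambda>x\<in>S. c x - L b x) < r/8"
      if c: "c \<in> A" "N (\<lambda>x\<in>S. a0 x - c x) < r" for c
    proof -
      have "c \<in> F n" using ball c a0 dist by auto
      then have "\<forall>\<rho>>0. \<exists>y\<in>L ` {a \<in> A. N a \<le> real n}. y \<in> M.sub.mball c \<rho>"
        unfolding F_def M.sub.metric_closure_of by blast
      then have "\<exists>y\<in>L ` {a \<in> A. N a \<le> real n}. y \<in> M.sub.mball c (r/8)"
        using r(1) by (meson divide_pos_pos zero_less_numeral)
      then show ?thesis using dist c by auto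
    qed
    have a0u: "(\<lambda>x\<in>S. a0 x + u x) \<in> A" using a0 u by (rule add_mem)
    have "(\<lambda>x\<in>S. a0 x - (\<lambda>x\<in>S. a0 x + u x) x) = (\<lambda>x\<in>S. (-1) * u x)"
      by (intro restrict_ext) simp
    then have "N (\<lambda>x\<in>S. a0 x - (\<lambda>x\<in>S. a0 x + u x) x) < r" using N_scale[OF u, of "-1"] ur by simp
    from near[OF a0u this] obtain b1 where b1: "b1 \<in> A" "N b1 \<le> real n"
      "N (\<lambda>x\<in>S. (\<lambda>x\<in>S. a0 x + u x) x - L b1 x) < r/8" by blast
    have "(\<lambda>x\<in>S. a0 x - a0 x) = (\<lambda>x\<in>S. 0)" by (intro restrict_ext) simp
    then have "N (\<lambda>x\<in>S. a0 x - a0 x) < r" using N_const_le[of 0] r(1) by simp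
    from near[OF a0 this] obtain b2 where b2: "b2 \<in> A" "N b2 \<le> real n"
      "N (\<lambda>x\<in>S. a0 x - L b2 x) < r/8" by blast
    define b where "b = (\<lambda>x\<in>S. b1 x - b2 x)"
    have b: "b \<in> A" unfolding b_def by (rule diff_mem[OF b1(1) b2(1)])
    have "(\<lambda>x\<in>S. u x - L b x) =
        (\<lambda>x\<in>S. (\<lambda>x\<in>S. (\<lambda>x\<in>S. a0 x + u x) x - L b1 x) x - (\<lambda>x\<in>S. a0 x - L b2 x) x)"
      unfolding b_def linear_map_diff[OF L b1(1) b2(1)] by (intro restrict_ext) simp
    then have "N (\<lambda>x\<in>S. u x - L b x) =
        N (\<lambda>x\<in>S. (\<lambda>x\<in>S. (\<lambda>x\<in>S. a0 x + u x) x - L b1 x) x - (\<lambda>x\<in>S. a0 x - L b2 x) x)"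
      by (rule arg_cong)
    also have "\<dots> \<le> N (\<lambda>x\<in>S. (\<lambda>x\<in>S. a0 x + u x) x - L b1 x) + N (\<lambda>x\<in>S. a0 x - L b2 x)"
      by (intro N_diff diff_mem a0u a0 linear_mapD(1)[OF L] b1 b2)
    also have "\<dots> \<le> r/4" using b1(3) b2(3) by linarith
    finally have "N (\<lambda>x\<in>S. u x - L b x) \<le> r/4" .
    moreover have "N b \<le> 2 * real n"
      unfolding b_def using N_diff[OF b1(1) b2(1)] b1(2) b2(2) by linarith
    ultimately show ?thesis using b by blast
  qed
  have approx: "\<exists>b\<in>A. N b \<le> (4 * real n / r) * N u \<and> N (\<lambda>x\<in>S. u x - L b x) \<le> N u / 2"
    if u: "u \<in> A" for u
  proof (cases "N u = 0")
    case True
    then have "u = (\<lambda>x\<in>S. 0)" using N_eq_0[OF u] by simp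
    then have "(\<lambda>x\<in>S. u x - L u x) = (\<lambda>x\<in>S. 0)"
      using linear_map_0[OF L] by (simp cong: restrict_cong)
    then show ?thesis using u True N_const_le[of 0] by (intro bexI[of _ u]) auto
  next
    case False
    then have Nu: "N u > 0" using N_nonneg[of u] by simp
    \<comment> \<open>Scaling \<open>u\<close> to norm \<open>r/2\<close> keeps it below
      \<open>r\<close> and makes the error \<open>r/4\<close> of \<open>small\<close> exactly half
      the norm.\<close>
    define c where "c = r / (2 * N u)"
    have c: "c > 0" using Nu r(1) by (simp add: c_def)
    define u' where "u' = (\<lambda>x\<in>S. of_real c * u x)"
    have u': "u' \<in> A" unfolding u'_def by (rule scale_mem[OF u])
    have "N u' = c * N u" unfolding u'_def using c by (intro N_scale_real u) simp
    also have "\<dots> < r" using r(1) Nu by (simp add: c_def)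
    finally have "N u' < r" .
    from small[OF u' this] obtain b where b: "b \<in> A" "N b \<le> 2 * real n"
      "N (\<lambda>x\<in>S. u' x - L b x) \<le> r/4" by blast
    define b' where "b' = (\<lambda>x\<in>S. of_real (1/c) * b x)"
    have b': "b' \<in> A" unfolding b'_def by (rule scale_mem[OF b(1)])
    have "N b' = (1/c) * N b" unfolding b'_def using c by (intro N_scale_real b(1)) simp
    also have "\<dots> \<le> (1/c) * (2 * real n)" using b(2) c by (intro mult_left_mono) auto
    also have "\<dots> = (4 * real n / r) * N u" using Nu by (simp add: c_def)
    finally have "N b' \<le> (4 * real n / r) * N u" .
    moreover have "(\<lambda>x\<in>S. u x - L b' x) = (\<lambda>x\<in>S. of_real (1/c) * (\<lambda>x\<in>S. u' x - L b x) x)"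
      unfolding b'_def linear_mapD(3)[OF L b(1)] u'_def
      using c by (intro restrict_ext) (simp add: field_simps)
    then have "N (\<lambda>x\<in>S. u x - L b' x) = (1/c) * N (\<lambda>x\<in>S. u' x - L b x)"
      using N_scale_real[OF diff_mem[OF u' linear_mapD(1)[OF L b(1)]], of "1/c"] c by (simp only:) simp
    moreover have "(1/c) * N (\<lambda>x\<in>S. u' x - L b x) \<le> (1/c) * (r/4)"
      using c by (intro mult_left_mono b(3)) auto
    moreover have "(1/c) * (r/4) = N u / 2" using Nu r(1) by (simp add: c_def)
    ultimately show ?thesis using b' by (intro bexI[of _ b']) auto
  qed
  \<comment> \<open>The added \<open>1\<close> keeps the constant positive when
    \<open>n = 0\<close>.\<close>
  have "N a \<le> (2 * (4 * real n / r) + 1) * N (L a)" if a: "a \<in> A" for a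
  proof -
    obtain b where b: "b \<in> A" "L b = L a" "N b \<le> 2 * (4 * real n / r) * N (L a)"
      using approximately_surjective[OF L bdd approx linear_mapD(1)[OF L a]] by blast
    then have "b = a" using bij a by (auto simp: bij_betw_def inj_on_def)
    then show ?thesis using b(3) N_nonneg[of "L a"] by (simp add: algebra_simps)
  qed
  then show thesis using r(1) by (intro that[of "2 * (4 * real n / r) + 1"]) (auto intro: add_nonneg_pos)
qed

end

subsection \<open>Small linear isomorphisms of a uniform algebra\<close>

text \<open>Taking \<open>n\<close>-th roots removes both constants as \<open>n\<close> grows.
  Applied to powers of a function, this turns estimates up to a constant into sharp ones, as in the
  spectral radius formula.\<close>

lemma le_of_power_le:
  fixes r s :: real
  assumes "0 \<le> s" "0 < c" "\<And>n. n > 0 \<Longrightarrow> c * r ^ n \<le> C * s ^ n"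
  shows "r \<le> s"
proof (rule ccontr)
  assume "\<not> r \<le> s"
  then have rs: "s < r" by simp
  show False
  proof (cases "s = 0")
    case True
    then have "c * r \<le> 0" using assms(3)[of 1] by simp
    then show False using rs True assms(2) by (simp add: mult_le_0_iff)
  next
    case False
    then have s: "s > 0" using assms(1) by simp
    \<comment> \<open>The \<open>1\<close> in the maximum excludes \<open>n = 0\<close>, where the
      hypothesis says nothing.\<close>
    then obtain n where n: "max 1 (C / c) < (r / s) ^ n"
      using real_arch_pow[of "r / s" "max 1 (C / c)"] rs by auto
    then have "n > 0" by (cases n) auto
    then have "(r / s) ^ n \<le> C / c"
      using assms(3)[of n] s assms(2) by (simp add: power_divide field_simps)
    then show False using n by simp
  qed
qed

text \<open>A linear map controls norms of linear combinations; the phase makes the modulus of one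
  of them equal to a sum of moduli at a chosen point.\<close>

lemma phase_alignment:
  fixes p q :: complex
  obtains \<beta> where "cmod \<beta> = 1" "cmod (p + \<beta> * q) = cmod p + cmod q"
proof (cases "p = 0 \<or> q = 0")
  case True
  then show thesis by (intro that[of 1]) auto
next
  case False
  have pq: "p + sgn p / sgn q * q = sgn p * of_real (cmod p + cmod q)"
    using False by (simp add: sgn_div_norm scaleR_conv_of_real field_simps)
  have "cmod (p + sgn p / sgn q * q) = cmod p + cmod q"
    unfolding pq norm_mult norm_of_real using False by (simp add: norm_sgn)
  then show thesis using False by (intro that[of "sgn p / sgn q"]) (auto simp: norm_divide norm_sgn)
qed

context unif_alg
begin

text \<open>
  The map \<open>a \<mapsto> (e a k \<cdot> y k)\<^sub>k\<close> represents \<open>A\<close>, with the norm \<open>W\<close>, as a module of functions on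
  \<open>K\<close>. For \<open>b \<in> A\<close> the operator \<open>L (b \<cdot> L\<^sup>-\<^sup>1 a)\<close> is an approximate multiplier on \<open>A\<close>, hence close
  to multiplication by \<open>L (b g)\<close> with \<open>g = L\<^sup>-\<^sup>1 1\<close>. This makes \<open>b \<mapsto> b g\<close> almost isometric from \<open>N\<close>
  to \<open>W\<close>, and \<open>a \<mapsto> L (g \<cdot> L\<^sup>-\<^sup>1 a) \<cdot> L 1\<close> so close to the identity that \<open>g\<close> is invertible.
\<close>

lemma almost_isometry_imp_unit:
  fixes e :: "('w \<Rightarrow> complex) \<Rightarrow> 'k \<Rightarrow> complex" and y :: "'k \<Rightarrow> complex"
  assumes e_mult: "\<And>a b k. a \<in> A \<Longrightarrow> b \<in> A \<Longrightarrow> k \<in> K \<Longrightarrow> e (\<lambda>x\<in>S. a x * b x) k = e a k * e b k"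
    and e_add: "\<And>a b k. a \<in> A \<Longrightarrow> b \<in> A \<Longrightarrow> k \<in> K \<Longrightarrow> e (\<lambda>x\<in>S. a x + b x) k = e a k + e b k"
    and e_const: "\<And>c k. k \<in> K \<Longrightarrow> e (\<lambda>x\<in>S. c) k = c"
    and W_upper: "\<And>a k. a \<in> A \<Longrightarrow> k \<in> K \<Longrightarrow> cmod (e a k * y k) \<le> W a"
    and W_le: "\<And>a c. a \<in> A \<Longrightarrow> 0 \<le> c \<Longrightarrow> (\<And>k. k \<in> K \<Longrightarrow> cmod (e a k * y k) \<le> c) \<Longrightarrow> W a \<le> c"
    and C: "C \<ge> 0" and W_N: "\<And>a. a \<in> A \<Longrightarrow> W a \<le> C * N a"
    and N_W: "\<And>a. a \<in> A \<Longrightarrow> c * N a \<le> W a" and c: "c > 0"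
    and L: "linear_map L" and bij: "bij_betw L A A"
    and W_L: "\<And>a. a \<in> A \<Longrightarrow> W a \<le> N (L a)"
    and L_W: "\<And>a. a \<in> A \<Longrightarrow> N (L a) \<le> (1 + \<epsilon>) * W a" and \<epsilon>: "\<epsilon> \<ge> 0"
    and small: "8 * \<epsilon> * (1 + \<epsilon>) * C \<le> c"
  obtains g h where "g \<in> A" "h \<in> A" "(\<lambda>x\<in>S. g x * h x) = (\<lambda>x\<in>S. 1)"
    "\<And>b. b \<in> A \<Longrightarrow> W (\<lambda>x\<in>S. b x * g x) \<le> N b"
    "\<And>b. b \<in> A \<Longrightarrow> (1 - 4 * \<epsilon> * (1 + \<epsilon>)) * N b \<le> (1 + \<epsilon>)\<^sup>2 * W (\<lambda>x\<in>S. b x * g x)"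
proof -
  have one: "(\<lambda>x\<in>S. 1) \<in> A" by (rule const_mem)
  have W_nonneg: "0 \<le> W a" if "a \<in> A" for a
    using N_W[OF that] N_nonneg[of a] c by (meson order_trans mult_nonneg_nonneg less_imp_le)
  have LA: "L a \<in> A" if "a \<in> A" for a using linear_mapD(1)[OF L that] .
  have e_scale: "e (\<lambda>x\<in>S. t * a x) k = t * e a k" if "a \<in> A" "k \<in> K" for t a k
  proof -
    have eq: "(\<lambda>x\<in>S. t * a x) = (\<lambda>x\<in>S. (\<lambda>x\<in>S. t) x * a x)" by (intro restrict_ext) simp
    show ?thesis unfolding eq e_mult[OF const_mem that] e_const[OF that(2)] ..
  qed
  have e_power: "e (\<lambda>x\<in>S. b x ^ n) k = e b k ^ n" if "b \<in> A" "k \<in> K" for b n k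
  proof (induction n)
    case 0
    show ?case unfolding power_0 by (rule e_const[OF that(2)])
  next
    case (Suc n)
    have eq: "(\<lambda>x\<in>S. b x ^ Suc n) = (\<lambda>x\<in>S. b x * (\<lambda>x\<in>S. b x ^ n) x)" by (intro restrict_ext) simp
    show ?case unfolding eq e_mult[OF that(1) power_mem[OF that(1)] that(2)] Suc by simp
  qed
  have N_power: "N (\<lambda>x\<in>S. b x ^ n) \<le> N b ^ n" if "b \<in> A" for b n
    using N_upper[OF that] N_nonneg
    by (intro N_le[OF power_mem[OF that]]) (auto simp: norm_power intro: power_mono)
  \<comment> \<open>For \<open>n = 0\<close> and empty \<open>S\<close> this would read
    \<open>1 \<le> 0\<close>.\<close>
  have power_N: "N b ^ n \<le> N (\<lambda>x\<in>S. b x ^ n)" if b: "b \<in> A" and n: "n > 0" for b n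
  proof -
    have "N b \<le> root n (N (\<lambda>x\<in>S. b x ^ n))"
    proof (rule N_le[OF b])
      fix x assume x: "x \<in> S"
      have "cmod (b x) ^ n \<le> N (\<lambda>x\<in>S. b x ^ n)"
        using N_upper[OF power_mem[OF b] x, of n] x by (simp add: norm_power)
      then have "root n (cmod (b x) ^ n) \<le> root n (N (\<lambda>x\<in>S. b x ^ n))"
        using n by simp
      then show "cmod (b x) \<le> root n (N (\<lambda>x\<in>S. b x ^ n))"
        using n by (simp add: real_root_power_cancel)
    qed (use n N_nonneg in auto)
    then have "N b ^ n \<le> root n (N (\<lambda>x\<in>S. b x ^ n)) ^ n"
      using N_nonneg by (intro power_mono)
    then show ?thesis using n N_nonneg by simp
  qed
  have e_le: "cmod (e b k * y k) \<le> N b * cmod (y k)" if b: "b \<in> A" and k: "k \<in> K" for b k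
  proof (cases "y k = 0")
    case False
    \<comment> \<open>Where \<open>y k\<close> is nonzero, the bound \<open>C\<close> holds for all
      powers of \<open>b\<close> at once, and \<open>n\<close>-th roots show that the character
      \<open>a \<mapsto> e a k\<close> is contractive.\<close>
    have power: "cmod (y k) * cmod (e b k) ^ n \<le> C * N b ^ n" for n
    proof -
      have "cmod (y k) * cmod (e b k) ^ n = cmod (e (\<lambda>x\<in>S. b x ^ n) k * y k)"
        by (simp add: e_power[OF b k] norm_mult norm_power)
      also have "\<dots> \<le> C * N (\<lambda>x\<in>S. b x ^ n)"
        using W_upper[OF power_mem[OF b] k, of n] W_N[OF power_mem[OF b], of n] by linarith
      also have "\<dots> \<le> C * N b ^ n"
        using N_power[OF b] C by (intro mult_left_mono)
      finally show ?thesis .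
    qed
    have "cmod (e b k) \<le> N b"
      using False by (intro le_of_power_le[OF N_nonneg _ power]) simp
    then show ?thesis by (simp add: norm_mult mult_right_mono)
  qed simp
  have W_mult: "W (\<lambda>x\<in>S. b x * a x) \<le> N b * W a" if b: "b \<in> A" and a: "a \<in> A" for a b
  proof (rule W_le[OF mult_mem[OF b a]])
    fix k assume k: "k \<in> K"
    have "cmod (e (\<lambda>x\<in>S. b x * a x) k * y k) = cmod (e b k * y k) * cmod (e a k)"
      by (simp add: e_mult[OF b a k] norm_mult)
    also have "\<dots> \<le> N b * cmod (y k) * cmod (e a k)"
      using e_le[OF b k] by (intro mult_right_mono) auto
    also have "\<dots> \<le> N b * W a"
      using mult_left_mono[OF W_upper[OF a k] N_nonneg[of b]] by (simp add: norm_mult mult_ac)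
    finally show "cmod (e (\<lambda>x\<in>S. b x * a x) k * y k) \<le> N b * W a" .
  qed (use N_nonneg W_nonneg[OF a] in auto)

  define M where "M = inv_into A L"
  have MA: "M a \<in> A" and L_M: "L (M a) = a" if "a \<in> A" for a
    using that bij by (auto simp: M_def bij_betw_def inv_into_into f_inv_into_f)
  have M_L: "M (L a) = a" if "a \<in> A" for a
    using that bij by (simp add: M_def bij_betw_def)
  have M_eqI: "M a = b" if "L b = a" "b \<in> A" for a b
    using M_L[OF that(2)] that(1) by simp
  have M_add: "M (\<lambda>x\<in>S. a x + b x) = (\<lambda>x\<in>S. M a x + M b x)" if "a \<in> A" "b \<in> A" for a b
    using that by (intro M_eqI add_mem MA) (simp add: linear_mapD(2)[OF L] MA L_M)
  have M_scale: "M (\<lambda>x\<in>S. t * a x) = (\<lambda>x\<in>S. t * M a x)" if "a \<in> A" for a t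
    using that by (intro M_eqI scale_mem MA) (simp add: linear_mapD(3)[OF L] MA L_M)
  have W_M: "W (M a) \<le> N a" if "a \<in> A" for a
    using W_L[OF MA[OF that]] L_M[OF that] by simp
  define g where "g = M (\<lambda>x\<in>S. 1)"
  define h where "h = L (\<lambda>x\<in>S. 1)"
  have g: "g \<in> A" and h: "h \<in> A" unfolding g_def h_def by (intro MA LA one)+

  have mult: "N (\<lambda>x\<in>S. L (\<lambda>x\<in>S. b x * a x) x - L (\<lambda>x\<in>S. b x * g x) x * L a x) \<le> 4 * \<epsilon> * N b * N (L a)"
    if b: "b \<in> A" and a: "a \<in> A" for a b
  proof -
    define R where "R a = L (\<lambda>x\<in>S. b x * M a x)" for a
    have R: "linear_map R"
      unfolding linear_map_def
    proof (intro conjI ballI allI)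
      fix u assume u: "u \<in> A"
      show "R u \<in> A" unfolding R_def by (intro LA mult_mem b MA u)
      fix t
      have "(\<lambda>x\<in>S. b x * M (\<lambda>x\<in>S. t * u x) x) = (\<lambda>x\<in>S. t * (\<lambda>x\<in>S. b x * M u x) x)"
        unfolding M_scale[OF u] by (intro restrict_ext) simp
      then show "R (\<lambda>x\<in>S. t * u x) = (\<lambda>x\<in>S. t * R u x)"
        unfolding R_def using linear_mapD(3)[OF L mult_mem[OF b MA[OF u]]] by simp
    next
      fix u v assume u: "u \<in> A" and v: "v \<in> A"
      have "(\<lambda>x\<in>S. b x * M (\<lambda>x\<in>S. u x + v x) x) =
          (\<lambda>x\<in>S. (\<lambda>x\<in>S. b x * M u x) x + (\<lambda>x\<in>S. b x * M v x) x)"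
        unfolding M_add[OF u v] by (intro restrict_ext) (simp add: distrib_left)
      then show "R (\<lambda>x\<in>S. u x + v x) = (\<lambda>x\<in>S. R u x + R v x)"
        unfolding R_def
        using linear_mapD(2)[OF L mult_mem[OF b MA[OF u]] mult_mem[OF b MA[OF v]]] by simp
    qed
    define \<kappa> where "\<kappa> = N b"
    have \<kappa>: "\<kappa> \<ge> 0" by (simp add: \<kappa>_def N_nonneg)
    have ineq: "cmod (R a x) + \<kappa> * cmod (v x) \<le> (1 + \<epsilon>) * \<kappa> * B"
      if a: "a \<in> A" and v: "v \<in> A" and x: "x \<in> S"
        and B: "\<And>t. t \<in> S \<Longrightarrow> cmod (a t) + cmod (v t) \<le> B" for a v x B
    proof -
      have B0: "B \<ge> 0" using B[OF x] by (smt (verit) norm_ge_zero)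
      \<comment> \<open>This phase belongs to \<open>x\<close>: it makes the left-hand side the
        modulus of a single value of \<open>L z\<close>. Then \<open>L_W\<close> moves the problem
        to \<open>W z\<close>, which can be estimated at each point of \<open>K\<close>.\<close>
      obtain \<alpha> where \<alpha>: "cmod \<alpha> = 1" "cmod (R a x + \<alpha> * (\<kappa> * v x)) = cmod (R a x) + cmod (\<kappa> * v x)"
        using phase_alignment by blast
      define z where "z = (\<lambda>x\<in>S. (\<lambda>x\<in>S. b x * M a x) x + (\<lambda>x\<in>S. (\<alpha> * \<kappa>) * M v x) x)"
      have z: "z \<in> A" unfolding z_def by (intro add_mem mult_mem scale_mem b MA a v)
      have "L z = (\<lambda>x\<in>S. R a x + (\<lambda>x\<in>S. (\<alpha> * \<kappa>) * v x) x)"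
        unfolding z_def linear_mapD(2)[OF L mult_mem[OF b MA[OF a]] scale_mem[OF MA[OF v]]]
          linear_mapD(3)[OF L MA[OF v]] L_M[OF v] R_def ..
      then have "cmod (R a x) + \<kappa> * cmod (v x) = cmod (L z x)"
        using \<alpha>(2) x \<kappa> by (simp add: norm_mult mult_ac)
      also have "\<dots> \<le> N (L z)" by (intro N_upper LA z x)
      also have "\<dots> \<le> (1 + \<epsilon>) * W z" by (rule L_W[OF z])
      also have "W z \<le> \<kappa> * B"
      proof (rule W_le[OF z])
        fix k assume k: "k \<in> K"
        define p q where "p = e (M a) k * y k" and "q = e (M v) k * y k"
        \<comment> \<open>A second phase, now for \<open>k\<close>. The combination \<open>w\<close>
          has norm at most \<open>B\<close> whatever the phase, so
          \<open>cmod p + cmod q \<le> B\<close>. Multiplication by \<open>b\<close> enlarges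
          \<open>cmod p\<close> by a factor of at most \<open>\<kappa>\<close>, by
          \<open>e_le\<close>.\<close>
        obtain \<beta> where \<beta>: "cmod \<beta> = 1" "cmod (p + \<beta> * q) = cmod p + cmod q"
          using phase_alignment by blast
        define w where "w = (\<lambda>x\<in>S. a x + (\<lambda>x\<in>S. \<beta> * v x) x)"
        have w: "w \<in> A" unfolding w_def by (intro add_mem scale_mem a v)
        have "e (M w) k * y k = p + \<beta> * q"
          unfolding w_def M_add[OF a scale_mem[OF v]] M_scale[OF v]
            e_add[OF MA[OF a] scale_mem[OF MA[OF v]] k] e_scale[OF MA[OF v] k]
          by (simp add: p_def q_def algebra_simps)
        then have "cmod p + cmod q = cmod (e (M w) k * y k)" using \<beta>(2) by simp
        also have "\<dots> \<le> N w" using W_upper[OF MA[OF w] k] W_M[OF w] by linarith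
        also have "\<dots> \<le> B"
        proof (rule N_le[OF w B0])
          fix t assume t: "t \<in> S"
          have "cmod (a t + \<beta> * v t) \<le> cmod (a t) + cmod (v t)"
            using norm_triangle_ineq[of "a t" "\<beta> * v t"] \<beta>(1) by (simp add: norm_mult)
          then show "cmod (w t) \<le> B" using B[OF t] t by (simp add: w_def)
        qed
        finally have pq: "cmod p + cmod q \<le> B" .
        have "e z k * y k = e b k * p + \<alpha> * \<kappa> * q"
          unfolding z_def e_add[OF mult_mem[OF b MA[OF a]] scale_mem[OF MA[OF v]] k]
            e_mult[OF b MA[OF a] k] e_scale[OF MA[OF v] k]
          by (simp add: p_def q_def algebra_simps)
        also have "cmod \<dots> \<le> cmod (e b k * p) + cmod (\<alpha> * \<kappa> * q)" by (rule norm_triangle_ineq)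
        also have "cmod (\<alpha> * \<kappa> * q) = \<kappa> * cmod q" using \<alpha>(1) \<kappa> by (simp add: norm_mult)
        also have "cmod (e b k * p) = cmod (e b k * y k) * cmod (e (M a) k)"
          by (simp add: p_def norm_mult)
        also have "\<dots> \<le> \<kappa> * cmod (y k) * cmod (e (M a) k)"
          unfolding \<kappa>_def using e_le[OF b k] by (intro mult_right_mono) auto
        also have "\<dots> = \<kappa> * cmod p" by (simp add: p_def norm_mult)
        also have "\<kappa> * cmod p + \<kappa> * cmod q \<le> \<kappa> * B"
          using mult_left_mono[OF pq \<kappa>] by (simp add: distrib_left)
        finally show "cmod (e z k * y k) \<le> \<kappa> * B" by simp
      qed (use \<kappa> B0 in auto)
      finally show ?thesis using \<epsilon> by (simp add: mult_ac mult_left_mono)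
    qed
    have "N (\<lambda>x\<in>S. R (L a) x - R (\<lambda>x\<in>S. 1) x * L a x) \<le> 4 * \<epsilon> * \<kappa> * N (L a)"
      using R \<epsilon> \<kappa> ineq LA[OF a] by (rule approximate_multiplier)
    then show ?thesis unfolding R_def M_L[OF a] g_def \<kappa>_def .
  qed

  have upper: "W (\<lambda>x\<in>S. b x * g x) \<le> N b" if b: "b \<in> A" for b
  proof -
    have "W g \<le> 1"
      using W_M[OF one] N_const_le[of 1] unfolding g_def by simp
    then have "N b * W g \<le> N b * 1" by (intro mult_left_mono N_nonneg)
    then show ?thesis using W_mult[OF b g] by simp
  qed
  have lower: "(1 - 4 * \<epsilon> * (1 + \<epsilon>)) * N b \<le> (1 + \<epsilon>)\<^sup>2 * W (\<lambda>x\<in>S. b x * g x)" if b: "b \<in> A" for b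
  proof -
    have bg: "(\<lambda>x\<in>S. b x * g x) \<in> A" by (rule mult_mem[OF b g])
    \<comment> \<open>Multiplication by \<open>b\<close> has \<open>W\<close>-norm at most
      \<open>\<mu>\<close>, because \<open>L\<close> nearly turns it into multiplication by
      \<open>L (b g)\<close>. Iteration on the constant \<open>1\<close> gives
      \<open>c * N b ^ n \<le> W 1 * \<mu> ^ n\<close>, and \<open>n\<close>-th roots remove
      \<open>c\<close> and \<open>W 1\<close>.\<close>
    define \<mu> where "\<mu> = (1 + \<epsilon>) * (N (L (\<lambda>x\<in>S. b x * g x)) + 4 * \<epsilon> * N b)"
    have \<mu>: "\<mu> \<ge> 0" using \<epsilon> N_nonneg by (simp add: \<mu>_def)
    have step: "W (\<lambda>x\<in>S. b x * z x) \<le> \<mu> * W z" if z: "z \<in> A" for z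
    proof -
      let ?p = "\<lambda>x\<in>S. L (\<lambda>x\<in>S. b x * g x) x * L z x"
      let ?d = "\<lambda>x\<in>S. L (\<lambda>x\<in>S. b x * z x) x - L (\<lambda>x\<in>S. b x * g x) x * L z x"
      have d: "?d \<in> A"
        by (rule mem_cong[OF diff_mem[OF LA[OF mult_mem[OF b z]] mult_mem[OF LA[OF bg] LA[OF z]]]]) auto
      have p: "?p \<in> A" by (intro mult_mem LA bg z)
      have bz: "L (\<lambda>x\<in>S. b x * z x) \<in> A" by (intro LA mult_mem b z)
      have "L (\<lambda>x\<in>S. b x * z x) = (\<lambda>x\<in>S. ?d x + ?p x)"
        by (rule mem_eqI[OF bz add_mem[OF d p]]) simp
      then have "N (L (\<lambda>x\<in>S. b x * z x)) \<le> N ?d + N ?p" using N_add[OF d p] by simp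
      also have "\<dots> \<le> 4 * \<epsilon> * N b * N (L z) + N (L (\<lambda>x\<in>S. b x * g x)) * N (L z)"
        by (intro add_mono mult[OF b z] N_mult LA bg z)
      also have "\<dots> = (N (L (\<lambda>x\<in>S. b x * g x)) + 4 * \<epsilon> * N b) * N (L z)"
        by (simp add: algebra_simps)
      also have "\<dots> \<le> (N (L (\<lambda>x\<in>S. b x * g x)) + 4 * \<epsilon> * N b) * ((1 + \<epsilon>) * W z)"
        using N_nonneg \<epsilon> by (intro mult_left_mono L_W z) simp
      also have "\<dots> = \<mu> * W z" by (simp add: \<mu>_def)
      finally show ?thesis using W_L[OF mult_mem[OF b z]] by linarith
    qed
    have iter: "W (\<lambda>x\<in>S. b x ^ n) \<le> W (\<lambda>x\<in>S. 1) * \<mu> ^ n" for n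
    proof (induction n)
      case (Suc n)
      have "(\<lambda>x\<in>S. b x ^ Suc n) = (\<lambda>x\<in>S. b x * (\<lambda>x\<in>S. b x ^ n) x)" by (intro restrict_ext) simp
      then have "W (\<lambda>x\<in>S. b x ^ Suc n) \<le> \<mu> * W (\<lambda>x\<in>S. b x ^ n)"
        using step[OF power_mem[OF b], of n] by (simp only:)
      also have "\<dots> \<le> \<mu> * (W (\<lambda>x\<in>S. 1) * \<mu> ^ n)" using Suc \<mu> by (rule mult_left_mono)
      finally show ?case by (simp only: power_Suc mult_ac)
    qed (simp only: power_0 mult_1_right order_refl)
    have "c * N b ^ n \<le> W (\<lambda>x\<in>S. 1) * \<mu> ^ n" if "n > 0" for n
    proof -
      have "c * N b ^ n \<le> c * N (\<lambda>x\<in>S. b x ^ n)" using power_N[OF b that] c by (intro mult_left_mono) auto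
      also have "\<dots> \<le> W (\<lambda>x\<in>S. b x ^ n)" by (rule N_W[OF power_mem[OF b]])
      also note iter
      finally show ?thesis .
    qed
    then have "N b \<le> \<mu>" using le_of_power_le[OF \<mu> c] by blast
    also have "\<dots> \<le> (1 + \<epsilon>) * ((1 + \<epsilon>) * W (\<lambda>x\<in>S. b x * g x) + 4 * \<epsilon> * N b)"
      unfolding \<mu>_def using L_W[OF bg] \<epsilon> by (intro mult_left_mono add_right_mono) auto
    finally show ?thesis by (simp add: power2_eq_square algebra_simps)
  qed

  define \<Phi> where "\<Phi> a = (\<lambda>x\<in>S. L (\<lambda>x\<in>S. g x * M a x) x * h x)" for a
  have gM: "(\<lambda>x\<in>S. g x * M a x) \<in> A" if "a \<in> A" for a by (intro mult_mem g MA that)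
  have \<Phi>: "linear_map \<Phi>"
    unfolding linear_map_def
  proof (intro conjI ballI allI)
    fix u assume u: "u \<in> A"
    show "\<Phi> u \<in> A" unfolding \<Phi>_def by (intro mult_mem LA gM u h)
    fix t
    have "(\<lambda>x\<in>S. g x * M (\<lambda>x\<in>S. t * u x) x) = (\<lambda>x\<in>S. t * (\<lambda>x\<in>S. g x * M u x) x)"
      unfolding M_scale[OF u] by (intro restrict_ext) simp
    then have "L (\<lambda>x\<in>S. g x * M (\<lambda>x\<in>S. t * u x) x) = (\<lambda>x\<in>S. t * L (\<lambda>x\<in>S. g x * M u x) x)"
      using linear_mapD(3)[OF L gM[OF u]] by simp
    then show "\<Phi> (\<lambda>x\<in>S. t * u x) = (\<lambda>x\<in>S. t * \<Phi> u x)"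
      unfolding \<Phi>_def by (intro restrict_ext) simp
  next
    fix u v assume u: "u \<in> A" and v: "v \<in> A"
    have "(\<lambda>x\<in>S. g x * M (\<lambda>x\<in>S. u x + v x) x) =
        (\<lambda>x\<in>S. (\<lambda>x\<in>S. g x * M u x) x + (\<lambda>x\<in>S. g x * M v x) x)"
      unfolding M_add[OF u v] by (intro restrict_ext) (simp add: distrib_left)
    then have "L (\<lambda>x\<in>S. g x * M (\<lambda>x\<in>S. u x + v x) x) =
        (\<lambda>x\<in>S. L (\<lambda>x\<in>S. g x * M u x) x + L (\<lambda>x\<in>S. g x * M v x) x)"
      using linear_mapD(2)[OF L gM[OF u] gM[OF v]] by simp
    then show "\<Phi> (\<lambda>x\<in>S. u x + v x) = (\<lambda>x\<in>S. \<Phi> u x + \<Phi> v x)"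
      unfolding \<Phi>_def by (intro restrict_ext) (simp add: distrib_right)
  qed
  \<comment> \<open>Here \<open>mult\<close> is used with \<open>M a\<close> as the multiplier and
    \<open>1\<close> as the argument: since \<open>L (M a) = a\<close>, it compares \<open>a\<close>
    with \<open>L (M a g) L 1 = \<Phi> a\<close>. The condition \<open>small\<close> makes the error
    at most half the norm of \<open>a\<close>.\<close>
  have \<Phi>_near: "N (\<lambda>x\<in>S. a x - \<Phi> a x) \<le> N a / 2" if a: "a \<in> A" for a
  proof -
    have "(\<lambda>x\<in>S. L (\<lambda>x\<in>S. M a x * (\<lambda>x\<in>S. 1) x) x - L (\<lambda>x\<in>S. M a x * g x) x * L (\<lambda>x\<in>S. 1) x) =
        (\<lambda>x\<in>S. a x - \<Phi> a x)"
    proof -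
      have "(\<lambda>x\<in>S. M a x * (\<lambda>x\<in>S. 1) x) = M a"
        by (rule mem_eqI[OF mult_mem[OF MA[OF a] one] MA[OF a]]) simp
      moreover have "(\<lambda>x\<in>S. M a x * g x) = (\<lambda>x\<in>S. g x * M a x)" by (simp add: mult.commute)
      ultimately show ?thesis unfolding \<Phi>_def h_def by (intro restrict_ext) (simp add: L_M[OF a])
    qed
    then have "N (\<lambda>x\<in>S. a x - \<Phi> a x) \<le> 4 * \<epsilon> * N (M a) * N h"
      using mult[OF MA[OF a] one] unfolding h_def by simp
    also have "\<dots> \<le> 4 * \<epsilon> * (N a / c) * ((1 + \<epsilon>) * C)"
    proof (intro mult_mono)
      have "c * N (M a) \<le> N a" using N_W[OF MA[OF a]] W_M[OF a] by linarith
      then show "N (M a) \<le> N a / c" using c by (simp add: field_simps)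
      have "W (\<lambda>x\<in>S. 1) \<le> C * N (\<lambda>x\<in>S. 1)" by (rule W_N[OF one])
      also have "\<dots> \<le> C * 1" using N_const_le[of 1] C by (intro mult_left_mono) auto
      finally have "(1 + \<epsilon>) * W (\<lambda>x\<in>S. 1) \<le> (1 + \<epsilon>) * C" using \<epsilon> by (intro mult_left_mono) auto
      then show "N h \<le> (1 + \<epsilon>) * C" using L_W[OF one] unfolding h_def by linarith
    qed (use \<epsilon> c C N_nonneg in auto)
    also have "\<dots> = (8 * \<epsilon> * (1 + \<epsilon>) * C) * (N a / (2 * c))" by simp
    also have "\<dots> \<le> c * (N a / (2 * c))"
      using small c N_nonneg by (intro mult_right_mono) auto
    also have "\<dots> = N a / 2" using c by simp
    finally show ?thesis .
  qed
  have \<Phi>_surj: "\<exists>b\<in>A. \<Phi> b = u" if u: "u \<in> A" for u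
  proof -
    have "N (\<Phi> a) \<le> 3/2 * N a" if a: "a \<in> A" for a
    proof -
      have Pa: "\<Phi> a \<in> A" by (rule linear_mapD(1)[OF \<Phi> a])
      have "\<Phi> a = (\<lambda>x\<in>S. a x - (\<lambda>x\<in>S. a x - \<Phi> a x) x)"
        by (rule mem_eqI[OF Pa diff_mem[OF a diff_mem[OF a Pa]]]) simp
      then show ?thesis using N_diff[OF a diff_mem[OF a Pa]] \<Phi>_near[OF a] by simp
    qed
    moreover have "\<exists>b\<in>A. N b \<le> 1 * N u \<and> N (\<lambda>x\<in>S. u x - \<Phi> b x) \<le> N u / 2" if "u \<in> A" for u
      using \<Phi>_near[OF that] that by auto
    ultimately show ?thesis using approximately_surjective[OF \<Phi> _ _ u] by blast
  qed
  \<comment> \<open>Solving \<open>\<Phi> a1 = 1\<close> shows that \<open>h\<close> has no zeros,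
    so one factor \<open>h\<close> can be cancelled in \<open>\<Phi> a2 = h h\<close>. What remains
    is \<open>L (g M a2) = h = L 1\<close>, and injectivity of \<open>L\<close> gives the inverse
    \<open>M a2\<close> of \<open>g\<close>.\<close>
  obtain a1 where a1: "a1 \<in> A" "\<Phi> a1 = (\<lambda>x\<in>S. 1)" using \<Phi>_surj[OF one] by blast
  obtain a2 where a2: "a2 \<in> A" "\<Phi> a2 = (\<lambda>x\<in>S. h x * h x)" using \<Phi>_surj[OF mult_mem[OF h h]] by blast
  have "L (\<lambda>x\<in>S. g x * M a2 x) = h"
  proof (rule mem_eqI[OF LA[OF gM[OF a2(1)]] h])
    fix x assume x: "x \<in> S"
    have "h x \<noteq> 0" using fun_cong[OF a1(2), of x] x by (auto simp: \<Phi>_def)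
    then show "L (\<lambda>x\<in>S. g x * M a2 x) x = h x" using fun_cong[OF a2(2), of x] x by (simp add: \<Phi>_def)
  qed
  then have "(\<lambda>x\<in>S. g x * M a2 x) = (\<lambda>x\<in>S. 1)"
    unfolding h_def using bij gM[OF a2(1)] one by (auto simp: bij_betw_def inj_on_def)
  then show thesis using that[OF g MA[OF a2(1)]] upper lower by blast
qed

end

subsection \<open>Almost isometric modules\<close>

lemma scalar_isoD:
  assumes "scalar_iso R X Y T"
  shows "bij_betw T (carrier X) (carrier Y)"
    and "x \<in> carrier X \<Longrightarrow> T x \<in> carrier Y"
    and "x \<in> carrier X \<Longrightarrow> y \<in> carrier X \<Longrightarrow> T (x \<oplus>\<^bsub>X\<^esub> y) = T x \<oplus>\<^bsub>Y\<^esub> T y"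
    and "a \<in> R \<Longrightarrow> x \<in> carrier X \<Longrightarrow> T (a \<odot>\<^bsub>X\<^esub> x) = a \<odot>\<^bsub>Y\<^esub> T x"
  using assms by (auto simp: scalar_iso_def bij_betw_def)

lemma scalar_iso_mono: "R' \<subseteq> R \<Longrightarrow> scalar_iso R X Y T \<Longrightarrow> scalar_iso R' X Y T"
  by (auto simp: scalar_iso_def)

lemma scalar_iso_inv:
  assumes T: "scalar_iso R X Y T"
    and add: "\<And>x y. x \<in> carrier X \<Longrightarrow> y \<in> carrier X \<Longrightarrow> x \<oplus>\<^bsub>X\<^esub> y \<in> carrier X"
    and smult: "\<And>a x. a \<in> R \<Longrightarrow> x \<in> carrier X \<Longrightarrow> a \<odot>\<^bsub>X\<^esub> x \<in> carrier X"
  shows "scalar_iso R Y X (inv_into (carrier X) T)"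
proof -
  note bij = scalar_isoD(1)[OF T]
  let ?T = "inv_into (carrier X) T"
  have inv: "?T y \<in> carrier X" "T (?T y) = y" if "y \<in> carrier Y" for y
    using bij that by (auto simp: bij_betw_def inv_into_into f_inv_into_f)
  have eqI: "?T y = x" if "T x = y" "x \<in> carrier X" for x y
    using bij that by (auto simp: bij_betw_def)
  show ?thesis
    unfolding scalar_iso_def
    using bij_betw_inv_into[OF bij] inv add smult scalar_isoD(3,4)[OF T]
    by (auto intro!: eqI)
qed

lemma C_ring_closure_of_iff:
  assumes "compact_space K"
  shows "f \<in> sup_topology K closure_of Q \<longleftrightarrow> f \<in> carrier (C_ring K) \<and>
    (\<forall>r>0. \<exists>g\<in>Q \<inter> carrier (C_ring K). \<forall>x\<in>topspace K. cmod (f x - g x) \<le> r)"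
proof -
  let ?m = "cfunspace K (euclidean_metric :: complex metric)"
  have carr: "carrier (C_ring K) = mspace ?m" by (rule C_ring_simps)
  interpret M: Metric_space "mspace ?m" "mdist ?m" by (rule Metric_space_mspace_mdist)
  have dist: "mdist ?m f g \<le> r \<longleftrightarrow> (\<forall>x\<in>topspace K. cmod (f x - g x) \<le> r)"
    if "f \<in> carrier (C_ring K)" "g \<in> carrier (C_ring K)" "r > 0" for g r
    using sup_dist_le[OF that(1,2), of r] sup_dist_upper[OF that(1,2)] that(3)
    by (auto intro: order_trans)
  have "f \<in> sup_topology K closure_of Q \<longleftrightarrow> f \<in> carrier (C_ring K) \<and>
      (\<forall>r>0. \<exists>g\<in>Q. f \<in> carrier (C_ring K) \<and> g \<in> carrier (C_ring K) \<and> mdist ?m f g \<le> r)"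
    unfolding mtopology_of_def M.metric_closure_of_alt M.in_mcball carr by blast
  then show ?thesis using dist by (metis IntE IntI)
qed

lemma op_norm_le:
  assumes "\<And>x. x \<in> carrier X \<Longrightarrow> nrm Y (T x) \<le> p * nrm X x" "0 \<le> p"
    and "x0 \<in> carrier X" "nrm X x0 \<le> 1"
  shows "op_norm X Y T \<le> p"
  unfolding op_norm_def
proof (rule cSUP_least)
  fix x assume x: "x \<in> {x \<in> carrier X. nrm X x \<le> 1}"
  then have "nrm Y (T x) \<le> p * nrm X x" using assms(1) by blast
  also have "\<dots> \<le> p * 1" using x assms(2) by (intro mult_left_mono) auto
  finally show "nrm Y (T x) \<le> p" by simp
qed (use assms in auto)

text \<open>Both \<open>X\<close> and the algebra over itself are instances, so a map and its
  inverse are covered by the same lemmas.\<close>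

locale unif_alg_module = unif_alg \<Omega> A
  for \<Omega> :: "'w topology" and A :: "('w \<Rightarrow> complex) set" +
  fixes X :: "('w \<Rightarrow> complex, 'm) normed_module"
  assumes module_X: "Module.module (alg_ring \<Omega> A) X"
    and nrm_nonneg: "x \<in> carrier X \<Longrightarrow> 0 \<le> nrm X x"
    and nrm_eq_0: "x \<in> carrier X \<Longrightarrow> nrm X x = 0 \<longleftrightarrow> x = \<zero>\<^bsub>X\<^esub>"
    and nrm_scale: "x \<in> carrier X \<Longrightarrow> nrm X (const_fun \<Omega> c \<odot>\<^bsub>X\<^esub> x) = cmod c * nrm X x"
    and nrm_smult: "a \<in> A \<Longrightarrow> x \<in> carrier X \<Longrightarrow> nrm X (a \<odot>\<^bsub>X\<^esub> x) \<le> N a * nrm X x"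
begin

interpretation M: Module.module "alg_ring \<Omega> A" X
  by (rule module_X)

lemma const_fun_mem: "const_fun \<Omega> c \<in> A"
  unfolding const_fun_def by (rule const_mem)

lemma X_add_mem: "x \<in> carrier X \<Longrightarrow> y \<in> carrier X \<Longrightarrow> x \<oplus>\<^bsub>X\<^esub> y \<in> carrier X"
  by simp

lemma X_zero_mem: "\<zero>\<^bsub>X\<^esub> \<in> carrier X"
  by simp

lemma X_smult_mem: "a \<in> A \<Longrightarrow> x \<in> carrier X \<Longrightarrow> a \<odot>\<^bsub>X\<^esub> x \<in> carrier X"
  using M.smult_closed[of a x] by simp

lemma X_smult_add:
  "a \<in> A \<Longrightarrow> b \<in> A \<Longrightarrow> x \<in> carrier X \<Longrightarrow> (\<lambda>t\<in>S. a t + b t) \<odot>\<^bsub>X\<^esub> x = a \<odot>\<^bsub>X\<^esub> x \<oplus>\<^bsub>X\<^esub> b \<odot>\<^bsub>X\<^esub> x"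
  using M.smult_l_distr[of a b x] by (simp add: C_ring_simps)

lemma X_smult_mult:
  "a \<in> A \<Longrightarrow> b \<in> A \<Longrightarrow> x \<in> carrier X \<Longrightarrow> (\<lambda>t\<in>S. a t * b t) \<odot>\<^bsub>X\<^esub> x = a \<odot>\<^bsub>X\<^esub> (b \<odot>\<^bsub>X\<^esub> x)"
  using M.smult_assoc1[of a b x] by (simp add: C_ring_simps)

lemma nrm_zero: "nrm X \<zero>\<^bsub>X\<^esub> = 0"
  using nrm_eq_0 by simp

text \<open>If \<open>a\<close> and \<open>b\<close> agree on the generator, then
  \<open>a - b\<close> kills it; by commutativity of \<open>A\<close> it kills all multiples of the
  generator, that is \<open>X\<close>, and faithfulness applies.\<close>

lemma faithful_generator_inj:
  assumes "faithful \<Omega> A X" and x0: "x0 \<in> carrier X" "carrier X = (\<lambda>a. a \<odot>\<^bsub>X\<^esub> x0) ` A"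
  shows "bij_betw (\<lambda>a. a \<odot>\<^bsub>X\<^esub> x0) A (carrier X)"
  unfolding bij_betw_def
proof (intro conjI inj_onI)
  fix a b assume a: "a \<in> A" and b: "b \<in> A" and eq: "a \<odot>\<^bsub>X\<^esub> x0 = b \<odot>\<^bsub>X\<^esub> x0"
  define d where "d = (\<lambda>t\<in>S. a t - b t)"
  have d: "d \<in> A" unfolding d_def by (rule diff_mem[OF a b])
  have "(\<lambda>t\<in>S. d t + b t) = a"
    by (rule mem_eqI[OF add_mem[OF d b] a]) (simp add: d_def)
  then have "d \<odot>\<^bsub>X\<^esub> x0 \<oplus>\<^bsub>X\<^esub> b \<odot>\<^bsub>X\<^esub> x0 = b \<odot>\<^bsub>X\<^esub> x0"
    using X_smult_add[OF d b x0(1)] eq by simp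
  then have 0: "d \<odot>\<^bsub>X\<^esub> x0 = \<zero>\<^bsub>X\<^esub>"
    using X_smult_mem[OF d x0(1)] X_smult_mem[OF b x0(1)] by (simp add: M.M.add.l_cancel_one)
  have "d \<odot>\<^bsub>X\<^esub> x = \<zero>\<^bsub>X\<^esub>" if "x \<in> carrier X" for x
  proof -
    obtain c where c: "c \<in> A" "x = c \<odot>\<^bsub>X\<^esub> x0" using \<open>x \<in> carrier X\<close> x0(2) by blast
    have "d \<odot>\<^bsub>X\<^esub> x = (\<lambda>t\<in>S. d t * c t) \<odot>\<^bsub>X\<^esub> x0" using X_smult_mult[OF d c(1) x0(1)] c by simp
    also have "(\<lambda>t\<in>S. d t * c t) = (\<lambda>t\<in>S. c t * d t)" by (intro restrict_ext) simp
    also have "(\<lambda>t\<in>S. c t * d t) \<odot>\<^bsub>X\<^esub> x0 = \<zero>\<^bsub>X\<^esub>"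
      using X_smult_mult[OF c(1) d x0(1)] 0 c(1) by simp
    finally show ?thesis .
  qed
  then have d0: "d = (\<lambda>t\<in>S. 0)" using assms(1) d by (simp add: faithful_def C_ring_simps)
  have "a t = b t" if "t \<in> S" for t
  proof -
    have "d t = 0" using d0 that by simp
    then show ?thesis using that by (simp add: d_def)
  qed
  then show "a = b" by (intro mem_eqI[OF a b])
qed (use x0 in auto)

lemma op_norm_upper:
  assumes Y: "unif_alg_module \<Omega> A Y"
    and T: "scalar_iso (range (const_fun \<Omega>)) X Y T" and bdd: "bounded_op X Y T"
  shows "0 \<le> op_norm X Y T"
    and "x \<in> carrier X \<Longrightarrow> nrm Y (T x) \<le> op_norm X Y T * nrm X x"
proof -
  interpret Y: unif_alg_module \<Omega> A Y by (rule Y)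
  obtain B where B: "\<And>x. x \<in> carrier X \<Longrightarrow> nrm Y (T x) \<le> B * nrm X x"
    using bdd by (auto simp: bounded_op_def)
  have "nrm Y (T x) \<le> \<bar>B\<bar>" if "x \<in> carrier X" "nrm X x \<le> 1" for x
  proof -
    have "nrm Y (T x) \<le> B * nrm X x" using B that by blast
    also have "\<dots> \<le> \<bar>B\<bar> * 1" using that nrm_nonneg by (intro mult_mono) auto
    finally show ?thesis by simp
  qed
  then have bdd: "bdd_above ((\<lambda>x. nrm Y (T x)) ` {x \<in> carrier X. nrm X x \<le> 1})"
    by (auto simp: bdd_above_def)
  have upper: "nrm Y (T x) \<le> op_norm X Y T" if "x \<in> carrier X" "nrm X x \<le> 1" for x
    unfolding op_norm_def using that by (intro cSUP_upper bdd) auto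
  have T_scale: "nrm Y (T (const_fun \<Omega> c \<odot>\<^bsub>X\<^esub> x)) = cmod c * nrm Y (T x)" if "x \<in> carrier X" for c x
    using scalar_isoD(2,4)[OF T] that Y.nrm_scale by simp
  show "0 \<le> op_norm X Y T"
    using upper[OF X_zero_mem] Y.nrm_nonneg[OF scalar_isoD(2)[OF T X_zero_mem]] nrm_zero by simp
  assume x: "x \<in> carrier X"
  show "nrm Y (T x) \<le> op_norm X Y T * nrm X x"
  proof (cases "nrm X x = 0")
    \<comment> \<open>Such an \<open>x\<close> coincides with \<open>0\<close> times
      \<open>x\<close>, as both are zero, so homogeneity of \<open>T\<close> gives an image of norm
      \<open>0\<close>.\<close>
    case True
    have "nrm X (const_fun \<Omega> 0 \<odot>\<^bsub>X\<^esub> x) = 0" using nrm_scale[OF x, of 0] by simp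
    then have "const_fun \<Omega> 0 \<odot>\<^bsub>X\<^esub> x = x"
      using True x X_smult_mem[OF const_fun_mem x] nrm_eq_0 by metis
    then show ?thesis using T_scale[OF x, of 0] True by simp
  next
    case False
    then have pos: "nrm X x > 0" using nrm_nonneg[OF x] by simp
    have "nrm X (const_fun \<Omega> (of_real (1 / nrm X x)) \<odot>\<^bsub>X\<^esub> x) \<le> 1"
      unfolding nrm_scale[OF x] norm_of_real using pos by simp
    then have "nrm Y (T (const_fun \<Omega> (of_real (1 / nrm X x)) \<odot>\<^bsub>X\<^esub> x)) \<le> op_norm X Y T"
      by (intro upper X_smult_mem const_fun_mem x)
    then show ?thesis
      unfolding T_scale[OF x] norm_of_real using pos by (simp add: field_simps)
  qed
qed

text \<open>Explicit bounds are easier to produce and to use than operator norms. The set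
  \<open>R\<close> of scalars is left open so that one proof covers module isomorphisms and
  complex-linear ones.\<close>

lemma almost_isometric_over_iff:
  assumes Y: "unif_alg_module \<Omega> A Y" and R: "range (const_fun \<Omega>) \<subseteq> R" "R \<subseteq> A"
  shows "almost_isometric_over R X Y \<longleftrightarrow>
    (\<forall>\<epsilon>>0. \<exists>T p q. scalar_iso R X Y T \<and> 0 < p \<and> 0 < q \<and> p * q < 1 + \<epsilon> \<and>
      (\<forall>x\<in>carrier X. nrm Y (T x) \<le> p * nrm X x \<and> nrm X x \<le> q * nrm Y (T x)))"
    (is "_ \<longleftrightarrow> (\<forall>\<epsilon>>0. ?P \<epsilon>)")
proof -
  interpret Y: unif_alg_module \<Omega> A Y by (rule Y)
  have inv: "inv_into (carrier X) T y \<in> carrier X" "T (inv_into (carrier X) T y) = y"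
    if "scalar_iso R X Y T" "y \<in> carrier Y" for T y
    using scalar_isoD(1)[OF that(1)] that(2) by (auto simp: bij_betw_def inv_into_into f_inv_into_f)
  have fwd: "?P \<epsilon>" if T: "scalar_iso R X Y T" "bounded_op X Y T" "bounded_op Y X (inv_into (carrier X) T)"
      "op_norm X Y T * op_norm Y X (inv_into (carrier X) T) < 1 + \<epsilon>" for \<epsilon> T
  proof -
    let ?T = "inv_into (carrier X) T"
    define p q where "p = op_norm X Y T" and "q = op_norm Y X ?T"
    have Ti: "scalar_iso R Y X ?T"
      using R by (intro scalar_iso_inv[OF T(1)] X_add_mem X_smult_mem) auto
    have p: "p \<ge> 0" "\<And>x. x \<in> carrier X \<Longrightarrow> nrm Y (T x) \<le> p * nrm X x"
      unfolding p_def using op_norm_upper[OF Y scalar_iso_mono[OF R(1) T(1)] T(2)] by auto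
    have q: "q \<ge> 0" "\<And>y. y \<in> carrier Y \<Longrightarrow> nrm X (?T y) \<le> q * nrm Y y"
      unfolding q_def
      using Y.op_norm_upper[OF unif_alg_module_axioms scalar_iso_mono[OF R(1) Ti] T(3)] by auto
    have q': "nrm X x \<le> q * nrm Y (T x)" if x: "x \<in> carrier X" for x
      using q(2)[OF scalar_isoD(2)[OF T(1) x]] scalar_isoD(1)[OF T(1)] x
      by (simp add: bij_betw_def)
    have gap: "1 + \<epsilon> - p * q > 0" using T(4) by (simp add: p_def q_def)
    \<comment> \<open>Operator norms can be \<open>0\<close>, when \<open>X\<close> is the zero
      module, whereas the bounds must be positive. Adding \<open>\<eta>\<close> to both uses at most
      half of the gap \<open>1 + \<epsilon> - p * q\<close>.\<close>
    define \<eta> where "\<eta> = min 1 ((1 + \<epsilon> - p * q) / (2 * (p + q + 1)))"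
    have \<eta>: "\<eta> > 0" "\<eta> \<le> 1" using gap p q by (auto simp: \<eta>_def)
    have "(p + \<eta>) * (q + \<eta>) = p * q + \<eta> * (p + q + \<eta>)" by (simp add: algebra_simps)
    also have "\<eta> * (p + q + \<eta>) \<le> \<eta> * (p + q + 1)" using \<eta> by (intro mult_left_mono) auto
    also have "\<dots> \<le> (1 + \<epsilon> - p * q) / (2 * (p + q + 1)) * (p + q + 1)"
      using p q by (intro mult_right_mono) (auto simp: \<eta>_def)
    also have "\<dots> = (1 + \<epsilon> - p * q) / 2" using p q by (simp add: field_simps)
    also have "p * q + (1 + \<epsilon> - p * q) / 2 < 1 + \<epsilon>" using gap by (simp add: field_simps)
    finally have less: "(p + \<eta>) * (q + \<eta>) < 1 + \<epsilon>" by simp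
    show ?thesis
    proof (rule exI[of _ T], rule exI[of _ "p + \<eta>"], rule exI[of _ "q + \<eta>"], intro conjI ballI)
      fix x assume x: "x \<in> carrier X"
      have "0 \<le> \<eta> * nrm X x" "0 \<le> \<eta> * nrm Y (T x)"
        using \<eta> nrm_nonneg[OF x] Y.nrm_nonneg[OF scalar_isoD(2)[OF T(1) x]] by auto
      then show "nrm Y (T x) \<le> (p + \<eta>) * nrm X x" "nrm X x \<le> (q + \<eta>) * nrm Y (T x)"
        using p(2)[OF x] q'[OF x] by (auto simp: distrib_right)
    qed (use p q \<eta> T less in auto)
  qed
  have bwd: "bounded_op X Y T \<and> bounded_op Y X (inv_into (carrier X) T) \<and>
      op_norm X Y T * op_norm Y X (inv_into (carrier X) T) < 1 + \<epsilon>"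
    if T: "scalar_iso R X Y T" and pq: "0 < p" "0 < q" "p * q < 1 + \<epsilon>"
      and p: "\<And>x. x \<in> carrier X \<Longrightarrow> nrm Y (T x) \<le> p * nrm X x"
      and q: "\<And>x. x \<in> carrier X \<Longrightarrow> nrm X x \<le> q * nrm Y (T x)" for T p q \<epsilon>
  proof -
    let ?T = "inv_into (carrier X) T"
    have Ti: "scalar_iso R Y X ?T"
      using R by (intro scalar_iso_inv[OF T(1)] X_add_mem X_smult_mem) auto
    have q': "nrm X (?T y) \<le> q * nrm Y y" if "y \<in> carrier Y" for y
      using q[OF inv(1)[OF T that]] inv(2)[OF T that] by simp
    have bdd: "bounded_op X Y T" "bounded_op Y X ?T"
      using p q' by (auto simp: bounded_op_def)
    have "op_norm X Y T \<le> p" "op_norm Y X ?T \<le> q"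
      using p q' pq nrm_zero Y.nrm_zero
      by (auto intro!: op_norm_le[OF _ _ X_zero_mem] op_norm_le[OF _ _ Y.X_zero_mem])
    moreover have "0 \<le> op_norm Y X ?T"
      by (rule Y.op_norm_upper(1)[OF unif_alg_module_axioms scalar_iso_mono[OF R(1) Ti] bdd(2)])
    ultimately have "op_norm X Y T * op_norm Y X ?T \<le> p * q"
      using pq by (intro mult_mono) auto
    then show ?thesis using bdd pq(3) by simp
  qed
  show ?thesis
  proof (intro iffI allI impI)
    fix \<epsilon> :: real assume "almost_isometric_over R X Y" "\<epsilon> > 0"
    then show "?P \<epsilon>" unfolding almost_isometric_over_def using fwd by blast
  next
    assume P: "\<forall>\<epsilon>>0. ?P \<epsilon>"
    show "almost_isometric_over R X Y"
      unfolding almost_isometric_over_def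
    proof (intro allI impI)
      fix \<epsilon> :: real assume "\<epsilon> > 0"
      with P obtain T p q where T: "scalar_iso R X Y T" and pq: "0 < p" "0 < q" "p * q < 1 + \<epsilon>"
        and *: "\<forall>x\<in>carrier X. nrm Y (T x) \<le> p * nrm X x \<and> nrm X x \<le> q * nrm Y (T x)" by blast
      show "\<exists>T. scalar_iso R X Y T \<and> bounded_op X Y T \<and> bounded_op Y X (inv_into (carrier X) T) \<and>
          op_norm X Y T * op_norm Y X (inv_into (carrier X) T) < 1 + \<epsilon>"
        using bwd[OF T pq] * T by blast
    qed
  qed
qed

lemma self_module: "unif_alg_module \<Omega> A (self_module \<Omega> A)"
proof (intro unif_alg_module.intro unif_alg_module_axioms.intro unif_alg_axioms)
  have cring: "cring (alg_ring \<Omega> A)" by (rule M.R.cring_axioms)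
  have abelian: "abelian_group (self_module \<Omega> A)"
  proof (rule abelian_groupI, unfold fun_module_simps)
    fix a assume a: "a \<in> A"
    show "(\<lambda>t\<in>S. (\<lambda>t\<in>S. 0) t + a t) = a"
      by (rule mem_eqI[OF add_mem[OF const_mem a] a]) simp
    have "(\<lambda>t\<in>S. (\<lambda>t\<in>S. (-1) * a t) t + a t) = (\<lambda>t\<in>S. 0)" by (intro restrict_ext) simp
    then show "\<exists>b\<in>A. (\<lambda>t\<in>S. b t + a t) = (\<lambda>t\<in>S. 0)" using scale_mem[OF a] by blast
  qed (auto intro!: add_mem const_mem restrict_ext)
  show "Module.module (alg_ring \<Omega> A) (self_module \<Omega> A)"
  proof (intro module.intro cring abelian module_axioms.intro)
    fix x assume "x \<in> carrier (self_module \<Omega> A)"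
    then show "\<one>\<^bsub>alg_ring \<Omega> A\<^esub> \<odot>\<^bsub>self_module \<Omega> A\<^esub> x = x"
      using mult_mem[OF const_mem[of 1], of x]
      by (intro mem_eqI) (auto simp: fun_module_simps C_ring_simps restrict_def)
  qed (auto simp: fun_module_simps C_ring_simps algebra_simps intro!: mult_mem restrict_ext)
next
  fix a x assume "a \<in> A" "x \<in> carrier (self_module \<Omega> A)"
  then show "nrm (self_module \<Omega> A) (a \<odot>\<^bsub>self_module \<Omega> A\<^esub> x) \<le> N a * nrm (self_module \<Omega> A) x"
    using N_mult by (simp add: fun_module_simps)
next
  fix c x assume x: "x \<in> carrier (self_module \<Omega> A)"
  have "(\<lambda>t\<in>S. const_fun \<Omega> c t * x t) = (\<lambda>t\<in>S. c * x t)"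
    by (intro restrict_ext) (simp add: const_fun_def)
  then show "nrm (self_module \<Omega> A) (const_fun \<Omega> c \<odot>\<^bsub>self_module \<Omega> A\<^esub> x) = cmod c * nrm (self_module \<Omega> A) x"
    using N_scale[of x c] x by (simp add: fun_module_simps)
qed (auto simp: fun_module_simps N_nonneg N_eq_0)

end

subsection \<open>From almost isometries to moduli\<close>

context unif_alg
begin

lemma modulus_closure_pos_iff:
  "f \<in> modulus_closure_pos \<Omega> A \<longleftrightarrow> f \<in> carrier (C_ring \<Omega>) \<and>
    (\<forall>x\<in>S. Im (f x) = 0 \<and> Re (f x) > 0) \<and>
    (\<forall>r>0. \<exists>g\<in>A. (\<exists>h\<in>A. (\<lambda>x\<in>S. g x * h x) = (\<lambda>x\<in>S. 1)) \<and> (\<forall>x\<in>S. \<bar>Re (f x) - cmod (g x)\<bar> \<le> r))"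
proof -
  have Q: "(\<lambda>x\<in>S. complex_of_real (cmod (g x))) \<in> carrier (C_ring \<Omega>)" if "g \<in> A" for g
    using C_ring_continuous[OF mem_C[OF that]]
    by (intro C_ring_restrictI[OF compact])
       (auto simp: continuous_map_atin intro!: tendsto_of_real tendsto_norm)
  have units: "g \<in> Units (alg_ring \<Omega> A) \<longleftrightarrow> g \<in> A \<and> (\<exists>h\<in>A. (\<lambda>x\<in>S. g x * h x) = (\<lambda>x\<in>S. 1))" for g
    by (auto simp: Units_def C_ring_simps mult.commute)
  have pos: "strictly_positive \<Omega> f \<longleftrightarrow> (\<forall>x\<in>S. Im (f x) = 0 \<and> Re (f x) > 0)"
    unfolding strictly_positive_def by (metis Im_complex_of_real Re_complex_of_real complex_eqI)
  have dist: "cmod (f x - complex_of_real (cmod (g x))) = \<bar>Re (f x) - cmod (g x)\<bar>"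
    if "Im (f x) = 0" for x g
    using that by (simp add: cmod_def)
  have "(\<exists>g\<in>modulus_set \<Omega> A \<inter> carrier (C_ring \<Omega>). \<forall>x\<in>S. cmod (f x - g x) \<le> r) \<longleftrightarrow>
      (\<exists>g\<in>Units (alg_ring \<Omega> A). \<forall>x\<in>S. cmod (f x - complex_of_real (cmod (g x))) \<le> r)" for r
  proof -
    have "modulus_set \<Omega> A \<inter> carrier (C_ring \<Omega>) = modulus_set \<Omega> A"
      using Q units by (auto simp: modulus_set_def)
    then show ?thesis by (simp add: modulus_set_def cong: ball_cong)
  qed
  then show ?thesis
    unfolding modulus_closure_pos_def mem_Collect_eq C_ring_closure_of_iff[OF compact] pos
    using dist units by (auto simp: Bex_def)
qed

text \<open>\<open>W a\<close> will be the norm of \<open>a\<close> times a generator, and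
  \<open>G n\<close> the rescaled image of the generator under the \<open>n\<close>-th isomorphism.
  The limit \<open>f\<close> need not lie in \<open>A\<close>, so the final estimates use the sup
  norm on all continuous functions.\<close>

lemma modulus_limit:
  assumes G: "\<And>n. G n \<in> A" and H: "\<And>n. H n \<in> A" "\<And>n. (\<lambda>x\<in>S. G n x * H n x) = (\<lambda>x\<in>S. 1)"
    and W_le: "\<And>a n. a \<in> A \<Longrightarrow> W a \<le> N (\<lambda>x\<in>S. a x * G n x)"
    and le_W: "\<And>a n. a \<in> A \<Longrightarrow> N (\<lambda>x\<in>S. a x * G n x) \<le> (1 + 1 / real (Suc n)) * W a"
  obtains f where "f \<in> modulus_closure_pos \<Omega> A" "\<And>a. a \<in> A \<Longrightarrow> N (\<lambda>x\<in>S. a x * f x) = W a"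
proof -
  define \<delta> where "\<delta> n = 1 / real (Suc n)" for n
  have \<delta>: "0 < \<delta> n" "\<delta> n \<le> 1" for n by (auto simp: \<delta>_def)
  have \<delta>_0: "\<delta> \<longlonglongrightarrow> 0" unfolding \<delta>_def using LIMSEQ_inverse_real_of_nat by (simp add: inverse_eq_divide)
  have GH: "G n x * H n x = 1" if "x \<in> S" for n x using fun_cong[OF H(2)[of n], of x] that by simp
  have cmp: "cmod (G n x) \<le> (1 + \<delta> n) * cmod (G m x)" if x: "x \<in> S" for n m x
  proof -
    have "N (\<lambda>x\<in>S. H m x * G m x) \<le> 1"
      using GH by (intro N_le mult_mem H G) (auto simp: mult.commute)
    then have "W (H m) \<le> 1" using W_le[OF H(1), of m m] by simp
    have "cmod (H m x * G n x) \<le> N (\<lambda>x\<in>S. H m x * G n x)"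
      using N_upper[OF mult_mem[OF H(1) G] x, of m n] x by simp
    also have "\<dots> \<le> (1 + \<delta> n) * W (H m)" unfolding \<delta>_def by (rule le_W[OF H(1)])
    also have "\<dots> \<le> (1 + \<delta> n) * 1" using \<open>W (H m) \<le> 1\<close> \<delta>(1)[of n] by (intro mult_left_mono) auto
    finally have "cmod (H m x * G n x) * cmod (G m x) \<le> (1 + \<delta> n) * 1 * cmod (G m x)"
      by (rule mult_right_mono) simp
    moreover have "cmod (H m x * G n x) * cmod (G m x) = cmod (G m x * H m x) * cmod (G n x)"
      by (simp add: norm_mult)
    ultimately show ?thesis using GH[OF x, of m] by simp
  qed
  \<comment> \<open>Since \<open>\<delta> n \<le> 1\<close>, \<open>cmp\<close> with
    \<open>m = 0\<close> bounds every \<open>G n\<close> by twice the first.\<close>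
  define B where "B = 2 * N (G 0)"
  have B: "cmod (G n x) \<le> B" if x: "x \<in> S" for n x
  proof -
    have "cmod (G n x) \<le> (1 + \<delta> n) * cmod (G 0 x)" by (rule cmp[OF x])
    also have "\<dots> \<le> 2 * N (G 0)" using \<delta>[of n] N_upper[OF G x, of 0] by (intro mult_mono) auto
    finally show ?thesis by (simp add: B_def)
  qed
  define s where "s n x = complex_of_real (cmod (G n x))" for n x
  have diff: "cmod (G n x) - cmod (G m x) \<le> \<delta> n * B" if x: "x \<in> S" for n m x
  proof -
    have "\<delta> n * cmod (G m x) \<le> \<delta> n * B" using \<delta>(1)[of n] B[OF x] by (intro mult_left_mono) auto
    then show ?thesis using cmp[OF x, of n m] by (simp add: distrib_right)
  qed
  have "uniformly_Cauchy_on S s"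
    unfolding uniformly_Cauchy_on_def
  proof (intro allI impI)
    fix e :: real assume e: "e > 0"
    have "(\<lambda>n. \<delta> n * B) \<longlonglongrightarrow> 0" by (rule tendsto_mult_left_zero[OF \<delta>_0])
    then have "\<forall>\<^sub>F n in sequentially. \<delta> n * B < e" using e by (rule order_tendstoD)
    then obtain n0 where n0: "\<And>n. n \<ge> n0 \<Longrightarrow> \<delta> n * B < e" by (auto simp: eventually_sequentially)
    show "\<exists>M. \<forall>x\<in>S. \<forall>m\<ge>M. \<forall>n\<ge>M. dist (s m x) (s n x) < e"
    proof (intro exI ballI allI impI)
      fix x m n assume "x \<in> S" "n0 \<le> m" "n0 \<le> n"
      then have "\<bar>cmod (G m x) - cmod (G n x)\<bar> < e"
        using diff[of x m n] diff[of x n m] n0[of m] n0[of n] by linarith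
      then show "dist (s m x) (s n x) < e"
        unfolding s_def dist_norm of_real_diff[symmetric] norm_of_real .
    qed
  qed
  then obtain f0 where f0: "uniform_limit S s f0 sequentially"
    using Cauchy_uniformly_convergent by (auto simp: uniformly_convergent_on_def)
  define f where "f = restrict f0 S"
  have s_C: "restrict (s n) S \<in> carrier (C_ring \<Omega>)" for n
    using C_ring_continuous[OF mem_C[OF G[of n]]] unfolding s_def
    by (intro C_ring_restrictI[OF compact])
       (auto simp: continuous_map_atin intro!: tendsto_of_real tendsto_norm)
  have "uniform_limit S (\<lambda>n. restrict (s n) S) f0 sequentially"
    using f0 by (auto simp: uniform_limit_iff)
  then have f_C: "f \<in> carrier (C_ring \<Omega>)"
    unfolding f_def by (rule uniform_limit_in_C_ring[OF compact s_C])
  have lim: "(\<lambda>n. cmod (G n x)) \<longlonglongrightarrow> Re (f x)" and Im: "Im (f x) = 0" if x: "x \<in> S" for x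
  proof -
    have *: "(\<lambda>n. s n x) \<longlonglongrightarrow> f x" using tendsto_uniform_limitI[OF f0 x] x by (simp add: f_def)
    show "(\<lambda>n. cmod (G n x)) \<longlonglongrightarrow> Re (f x)" using tendsto_Re[OF *] by (simp add: s_def)
    show "Im (f x) = 0" using tendsto_Im[OF *] by (simp add: s_def LIMSEQ_const_iff)
  qed
  \<comment> \<open>Letting \<open>m\<close> in \<open>cmp\<close> tend to infinity gives this
    bound, letting \<open>n\<close> do so gives the next. So \<open>f\<close> lies between
    \<open>cmod (G n)\<close> and its quotient by \<open>1 + \<delta> n\<close>; in particular it
    inherits positivity from the invertible \<open>G 0\<close>.\<close>
  have G_le: "cmod (G n x) \<le> (1 + \<delta> n) * Re (f x)" if x: "x \<in> S" for n x
    by (rule LIMSEQ_le_const[OF tendsto_mult_left[OF lim[OF x]]]) (use cmp[OF x] in blast)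
  have le_G: "Re (f x) \<le> cmod (G m x)" if x: "x \<in> S" for m x
  proof (rule LIMSEQ_le[OF lim[OF x]])
    have "(\<lambda>n. (1 + \<delta> n) * cmod (G m x)) \<longlonglongrightarrow> (1 + 0) * cmod (G m x)"
      by (intro tendsto_intros \<delta>_0)
    then show "(\<lambda>n. (1 + \<delta> n) * cmod (G m x)) \<longlonglongrightarrow> cmod (G m x)" by simp
  qed (use cmp[OF x] in auto)
  have pos: "Re (f x) > 0" if x: "x \<in> S" for x
  proof -
    have "G 0 x \<noteq> 0" using GH[OF x, of 0] by auto
    then have "0 < (1 + \<delta> 0) * Re (f x)"
      using G_le[OF x, of 0] by (meson less_le_trans zero_less_norm_iff)
    then show ?thesis using \<delta>(1)[of 0] by (simp add: zero_less_mult_iff)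
  qed
  have cf: "cmod (f x) = Re (f x)" if x: "x \<in> S" for x
    using Im[OF x] pos[OF x] by (simp add: cmod_def)
  show thesis
  proof
    show "f \<in> modulus_closure_pos \<Omega> A"
      unfolding modulus_closure_pos_iff
    proof (intro conjI ballI allI impI f_C Im pos)
      fix r :: real assume r: "r > 0"
      have "\<forall>\<^sub>F n in sequentially. \<delta> n * B < r"
        using tendsto_mult_left_zero[OF \<delta>_0] r by (rule order_tendstoD)
      then obtain n where n: "\<delta> n * B < r" by (auto simp: eventually_sequentially)
      have "\<bar>Re (f x) - cmod (G n x)\<bar> \<le> r" if x: "x \<in> S" for x
      proof -
        have "Re (f x) \<le> B" using le_G[OF x, of n] B[OF x, of n] by linarith
        then have "\<delta> n * Re (f x) \<le> \<delta> n * B" using \<delta>(1)[of n] by (intro mult_left_mono) auto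
        then show ?thesis using G_le[OF x, of n] le_G[OF x, of n] n by (simp add: distrib_right)
      qed
      then show "\<exists>g\<in>A. (\<exists>h\<in>A. (\<lambda>x\<in>S. g x * h x) = (\<lambda>x\<in>S. 1)) \<and> (\<forall>x\<in>S. \<bar>Re (f x) - cmod (g x)\<bar> \<le> r)"
        using G H by blast
    qed
    fix a assume a: "a \<in> A"
    have af: "(\<lambda>x\<in>S. a x * f x) \<in> carrier (C_ring \<Omega>)"
      using C_ring_continuous[OF mem_C[OF a]] C_ring_continuous[OF f_C]
      by (intro C_ring_restrictI[OF compact]) (auto simp: continuous_map_atin intro!: tendsto_mult)
    have aG: "(\<lambda>x\<in>S. a x * G n x) \<in> A" for n by (rule mult_mem[OF a G])
    have "N (\<lambda>x\<in>S. a x * f x) \<le> (1 + \<delta> n) * W a" for n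
    proof -
      have "N (\<lambda>x\<in>S. a x * f x) \<le> N (\<lambda>x\<in>S. a x * G n x)"
      proof (rule sup_norm_le[OF compact af])
        fix x assume x: "x \<in> S"
        have "cmod (a x) * cmod (f x) \<le> cmod (a x) * cmod (G n x)"
          using le_G[OF x] cf[OF x] by (intro mult_left_mono) auto
        then show "cmod ((\<lambda>x\<in>S. a x * f x) x) \<le> N (\<lambda>x\<in>S. a x * G n x)"
          using N_upper[OF aG x, of n] x by (simp add: norm_mult)
      qed (rule N_nonneg)
      also have "\<dots> \<le> (1 + \<delta> n) * W a" unfolding \<delta>_def by (rule le_W[OF a])
      finally show ?thesis .
    qed
    moreover have "(\<lambda>n. (1 + \<delta> n) * W a) \<longlonglongrightarrow> (1 + 0) * W a" by (intro tendsto_intros \<delta>_0)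
    ultimately have "N (\<lambda>x\<in>S. a x * f x) \<le> (1 + 0) * W a" by (intro Lim_bounded2) auto
    moreover have "W a \<le> (1 + \<delta> n) * N (\<lambda>x\<in>S. a x * f x)" for n
    proof -
      have "W a \<le> N (\<lambda>x\<in>S. a x * G n x)" by (rule W_le[OF a])
      also have "\<dots> \<le> (1 + \<delta> n) * N (\<lambda>x\<in>S. a x * f x)"
      proof (rule N_le[OF aG])
        fix x assume x: "x \<in> S"
        have "cmod (a x) * cmod (G n x) \<le> cmod (a x) * ((1 + \<delta> n) * cmod (f x))"
          using G_le[OF x] cf[OF x] by (intro mult_left_mono) auto
        also have "\<dots> = (1 + \<delta> n) * cmod ((\<lambda>x\<in>S. a x * f x) x)" using x by (simp add: norm_mult)
        also have "\<dots> \<le> (1 + \<delta> n) * N (\<lambda>x\<in>S. a x * f x)"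
          using sup_norm_upper[OF compact af x] \<delta>(1)[of n] by (intro mult_left_mono) auto
        finally show "cmod ((\<lambda>x\<in>S. a x * G n x) x) \<le> (1 + \<delta> n) * N (\<lambda>x\<in>S. a x * f x)"
          using x by (simp add: norm_mult)
      qed (use \<delta>(1)[of n] N_nonneg in auto)
      finally show ?thesis .
    qed
    moreover have "(\<lambda>n. (1 + \<delta> n) * N (\<lambda>x\<in>S. a x * f x)) \<longlonglongrightarrow> (1 + 0) * N (\<lambda>x\<in>S. a x * f x)"
      by (intro tendsto_intros \<delta>_0)
    ultimately have "W a \<le> (1 + 0) * N (\<lambda>x\<in>S. a x * f x)" by (intro Lim_bounded2) auto
    then show "N (\<lambda>x\<in>S. a x * f x) = W a"
      using \<open>N (\<lambda>x\<in>S. a x * f x) \<le> (1 + 0) * W a\<close> by simp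
  qed
qed

end

context unif_alg_module
begin

section \<open>Module isomorphisms onto \<open>A\<close> and their generators\<close>

lemma self_scalar_isoD:
  assumes "scalar_iso A X (self_module \<Omega> A) T"
  shows "bij_betw T (carrier X) A" "x \<in> carrier X \<Longrightarrow> T x \<in> A"
    and "x \<in> carrier X \<Longrightarrow> y \<in> carrier X \<Longrightarrow> T (x \<oplus>\<^bsub>X\<^esub> y) = (\<lambda>t\<in>S. T x t + T y t)"
    and "a \<in> A \<Longrightarrow> x \<in> carrier X \<Longrightarrow> T (a \<odot>\<^bsub>X\<^esub> x) = (\<lambda>t\<in>S. a t * T x t)"
  using scalar_isoD[OF assms] by (simp_all add: fun_module_simps)

lemma almost_isometric_modules_iff:
  "almost_isometric_modules A X (self_module \<Omega> A) \<longleftrightarrow>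
    (\<forall>\<epsilon>>0. \<exists>T p q. scalar_iso A X (self_module \<Omega> A) T \<and> 0 < p \<and> 0 < q \<and> p * q < 1 + \<epsilon> \<and>
      (\<forall>x\<in>carrier X. N (T x) \<le> p * nrm X x \<and> nrm X x \<le> q * N (T x)))"
  unfolding almost_isometric_modules_def
  using almost_isometric_over_iff[OF self_module, of A] const_fun_mem by (auto simp: fun_module_simps)

lemma almost_isometric_spaces_iff:
  "almost_isometric_spaces \<Omega> X (self_module \<Omega> A) \<longleftrightarrow>
    (\<forall>\<epsilon>>0. \<exists>T p q. scalar_iso (range (const_fun \<Omega>)) X (self_module \<Omega> A) T \<and>
      0 < p \<and> 0 < q \<and> p * q < 1 + \<epsilon> \<and>
      (\<forall>x\<in>carrier X. N (T x) \<le> p * nrm X x \<and> nrm X x \<le> q * N (T x)))"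
  unfolding almost_isometric_spaces_def
  using almost_isometric_over_iff[OF self_module, of "range (const_fun \<Omega>)"] const_fun_mem
  by (auto simp: fun_module_simps)

text \<open>The generator is the preimage of \<open>1\<close>: both \<open>x\<close> and
  \<open>T x\<close> times \<open>x0\<close> have image \<open>T x\<close>.\<close>

lemma self_iso_generator:
  assumes T: "scalar_iso A X (self_module \<Omega> A) T"
  obtains x0 where "x0 \<in> carrier X" "T x0 = (\<lambda>t\<in>S. 1)" "\<And>x. x \<in> carrier X \<Longrightarrow> T x \<odot>\<^bsub>X\<^esub> x0 = x"
proof -
  note T' = self_scalar_isoD[OF T]
  obtain x0 where x0: "x0 \<in> carrier X" "T x0 = (\<lambda>t\<in>S. 1)"
    using T'(1) const_mem[of 1] by (metis bij_betw_def imageE)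
  have "T x \<odot>\<^bsub>X\<^esub> x0 = x" if x: "x \<in> carrier X" for x
  proof -
    have "T (T x \<odot>\<^bsub>X\<^esub> x0) = T x"
      unfolding T'(4)[OF T'(2)[OF x] x0(1)] x0(2)
      by (rule mem_eqI[OF mult_mem[OF T'(2)[OF x] const_mem] T'(2)[OF x]]) simp
    then show ?thesis
      using T'(1) X_smult_mem[OF T'(2)[OF x] x0(1)] x by (auto simp: bij_betw_def inj_on_def)
  qed
  with x0 show thesis using that by blast
qed

lemma self_iso_imp_generated_faithful:
  assumes T: "scalar_iso A X (self_module \<Omega> A) T"
  shows "singly_generated A X" "faithful \<Omega> A X"
proof -
  note T' = self_scalar_isoD[OF T]
  obtain x0 where x0: "x0 \<in> carrier X" "T x0 = (\<lambda>t\<in>S. 1)"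
    "\<And>x. x \<in> carrier X \<Longrightarrow> T x \<odot>\<^bsub>X\<^esub> x0 = x" using self_iso_generator[OF T] by blast
  have "carrier X = (\<lambda>a. a \<odot>\<^bsub>X\<^esub> x0) ` A"
    using x0(3) T'(2) X_smult_mem[OF _ x0(1)] by (auto simp: image_iff) (metis T'(2) x0(3))
  then show "singly_generated A X" unfolding singly_generated_def using x0(1) by blast
  show "faithful \<Omega> A X"
    unfolding faithful_def
  proof (intro ballI impI)
    fix a assume a: "a \<in> A" "\<forall>x\<in>carrier X. a \<odot>\<^bsub>X\<^esub> x = \<zero>\<^bsub>X\<^esub>"
    have eq: "(\<lambda>t\<in>S. 0) \<odot>\<^bsub>X\<^esub> x0 = \<zero>\<^bsub>X\<^esub>"
      using nrm_scale[OF x0(1), of 0] nrm_eq_0[OF X_smult_mem[OF const_fun_mem x0(1)]]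
      by (simp add: const_fun_def)
    have "T (a \<odot>\<^bsub>X\<^esub> x0) = T ((\<lambda>t\<in>S. 0) \<odot>\<^bsub>X\<^esub> x0)" using a(2) x0(1) eq by simp
    then have *: "(\<lambda>t\<in>S. a t * (\<lambda>t\<in>S. 1) t) = (\<lambda>t\<in>S. (\<lambda>t\<in>S. 0) t * (\<lambda>t\<in>S. 1) t)"
      unfolding T'(4)[OF a(1) x0(1)] T'(4)[OF const_mem x0(1)] x0(2) .
    have "a = (\<lambda>t\<in>S. 0)"
    proof (rule mem_eqI[OF a(1) const_mem])
      fix t assume "t \<in> S"
      then show "a t = (\<lambda>t\<in>S. 0) t" using fun_cong[OF *, of t] by simp
    qed
    then show "a = \<zero>\<^bsub>C_ring \<Omega>\<^esub>" by (simp only: C_ring_simps)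
  qed
qed

lemma almost_isometric_imp_principal:
  assumes "almost_isometric_modules A X (self_module \<Omega> A)"
  shows "\<exists>f\<in>modulus_closure_pos \<Omega> A. isometric_modules A X (principal_module \<Omega> A f)"
proof -
  have "\<forall>n. \<exists>T p q. scalar_iso A X (self_module \<Omega> A) T \<and> 0 < p \<and> 0 < q \<and> p * q < 1 + 1 / real (Suc n) \<and>
      (\<forall>x\<in>carrier X. N (T x) \<le> p * nrm X x \<and> nrm X x \<le> q * N (T x))"
    using assms unfolding almost_isometric_modules_iff by (metis divide_pos_pos of_nat_0_less_iff zero_less_Suc zero_less_one)
  then obtain T p q where T: "\<And>n. scalar_iso A X (self_module \<Omega> A) (T n)"
    and pq: "\<And>n. 0 < p n" "\<And>n. 0 < q n" "\<And>n. p n * q n < 1 + 1 / real (Suc n)"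
    and T_le: "\<And>n x. x \<in> carrier X \<Longrightarrow> N (T n x) \<le> p n * nrm X x"
    and le_T: "\<And>n x. x \<in> carrier X \<Longrightarrow> nrm X x \<le> q n * N (T n x)"
    by metis
  note T' = self_scalar_isoD[OF T]
  obtain x0 where x0: "x0 \<in> carrier X" "T 0 x0 = (\<lambda>t\<in>S. 1)"
    "\<And>x. x \<in> carrier X \<Longrightarrow> T 0 x \<odot>\<^bsub>X\<^esub> x0 = x" using self_iso_generator[OF T] by blast
  \<comment> \<open>The inverse of \<open>T n x0\<close> is \<open>T 0 x\<close>, where
    \<open>T n x = 1\<close>: by \<open>A\<close>-linearity of \<open>T n\<close> their product is
    the image of \<open>T 0 x\<close> times \<open>x0\<close>, which is \<open>x\<close>.\<close>
  have "\<exists>h\<in>A. (\<lambda>t\<in>S. T n x0 t * h t) = (\<lambda>t\<in>S. 1)" for n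
  proof -
    obtain x where x: "x \<in> carrier X" "T n x = (\<lambda>t\<in>S. 1)" using self_iso_generator[OF T[of n]] by blast
    have "(\<lambda>t\<in>S. T n x0 t * T 0 x t) = T n (T 0 x \<odot>\<^bsub>X\<^esub> x0)"
      unfolding T'(4)[OF T'(2)[OF x(1)] x0(1)] by (intro restrict_ext) simp
    also have "\<dots> = (\<lambda>t\<in>S. 1)" unfolding x0(3)[OF x(1)] by (rule x(2))
    finally show ?thesis using T'(2)[OF x(1), of 0] by blast
  qed
  then obtain h where h: "\<And>n. h n \<in> A" "\<And>n. (\<lambda>t\<in>S. T n x0 t * h n t) = (\<lambda>t\<in>S. 1)" by metis
  \<comment> \<open>The factor \<open>q n\<close> turns the lower bound for \<open>T n\<close> into
    \<open>W_le\<close>, which has no constant; the upper bound then contains the product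
    \<open>p n * q n\<close>.\<close>
  define G where "G n = (\<lambda>t\<in>S. of_real (q n) * T n x0 t)" for n
  define H where "H n = (\<lambda>t\<in>S. of_real (1 / q n) * h n t)" for n
  have G: "G n \<in> A" and H: "H n \<in> A" for n
    unfolding G_def H_def by (intro scale_mem T' x0 h)+
  have GH: "(\<lambda>t\<in>S. G n t * H n t) = (\<lambda>t\<in>S. 1)" for n
    unfolding h(2)[of n, symmetric] G_def H_def using pq(2)[of n] by (intro restrict_ext) simp
  have NG: "N (\<lambda>t\<in>S. a t * G n t) = q n * N (T n (a \<odot>\<^bsub>X\<^esub> x0))" if a: "a \<in> A" for a n
  proof -
    have eq: "(\<lambda>t\<in>S. a t * G n t) = (\<lambda>t\<in>S. of_real (q n) * T n (a \<odot>\<^bsub>X\<^esub> x0) t)"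
      unfolding T'(4)[OF a x0(1)] G_def by (intro restrict_ext) simp
    show ?thesis
      unfolding eq using pq(2)[of n] by (intro N_scale_real T' X_smult_mem a x0) simp
  qed
  have W_le: "nrm X (a \<odot>\<^bsub>X\<^esub> x0) \<le> N (\<lambda>t\<in>S. a t * G n t)" if a: "a \<in> A" for a n
    unfolding NG[OF a] by (rule le_T[OF X_smult_mem[OF a x0(1)]])
  have le_W: "N (\<lambda>t\<in>S. a t * G n t) \<le> (1 + 1 / real (Suc n)) * nrm X (a \<odot>\<^bsub>X\<^esub> x0)" if a: "a \<in> A" for a n
  proof -
    have ax: "a \<odot>\<^bsub>X\<^esub> x0 \<in> carrier X" by (rule X_smult_mem[OF a x0(1)])
    have "q n * N (T n (a \<odot>\<^bsub>X\<^esub> x0)) \<le> q n * (p n * nrm X (a \<odot>\<^bsub>X\<^esub> x0))"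
      using T_le[OF ax] pq(2)[of n] by (intro mult_left_mono) auto
    also have "\<dots> = (p n * q n) * nrm X (a \<odot>\<^bsub>X\<^esub> x0)" by simp
    also have "\<dots> \<le> (1 + 1 / real (Suc n)) * nrm X (a \<odot>\<^bsub>X\<^esub> x0)"
      using pq(3)[of n] nrm_nonneg[OF ax] by (intro mult_right_mono) auto
    finally show ?thesis unfolding NG[OF a] .
  qed
  obtain f where f: "f \<in> modulus_closure_pos \<Omega> A"
    and Nf: "\<And>a. a \<in> A \<Longrightarrow> N (\<lambda>t\<in>S. a t * f t) = nrm X (a \<odot>\<^bsub>X\<^esub> x0)"
    using G H GH W_le le_W
  proof (rule modulus_limit)
    fix f assume "f \<in> modulus_closure_pos \<Omega> A"
      "\<And>a. a \<in> A \<Longrightarrow> N (\<lambda>t\<in>S. a t * f t) = nrm X (a \<odot>\<^bsub>X\<^esub> x0)"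
    then show thesis by (rule that)
  qed
  have f_ne: "f t \<noteq> 0" if "t \<in> S" for t
    using f that unfolding modulus_closure_pos_iff by auto
  \<comment> \<open>Each \<open>x\<close> is \<open>T 0 x\<close> times \<open>x0\<close>, so
    \<open>U\<close> replaces the generator by \<open>f\<close>, and \<open>Nf\<close> says that
    this preserves norms.\<close>
  define U where "U x = (\<lambda>t\<in>S. T 0 x t * f t)" for x
  have "inj_on U (carrier X)"
  proof (rule inj_onI)
    fix x y assume x: "x \<in> carrier X" and y: "y \<in> carrier X" and eq: "U x = U y"
    have "T 0 x = T 0 y"
    proof (rule mem_eqI[OF T'(2)[OF x] T'(2)[OF y]])
      fix t assume t: "t \<in> S"
      then show "T 0 x t = T 0 y t" using fun_cong[OF eq, of t] f_ne[OF t] by (simp add: U_def)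
    qed
    then have "T 0 x \<odot>\<^bsub>X\<^esub> x0 = T 0 y \<odot>\<^bsub>X\<^esub> x0" by (rule arg_cong)
    then show "x = y" unfolding x0(3)[OF x] x0(3)[OF y] .
  qed
  moreover have "U ` carrier X = (\<lambda>a. \<lambda>t\<in>S. a t * f t) ` A"
  proof -
    have "U = (\<lambda>a. \<lambda>t\<in>S. a t * f t) \<circ> T 0" by (simp add: U_def fun_eq_iff)
    then have "U ` carrier X = (\<lambda>a. \<lambda>t\<in>S. a t * f t) ` T 0 ` carrier X" by (simp only: image_comp)
    then show ?thesis using T'(1)[of 0] by (simp only: bij_betw_def)
  qed
  ultimately have bij: "bij_betw U (carrier X) (carrier (principal_module \<Omega> A f))"
    by (simp add: bij_betw_def principal_module_def fun_module_simps C_ring_simps)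
  have "scalar_iso A X (principal_module \<Omega> A f) U"
    unfolding scalar_iso_def
  proof (intro conjI ballI bij)
    fix x y assume "x \<in> carrier X" "y \<in> carrier X"
    then show "U (x \<oplus>\<^bsub>X\<^esub> y) = U x \<oplus>\<^bsub>principal_module \<Omega> A f\<^esub> U y"
      unfolding principal_module_def fun_module_simps U_def
      by (simp only: T'(3)) (intro restrict_ext, simp add: distrib_right)
  next
    fix a x assume "a \<in> A" "x \<in> carrier X"
    then show "U (a \<odot>\<^bsub>X\<^esub> x) = a \<odot>\<^bsub>principal_module \<Omega> A f\<^esub> U x"
      unfolding principal_module_def fun_module_simps U_def
      by (simp only: T'(4)) (intro restrict_ext, simp)
  qed
  moreover have "nrm (principal_module \<Omega> A f) (U x) = nrm X x" if x: "x \<in> carrier X" for x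
    using Nf[OF T'(2)[OF x]] x0(3)[OF x] by (simp add: principal_module_def fun_module_simps U_def)
  ultimately show ?thesis using f unfolding isometric_modules_def by blast
qed

end

subsection \<open>From moduli and linear almost isometries to module isomorphisms\<close>

lemma C_ring_add_inverse:
  assumes K: "compact_space K" and f: "f \<in> carrier (C_ring K)"
  shows "inv\<^bsub>add_monoid (C_ring K)\<^esub> f = (\<lambda>x\<in>topspace K. - f x)"
proof -
  have mem: "(\<lambda>x\<in>topspace K. - f x) \<in> carrier (C_ring K)"
    using C_ring_continuous[OF f] by (intro C_ring_restrictI[OF K] continuous_map_minus)
  show ?thesis
    unfolding m_inv_def
  proof (rule the_equality)
    show "(\<lambda>x\<in>topspace K. - f x) \<in> carrier (add_monoid (C_ring K)) \<and>
      f \<otimes>\<^bsub>add_monoid (C_ring K)\<^esub> (\<lambda>x\<in>topspace K. - f x) = \<one>\<^bsub>add_monoid (C_ring K)\<^esub> \<and>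
      (\<lambda>x\<in>topspace K. - f x) \<otimes>\<^bsub>add_monoid (C_ring K)\<^esub> f = \<one>\<^bsub>add_monoid (C_ring K)\<^esub>"
      using mem by (simp add: C_ring_simps del: mspace_cfunspace cong: restrict_cong)
  next
    fix g assume "g \<in> carrier (add_monoid (C_ring K)) \<and>
      f \<otimes>\<^bsub>add_monoid (C_ring K)\<^esub> g = \<one>\<^bsub>add_monoid (C_ring K)\<^esub> \<and>
      g \<otimes>\<^bsub>add_monoid (C_ring K)\<^esub> f = \<one>\<^bsub>add_monoid (C_ring K)\<^esub>"
    then have g: "g \<in> carrier (C_ring K)" and eq: "(\<lambda>x\<in>topspace K. g x + f x) = (\<lambda>x\<in>topspace K. 0)"
      by (simp_all add: C_ring_simps(3-5))
    show "g = (\<lambda>x\<in>topspace K. - f x)"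
    proof (rule C_ring_eqI[OF g mem])
      fix x assume "x \<in> topspace K"
      then show "g x = (\<lambda>x\<in>topspace K. - f x) x"
        using fun_cong[OF eq, of x] by (simp add: eq_neg_iff_add_eq_0)
    qed
  qed
qed

context unif_alg
begin

text \<open>Compactness makes the positivity of \<open>f\<close> uniform, so that division by
  \<open>f\<close> preserves uniform convergence.\<close>

lemma modulus_closure_pos_bound:
  assumes f: "f \<in> modulus_closure_pos \<Omega> A"
  obtains m where "m > 0" "\<And>x. x \<in> S \<Longrightarrow> m \<le> Re (f x)" "\<And>x. x \<in> S \<Longrightarrow> cmod (f x) = Re (f x)"
proof -
  have f': "f \<in> carrier (C_ring \<Omega>)" "\<And>x. x \<in> S \<Longrightarrow> Im (f x) = 0 \<and> Re (f x) > 0"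
    using f unfolding modulus_closure_pos_iff by auto
  have cf: "cmod (f x) = Re (f x)" if "x \<in> S" for x
    using f'(2)[OF that] by (simp add: cmod_def)
  show thesis
  proof (cases "S = {}")
    case True
    then show thesis using that[of 1] by auto
  next
    case False
    have "continuous_map \<Omega> euclideanreal (\<lambda>x. - Re (f x))"
      using C_ring_continuous[OF f'(1)]
      by (intro continuous_map_minus) (auto simp: continuous_map_atin intro!: tendsto_Re)
    then obtain x0 where "x0 \<in> S" "\<And>x. x \<in> S \<Longrightarrow> - Re (f x) \<le> - Re (f x0)"
      using attains_sup False by blast
    then show thesis using that[of "Re (f x0)"] f'(2) cf by auto
  qed
qed

text \<open>This yields the function module required in (i), represented over
  \<open>\<Omega>\<close> itself. The point with content is that \<open>A f\<close> is closed:
  division by \<open>f\<close>, which is bounded below, leads back to a uniform limit in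
  \<open>A\<close>.\<close>

lemma concrete_principal_module:
  assumes f: "f \<in> modulus_closure_pos \<Omega> A"
  shows "concrete_function_module \<Omega> A \<Omega> (\<lambda>a. a) ((\<lambda>a. a \<otimes>\<^bsub>C_ring \<Omega>\<^esub> f) ` A)"
proof -
  obtain m where m: "m > 0" "\<And>x. x \<in> S \<Longrightarrow> m \<le> Re (f x)" "\<And>x. x \<in> S \<Longrightarrow> cmod (f x) = Re (f x)"
    using modulus_closure_pos_bound[OF f] by blast
  have f_ne: "f x \<noteq> 0" if "x \<in> S" for x using m(1) m(2)[OF that] by auto
  have f_C: "f \<in> carrier (C_ring \<Omega>)" using f unfolding modulus_closure_pos_iff by blast
  define Y where "Y = (\<lambda>a. \<lambda>x\<in>S. a x * f x) ` A"
  have YI: "restrict y S \<in> Y" if "a \<in> A" "\<And>x. x \<in> S \<Longrightarrow> y x = a x * f x" for a y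
    unfolding Y_def using that by (intro image_eqI[of _ _ a] restrict_ext) auto
  have YC: "Y \<subseteq> carrier (C_ring \<Omega>)"
    unfolding Y_def using C_ring_continuous[OF mem_C] C_ring_continuous[OF f_C]
    by (intro image_subsetI C_ring_restrictI[OF compact])
       (auto simp: continuous_map_atin intro!: tendsto_mult)
  have smult: "(\<lambda>x\<in>S. a x * y x) \<in> Y" if a: "a \<in> A" and y: "y \<in> Y" for a y
  proof -
    obtain b where b: "b \<in> A" "y = (\<lambda>x\<in>S. b x * f x)" using y by (auto simp: Y_def)
    then show ?thesis by (intro YI[OF mult_mem[OF a b(1)]]) simp
  qed
  have "subgroup Y (add_monoid (C_ring \<Omega>))"
  proof
    show "Y \<subseteq> carrier (add_monoid (C_ring \<Omega>))" using YC by simp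
  next
    fix y z assume "y \<in> Y" "z \<in> Y"
    then obtain a b where "a \<in> A" "y = (\<lambda>x\<in>S. a x * f x)" "b \<in> A" "z = (\<lambda>x\<in>S. b x * f x)"
      by (auto simp: Y_def)
    then have "(\<lambda>x\<in>S. y x + z x) \<in> Y"
      by (intro YI[OF add_mem[of a b]]) (auto simp: distrib_right)
    then show "y \<otimes>\<^bsub>add_monoid (C_ring \<Omega>)\<^esub> z \<in> Y" by (simp only: monoid.simps C_ring_simps)
  next
    have "(\<lambda>x\<in>S. 0) \<in> Y" by (rule YI[OF const_mem[of 0]]) simp
    then show "\<one>\<^bsub>add_monoid (C_ring \<Omega>)\<^esub> \<in> Y" by (simp only: monoid.simps C_ring_simps)
  next
    fix y assume y: "y \<in> Y"
    then obtain a where "a \<in> A" "y = (\<lambda>x\<in>S. a x * f x)" by (auto simp: Y_def)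
    then have "(\<lambda>x\<in>S. - y x) \<in> Y" by (intro YI[OF scale_mem[of a "-1"]]) auto
    then show "inv\<^bsub>add_monoid (C_ring \<Omega>)\<^esub> y \<in> Y"
      using C_ring_add_inverse[OF compact] y YC by (metis subsetD)
  qed
  moreover have "closedin (sup_topology \<Omega>) Y"
    unfolding closedin_sup_topology_iff[OF compact]
  proof (intro conjI YC allI impI)
    fix s F assume s: "(\<forall>n. s n \<in> Y) \<and> uniform_limit S s F sequentially"
    then have "\<forall>n. \<exists>a\<in>A. s n = (\<lambda>x\<in>S. a x * f x)" by (auto simp: Y_def)
    then obtain a where a: "\<And>n. a n \<in> A" "\<And>n. s n = (\<lambda>x\<in>S. a n x * f x)" by metis
    have "uniform_limit S a (\<lambda>x. F x / f x) sequentially"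
    proof (rule uniform_limitI)
      fix e :: real assume "e > 0"
      then have "\<forall>\<^sub>F n in sequentially. \<forall>x\<in>S. dist (s n x) (F x) < e * m"
        using s m(1) by (intro uniform_limitD) auto
      then show "\<forall>\<^sub>F n in sequentially. \<forall>x\<in>S. dist (a n x) (F x / f x) < e"
      proof eventually_elim
        case (elim n)
        show ?case
        proof
          fix x assume x: "x \<in> S"
          have "a n x - F x / f x = (s n x - F x) / f x"
            using x f_ne[OF x] by (simp add: a(2) field_simps)
          then have "dist (a n x) (F x / f x) = dist (s n x) (F x) / Re (f x)"
            using m(3)[OF x] by (simp add: dist_norm norm_divide)
          also have "\<dots> \<le> dist (s n x) (F x) / m"
            using m(1) m(2)[OF x] by (intro divide_left_mono) auto
          also have "\<dots> < e" using elim x m(1) by (simp add: field_simps)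
          finally show "dist (a n x) (F x / f x) < e" .
        qed
      qed
    qed
    then have "(\<lambda>x\<in>S. F x / f x) \<in> A" by (rule uniform_limit_mem[OF a(1)])
    then show "restrict F S \<in> Y" by (rule YI) (simp add: f_ne)
  qed
  moreover have "(\<lambda>a. a) \<in> ring_hom (alg_ring \<Omega> A) (C_ring \<Omega>)"
    using mem_C by (intro ring_hom_memI) auto
  ultimately have "concrete_function_module \<Omega> A \<Omega> (\<lambda>a. a) Y"
    unfolding concrete_function_module_def C_ring_simps(2)
    using compact hausdorff smult const_mem[folded const_fun_def] by blast
  then show ?thesis unfolding Y_def C_ring_simps .
qed

end

context unif_alg_module
begin

text \<open>Some invertible \<open>g\<close> has modulus uniformly close to \<open>f\<close>, and
  exchanging the factor \<open>f\<close> for \<open>g\<close> changes norms only by a factor close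
  to \<open>1\<close>.\<close>

lemma isometric_principal_imp_almost:
  assumes f: "f \<in> modulus_closure_pos \<Omega> A" and iso: "isometric_modules A X (principal_module \<Omega> A f)"
  shows "almost_isometric_modules A X (self_module \<Omega> A)"
  unfolding almost_isometric_modules_iff
proof (intro allI impI)
  obtain m where m: "m > 0" "\<And>x. x \<in> S \<Longrightarrow> m \<le> Re (f x)" "\<And>x. x \<in> S \<Longrightarrow> cmod (f x) = Re (f x)"
    using modulus_closure_pos_bound[OF f] by blast
  have f_ne: "f x \<noteq> 0" if "x \<in> S" for x using m(1) m(2)[OF that] by auto
  have f_C: "f \<in> carrier (C_ring \<Omega>)" using f unfolding modulus_closure_pos_iff by blast
  obtain U where U: "scalar_iso A X (principal_module \<Omega> A f) U"
    and nU: "\<And>x. x \<in> carrier X \<Longrightarrow> N (U x) = nrm X x"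
    using iso unfolding isometric_modules_def principal_module_def fun_module_simps by blast
  define Y where "Y = (\<lambda>a. \<lambda>x\<in>S. a x * f x) ` A"
  have U': "bij_betw U (carrier X) Y"
    "\<And>x y. x \<in> carrier X \<Longrightarrow> y \<in> carrier X \<Longrightarrow> U (x \<oplus>\<^bsub>X\<^esub> y) = (\<lambda>t\<in>S. U x t + U y t)"
    "\<And>a x. a \<in> A \<Longrightarrow> x \<in> carrier X \<Longrightarrow> U (a \<odot>\<^bsub>X\<^esub> x) = (\<lambda>t\<in>S. a t * U x t)"
    using scalar_isoD[OF U] unfolding principal_module_def fun_module_simps C_ring_simps Y_def by blast+
  fix \<epsilon> :: real assume \<epsilon>: "\<epsilon> > 0"
  \<comment> \<open>For this value \<open>(1 + \<eta>) / (1 - \<eta>) = (4 + 3 \<epsilon>) / (4 +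
    \<epsilon>)\<close>, which is below \<open>1 + \<epsilon>\<close>.\<close>
  define \<eta> where "\<eta> = \<epsilon> / (4 + 2 * \<epsilon>)"
  have \<eta>: "\<eta> > 0" "\<eta> < 1" and \<eta>\<epsilon>: "(1 + \<eta>) * (1 / (1 - \<eta>)) < 1 + \<epsilon>"
    using \<epsilon> by (auto simp: \<eta>_def field_simps add_pos_pos)
  \<comment> \<open>The absolute error \<open>m * \<eta>\<close> is a relative error
    \<open>\<eta>\<close>, because \<open>m \<le> Re (f x)\<close>.\<close>
  obtain g h where g: "g \<in> A" and h: "h \<in> A" "(\<lambda>x\<in>S. g x * h x) = (\<lambda>x\<in>S. 1)"
    and fg: "\<And>x. x \<in> S \<Longrightarrow> \<bar>Re (f x) - cmod (g x)\<bar> \<le> m * \<eta>"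
    using f[unfolded modulus_closure_pos_iff, THEN conjunct2, THEN conjunct2, rule_format,
        OF mult_pos_pos[OF m(1) \<eta>(1)]] by blast
  have gh: "g x * h x = 1" if "x \<in> S" for x using fun_cong[OF h(2), of x] that by simp
  have "m * \<eta> \<le> Re (f x) * \<eta>" if "x \<in> S" for x using m(2)[OF that] \<eta> by (intro mult_right_mono) auto
  then have fg': "cmod (g x) \<le> (1 + \<eta>) * Re (f x)" "(1 - \<eta>) * Re (f x) \<le> cmod (g x)" if "x \<in> S" for x
    using fg[OF that] that by (auto simp: algebra_simps) (smt (verit))+
  define V where "V y = (\<lambda>t\<in>S. y t / f t * g t)" for y
  have V: "V (\<lambda>t\<in>S. a t * f t) = (\<lambda>t\<in>S. a t * g t)" for a
    unfolding V_def using f_ne by (intro restrict_ext) simp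
  have "bij_betw V Y A"
  proof (rule bij_betw_byWitness[where f' = "\<lambda>b. \<lambda>t\<in>S. (\<lambda>t\<in>S. b t * h t) t * f t"])
    show "\<forall>y\<in>Y. (\<lambda>t\<in>S. (\<lambda>t\<in>S. V y t * h t) t * f t) = y"
      unfolding Y_def using gh by (auto simp: V intro!: restrict_ext)
    show "\<forall>b\<in>A. V (\<lambda>t\<in>S. (\<lambda>t\<in>S. b t * h t) t * f t) = b"
    proof
      fix b assume b: "b \<in> A"
      show "V (\<lambda>t\<in>S. (\<lambda>t\<in>S. b t * h t) t * f t) = b"
        unfolding V using gh
        by (intro mem_eqI[OF mult_mem[OF mult_mem[OF b h(1)] g] b]) (simp add: mult.assoc mult.commute[of "h _"])
    qed
    show "V ` Y \<subseteq> A" unfolding Y_def using mult_mem[OF _ g] by (auto simp: V)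
    show "(\<lambda>b. \<lambda>t\<in>S. (\<lambda>t\<in>S. b t * h t) t * f t) ` A \<subseteq> Y"
      unfolding Y_def using mult_mem[OF _ h(1)] by (intro image_subsetI imageI)
  qed
  with U'(1) have bij: "bij_betw (V \<circ> U) (carrier X) A" by (rule bij_betw_trans)
  have iso: "scalar_iso A X (self_module \<Omega> A) (V \<circ> U)"
    unfolding scalar_iso_def fun_module_simps
  proof (intro conjI ballI bij)
    fix x y assume "x \<in> carrier X" "y \<in> carrier X"
    then show "(V \<circ> U) (x \<oplus>\<^bsub>X\<^esub> y) = (\<lambda>t\<in>S. (V \<circ> U) x t + (V \<circ> U) y t)"
      unfolding o_def V_def by (simp only: U'(2)) (intro restrict_ext, simp add: add_divide_distrib distrib_right)
  next
    fix a x assume "a \<in> A" "x \<in> carrier X"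
    then show "(V \<circ> U) (a \<odot>\<^bsub>X\<^esub> x) = (\<lambda>t\<in>S. a t * (V \<circ> U) x t)"
      unfolding o_def V_def by (simp only: U'(3)) (intro restrict_ext, simp)
  qed
  have norms: "N (V y) \<le> (1 + \<eta>) * N y \<and> N y \<le> 1 / (1 - \<eta>) * N (V y)" if y: "y \<in> Y" for y
  proof -
    obtain a where a: "a \<in> A" "y = (\<lambda>t\<in>S. a t * f t)" using y by (auto simp: Y_def)
    have y_C: "y \<in> carrier (C_ring \<Omega>)"
      unfolding a(2) using C_ring_continuous[OF mem_C[OF a(1)]] C_ring_continuous[OF f_C]
      by (intro C_ring_restrictI[OF compact]) (auto simp: continuous_map_atin intro!: tendsto_mult)
    have VA: "V y \<in> A" unfolding a(2) V by (rule mult_mem[OF a(1) g])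
    have yt: "cmod (y t) = cmod (a t) * Re (f t)" and Vt: "cmod (V y t) = cmod (a t) * cmod (g t)"
      if "t \<in> S" for t
      unfolding a(2) V using that m(3)[OF that] by (simp_all add: norm_mult)
    show ?thesis
    proof
      show "N (V y) \<le> (1 + \<eta>) * N y"
      proof (rule N_le[OF VA])
        fix t assume t: "t \<in> S"
        have "cmod (a t) * cmod (g t) \<le> cmod (a t) * ((1 + \<eta>) * Re (f t))"
          by (intro mult_left_mono fg'(1)[OF t]) simp
        also have "\<dots> = (1 + \<eta>) * cmod (y t)" by (simp add: yt[OF t])
        also have "\<dots> \<le> (1 + \<eta>) * N y"
          using sup_norm_upper[OF compact y_C t] \<eta> by (intro mult_left_mono) auto
        finally show "cmod (V y t) \<le> (1 + \<eta>) * N y" by (simp only: Vt[OF t])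
      qed (use \<eta> N_nonneg in auto)
      show "N y \<le> 1 / (1 - \<eta>) * N (V y)"
      proof (rule sup_norm_le[OF compact y_C])
        fix t assume t: "t \<in> S"
        have "cmod (a t) * ((1 - \<eta>) * Re (f t)) \<le> cmod (a t) * cmod (g t)"
          by (intro mult_left_mono fg'(2)[OF t]) simp
        then have "(1 - \<eta>) * cmod (y t) \<le> cmod (V y t)"
          unfolding yt[OF t] Vt[OF t] by (simp add: mult_ac)
        also have "\<dots> \<le> N (V y)" by (rule N_upper[OF VA t])
        finally show "cmod (y t) \<le> 1 / (1 - \<eta>) * N (V y)" using \<eta>(2) by (simp add: field_simps)
      qed (use \<eta> N_nonneg in auto)
    qed
  qed
  show "\<exists>T p q. scalar_iso A X (self_module \<Omega> A) T \<and> 0 < p \<and> 0 < q \<and> p * q < 1 + \<epsilon> \<and>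
      (\<forall>x\<in>carrier X. N (T x) \<le> p * nrm X x \<and> nrm X x \<le> q * N (T x))"
  proof (rule exI[of _ "V \<circ> U"], rule exI[of _ "1 + \<eta>"], rule exI[of _ "1 / (1 - \<eta>)"], intro conjI iso \<eta>\<epsilon> ballI)
    fix x assume x: "x \<in> carrier X"
    have "U x \<in> Y" using U'(1) x by (auto simp: bij_betw_def)
    then show "N ((V \<circ> U) x) \<le> (1 + \<eta>) * nrm X x" "nrm X x \<le> 1 / (1 - \<eta>) * N ((V \<circ> U) x)"
      using norms[of "U x"] nU[OF x] by auto
  qed (use \<eta> in auto)
qed

text \<open>The generator identifies \<open>X\<close> with \<open>A\<close> as a vector space, so a
  linear isomorphism of \<open>X\<close> onto \<open>A\<close> becomes a linear bijection of
  \<open>A\<close>, to which the results on uniform algebras apply.\<close>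

lemma linear_map_of_scalar_iso:
  assumes T: "scalar_iso (range (const_fun \<Omega>)) X (self_module \<Omega> A) T"
    and x0: "x0 \<in> carrier X" and bij: "bij_betw (\<lambda>a. a \<odot>\<^bsub>X\<^esub> x0) A (carrier X)"
  shows "linear_map (\<lambda>a. T (a \<odot>\<^bsub>X\<^esub> x0))" "bij_betw (\<lambda>a. T (a \<odot>\<^bsub>X\<^esub> x0)) A A"
proof -
  note T' = scalar_isoD[OF T, unfolded fun_module_simps]
  show "bij_betw (\<lambda>a. T (a \<odot>\<^bsub>X\<^esub> x0)) A A"
    using bij_betw_trans[OF bij T'(1)] by (simp add: o_def)
  show "linear_map (\<lambda>a. T (a \<odot>\<^bsub>X\<^esub> x0))"
    unfolding linear_map_def
  proof (intro conjI ballI allI)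
    fix a assume a: "a \<in> A"
    note ax = X_smult_mem[OF a x0]
    show "T (a \<odot>\<^bsub>X\<^esub> x0) \<in> A" by (rule T'(2)[OF ax])
    fix b assume b: "b \<in> A"
    show "T ((\<lambda>t\<in>S. a t + b t) \<odot>\<^bsub>X\<^esub> x0) = (\<lambda>t\<in>S. T (a \<odot>\<^bsub>X\<^esub> x0) t + T (b \<odot>\<^bsub>X\<^esub> x0) t)"
      unfolding X_smult_add[OF a b x0] by (rule T'(3)[OF ax X_smult_mem[OF b x0]])
  next
    fix c a assume a: "a \<in> A"
    note ax = X_smult_mem[OF a x0]
    have eq: "(\<lambda>t\<in>S. c * a t) = (\<lambda>t\<in>S. const_fun \<Omega> c t * a t)"
      by (intro restrict_ext) (simp add: const_fun_def)
    have "T (const_fun \<Omega> c \<odot>\<^bsub>X\<^esub> (a \<odot>\<^bsub>X\<^esub> x0)) = (\<lambda>t\<in>S. const_fun \<Omega> c t * T (a \<odot>\<^bsub>X\<^esub> x0) t)"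
      by (rule T'(4)[OF _ ax]) simp
    also have "\<dots> = (\<lambda>t\<in>S. c * T (a \<odot>\<^bsub>X\<^esub> x0) t)"
      by (intro restrict_ext) (simp add: const_fun_def)
    finally show "T ((\<lambda>t\<in>S. c * a t) \<odot>\<^bsub>X\<^esub> x0) = (\<lambda>t\<in>S. c * T (a \<odot>\<^bsub>X\<^esub> x0) t)"
      unfolding eq X_smult_mult[OF const_fun_mem a x0] .
  qed
qed

lemma function_module_imp_almost:
  assumes gen: "singly_generated A X" and faithful: "faithful \<Omega> A X"
    and fm: "function_module \<Omega> A X" and almost: "almost_isometric_spaces \<Omega> X (self_module \<Omega> A)"
  shows "almost_isometric_modules A X (self_module \<Omega> A)"
  unfolding almost_isometric_modules_iff
proof (intro allI impI)
  obtain x0 where x0: "x0 \<in> carrier X" "carrier X = (\<lambda>a. a \<odot>\<^bsub>X\<^esub> x0) ` A"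
    using gen by (auto simp: singly_generated_def)
  have bij: "bij_betw (\<lambda>a. a \<odot>\<^bsub>X\<^esub> x0) A (carrier X)"
    by (rule faithful_generator_inj[OF faithful x0])
  have ax: "a \<odot>\<^bsub>X\<^esub> x0 \<in> carrier X" if "a \<in> A" for a by (rule X_smult_mem[OF that x0(1)])
  have W_N: "nrm X (a \<odot>\<^bsub>X\<^esub> x0) \<le> nrm X x0 * N a" if "a \<in> A" for a
    using nrm_smult[OF that x0(1)] by (simp add: mult.commute)
  obtain K :: "(('m \<Rightarrow> complex) \<times> (('w \<Rightarrow> complex) \<Rightarrow> complex)) topology" and \<pi> Y
    where conc: "concrete_function_module \<Omega> A K \<pi> Y" and isom: "isometric_modules A X (fun_module K \<pi> Y)"
    using fm unfolding function_module_def by blast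
  obtain U where U: "scalar_iso A X (fun_module K \<pi> Y) U"
    and nU: "\<And>x. x \<in> carrier X \<Longrightarrow> sup_norm K (U x) = nrm X x"
    using isom unfolding isometric_modules_def fun_module_simps by blast
  note U' = scalar_isoD[OF U, unfolded fun_module_simps]
  have K: "compact_space K" and hom: "\<pi> \<in> ring_hom (alg_ring \<Omega> A) (C_ring K)"
    and \<pi>_const: "\<And>c. \<pi> (const_fun \<Omega> c) = const_fun K c"
    and YC: "Y \<subseteq> carrier (C_ring K)"
    using conc closedin_sup_topology_iff[of K Y] unfolding concrete_function_module_def by auto
  have \<pi>_mult: "\<pi> (\<lambda>x\<in>S. a x * b x) k = \<pi> a k * \<pi> b k"
    and \<pi>_add: "\<pi> (\<lambda>x\<in>S. a x + b x) k = \<pi> a k + \<pi> b k"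
    if "a \<in> A" "b \<in> A" "k \<in> topspace K" for a b k
    using ring_hom_mult[OF hom, of a b] ring_hom_add[OF hom, of a b] that
    by (simp_all add: C_ring_simps)
  have \<pi>_c: "\<pi> (\<lambda>x\<in>S. c) k = c" if "k \<in> topspace K" for c k
    using \<pi>_const[of c] that by (simp add: const_fun_def)
  define y where "y = U x0"
  have UC: "U (a \<odot>\<^bsub>X\<^esub> x0) \<in> carrier (C_ring K)" if "a \<in> A" for a
    using U'(2)[OF ax[OF that]] YC by blast
  have Uk: "U (a \<odot>\<^bsub>X\<^esub> x0) k = \<pi> a k * y k" if "a \<in> A" "k \<in> topspace K" for a k
    using U'(4)[OF that(1) x0(1)] that(2) by (simp add: y_def)
  have W_upper: "cmod (\<pi> a k * y k) \<le> nrm X (a \<odot>\<^bsub>X\<^esub> x0)" if "a \<in> A" "k \<in> topspace K" for a k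
    using sup_norm_upper[OF K UC[OF that(1)] that(2)] Uk[OF that] nU[OF ax[OF that(1)]] by simp
  have W_le: "nrm X (a \<odot>\<^bsub>X\<^esub> x0) \<le> c"
    if "a \<in> A" "0 \<le> c" "\<And>k. k \<in> topspace K \<Longrightarrow> cmod (\<pi> a k * y k) \<le> c" for a c
    using sup_norm_le[OF K UC[OF that(1)] that(2)] that(3) Uk[OF that(1)] nU[OF ax[OF that(1)]] by simp

  \<comment> \<open>One isomorphism, here for accuracy \<open>1\<close>, makes the norms of
    \<open>X\<close> and \<open>A\<close> comparable through the bounded inverse theorem. The
    constant \<open>c\<close> must come first, since the choice of \<open>\<epsilon>\<close> depends
    on it.\<close>
  obtain T1 p1 where T1: "scalar_iso (range (const_fun \<Omega>)) X (self_module \<Omega> A) T1" "p1 > 0"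
    "\<And>x. x \<in> carrier X \<Longrightarrow> N (T1 x) \<le> p1 * nrm X x"
    using almost[unfolded almost_isometric_spaces_iff, rule_format, OF zero_less_one] by blast
  note L1 = linear_map_of_scalar_iso[OF T1(1) x0(1) bij]
  have L1_bdd: "N (T1 (a \<odot>\<^bsub>X\<^esub> x0)) \<le> (p1 * nrm X x0) * N a" if a: "a \<in> A" for a
  proof -
    have "p1 * nrm X (a \<odot>\<^bsub>X\<^esub> x0) \<le> p1 * (nrm X x0 * N a)" using T1(2) W_N[OF a] by (intro mult_left_mono) auto
    then show ?thesis using T1(3)[OF ax[OF a]] by simp
  qed
  obtain C1 where C1: "C1 > 0" "\<And>a. a \<in> A \<Longrightarrow> N a \<le> C1 * N (T1 (a \<odot>\<^bsub>X\<^esub> x0))"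
    using bounded_inverse[OF L1(1) L1_bdd L1(2)] by blast
  define c where "c = 1 / (C1 * p1)"
  have c: "c > 0" using C1(1) T1(2) by (simp add: c_def)
  have N_W: "c * N a \<le> nrm X (a \<odot>\<^bsub>X\<^esub> x0)" if a: "a \<in> A" for a
  proof -
    have "N a \<le> C1 * (p1 * nrm X (a \<odot>\<^bsub>X\<^esub> x0))"
      using C1(2)[OF a] mult_left_mono[OF T1(3)[OF ax[OF a]], of C1] C1(1) by linarith
    then show ?thesis using C1(1) T1(2) by (simp add: c_def field_simps)
  qed

  fix \<delta> :: real assume \<delta>: "\<delta> > 0"
  \<comment> \<open>The first term is for
    \<open>1 + 3 \<epsilon> < (1 + \<delta>) (1 - 8 \<epsilon>)\<close>, that is
    \<open>\<epsilon> (11 + 8 \<delta>) < \<delta>\<close>; the \<open>12\<close> makes it strict.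
    In the second, \<open>16\<close> is \<open>8\<close> times the bound \<open>2\<close> for
    \<open>1 + \<epsilon>\<close>, and the added \<open>1\<close> avoids a zero denominator.\<close>
  define \<epsilon> where "\<epsilon> = min (\<delta> / (12 + 8 * \<delta>)) (c / (16 * (nrm X x0 + 1)))"
  have x0_nn: "nrm X x0 \<ge> 0" by (rule nrm_nonneg[OF x0(1)])
  have \<epsilon>: "\<epsilon> > 0" using \<delta> c x0_nn by (auto simp: \<epsilon>_def)
  have \<epsilon>_le: "\<epsilon> \<le> \<delta> / (12 + 8 * \<delta>)" by (simp add: \<epsilon>_def)
  then have \<epsilon>\<delta>: "\<epsilon> * (12 + 8 * \<delta>) \<le> \<delta>" using \<delta> by (simp add: field_simps)
  have "\<delta> / (12 + 8 * \<delta>) < 1 / 8" using \<delta> by (simp add: field_simps)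
  with \<epsilon>_le have \<epsilon>8: "\<epsilon> < 1 / 8" by (rule le_less_trans)
  have small: "8 * \<epsilon> * (1 + \<epsilon>) * nrm X x0 \<le> c"
  proof -
    have "8 * \<epsilon> * (1 + \<epsilon>) * nrm X x0 \<le> 8 * \<epsilon> * 2 * (nrm X x0 + 1)"
      using \<epsilon> \<epsilon>8 x0_nn by (intro mult_mono) auto
    also have "\<dots> = \<epsilon> * (16 * (nrm X x0 + 1))" by simp
    also have "\<dots> \<le> c / (16 * (nrm X x0 + 1)) * (16 * (nrm X x0 + 1))"
      using x0_nn by (intro mult_right_mono) (auto simp: \<epsilon>_def)
    also have "\<dots> = c" using x0_nn by (simp add: add_nonneg_pos less_imp_neq[symmetric])
    finally show ?thesis .
  qed
  define \<theta> where "\<theta> = 1 - 4 * \<epsilon> * (1 + \<epsilon>)"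
  have "\<epsilon> * \<epsilon> \<le> \<epsilon> * (1/8)" using \<epsilon> \<epsilon>8 by (intro mult_left_mono) auto
  then have \<theta>8: "1 - 8 * \<epsilon> \<le> \<theta>" and sq: "(1 + \<epsilon>)\<^sup>2 \<le> 1 + 3 * \<epsilon>"
    using \<epsilon> by (auto simp: \<theta>_def power2_eq_square algebra_simps)
  have \<theta>: "\<theta> > 0" using \<theta>8 \<epsilon>8 by linarith
  have "(1 + \<epsilon>)\<^sup>2 < (1 + \<delta>) * (1 - 8 * \<epsilon>)"
    using sq \<epsilon>\<delta> \<epsilon> by (simp add: algebra_simps)
  also have "\<dots> \<le> (1 + \<delta>) * \<theta>" using \<theta>8 \<delta> by (intro mult_left_mono) auto
  finally have \<theta>\<delta>: "(1 + \<epsilon>)\<^sup>2 / \<theta> < 1 + \<delta>" using \<theta> by (simp add: field_simps)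

  obtain T p q where T: "scalar_iso (range (const_fun \<Omega>)) X (self_module \<Omega> A) T"
    and pq: "p > 0" "q > 0" "p * q < 1 + \<epsilon>"
    and T_le: "\<And>x. x \<in> carrier X \<Longrightarrow> N (T x) \<le> p * nrm X x"
    and le_T: "\<And>x. x \<in> carrier X \<Longrightarrow> nrm X x \<le> q * N (T x)"
    using almost[unfolded almost_isometric_spaces_iff, rule_format, OF \<epsilon>] by blast
  note L = linear_map_of_scalar_iso[OF T x0(1) bij]
  \<comment> \<open>Division by \<open>q\<close> absorbs the constant of the lower bound, giving
    \<open>W a \<le> N (T (a x0)) \<le> p * q * W a\<close>. The constants \<open>C\<close> and
    \<open>c\<close> are divided as well, so the smallness condition is unchanged.\<close>
  define W where "W a = nrm X (a \<odot>\<^bsub>X\<^esub> x0) / q" for a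
  obtain g h where g: "g \<in> A" and h: "h \<in> A" and gh: "(\<lambda>x\<in>S. g x * h x) = (\<lambda>x\<in>S. 1)"
    and upper: "\<And>b. b \<in> A \<Longrightarrow> W (\<lambda>x\<in>S. b x * g x) \<le> N b"
    and lower: "\<And>b. b \<in> A \<Longrightarrow> \<theta> * N b \<le> (1 + \<epsilon>)\<^sup>2 * W (\<lambda>x\<in>S. b x * g x)"
  proof (rule almost_isometry_imp_unit[where e = \<pi> and K = "topspace K" and W = W and L = "\<lambda>a. T (a \<odot>\<^bsub>X\<^esub> x0)"
        and y = "\<lambda>k. y k / q" and C = "nrm X x0 / q" and c = "c / q" and \<epsilon> = \<epsilon>])
    fix a assume a: "a \<in> A"
    show "cmod (\<pi> a k * (y k / complex_of_real q)) \<le> W a" if k: "k \<in> topspace K" for k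
      using divide_right_mono[OF W_upper[OF a k], of q] pq(2) by (simp add: W_def norm_mult norm_divide)
    show "W a \<le> r" if "0 \<le> r" "\<And>k. k \<in> topspace K \<Longrightarrow> cmod (\<pi> a k * (y k / complex_of_real q)) \<le> r" for r
    proof -
      have "nrm X (a \<odot>\<^bsub>X\<^esub> x0) \<le> r * q"
      proof (rule W_le[OF a])
        fix k assume "k \<in> topspace K"
        then show "cmod (\<pi> a k * y k) \<le> r * q"
          using that(2)[of k] pq(2) by (simp add: norm_mult norm_divide field_simps)
      qed (use that pq in auto)
      then show ?thesis using pq(2) by (simp add: W_def field_simps)
    qed
    show "W a \<le> nrm X x0 / q * N a"
      using divide_right_mono[OF W_N[OF a], of q] pq(2) by (simp add: W_def)
    show "c / q * N a \<le> W a"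
      using divide_right_mono[OF N_W[OF a], of q] pq(2) by (simp add: W_def)
    show "W a \<le> N (T (a \<odot>\<^bsub>X\<^esub> x0))"
      using le_T[OF ax[OF a]] pq(2) by (simp add: W_def field_simps)
    have "N (T (a \<odot>\<^bsub>X\<^esub> x0)) \<le> (p * q) * W a"
      using T_le[OF ax[OF a]] pq(2) by (simp add: W_def)
    also have "\<dots> \<le> (1 + \<epsilon>) * W a"
      using pq nrm_nonneg[OF ax[OF a]] by (intro mult_right_mono) (auto simp: W_def)
    finally show "N (T (a \<odot>\<^bsub>X\<^esub> x0)) \<le> (1 + \<epsilon>) * W a" .
  next
    show "8 * \<epsilon> * (1 + \<epsilon>) * (nrm X x0 / q) \<le> c / q"
      using divide_right_mono[OF small, of q] pq(2) by simp
  next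
    fix g h assume *: "g \<in> A" "h \<in> A" "(\<lambda>x\<in>S. g x * h x) = (\<lambda>x\<in>S. 1)"
      "\<And>b. b \<in> A \<Longrightarrow> W (\<lambda>x\<in>S. b x * g x) \<le> N b"
      "\<And>b. b \<in> A \<Longrightarrow> (1 - 4 * \<epsilon> * (1 + \<epsilon>)) * N b \<le> (1 + \<epsilon>)\<^sup>2 * W (\<lambda>x\<in>S. b x * g x)"
    show thesis using * unfolding \<theta>_def[symmetric] by (rule that)
  qed (use \<pi>_mult \<pi>_add \<pi>_c c pq \<epsilon> x0_nn L in \<open>auto simp: divide_simps\<close>)
  have ghx: "g x * h x = 1" if "x \<in> S" for x using fun_cong[OF gh, of x] that by simp
  \<comment> \<open>The isomorphism sought is the inverse of this map, which sends \<open>1\<close>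
    to \<open>g\<close> times \<open>x0\<close>; invertibility of \<open>g\<close> makes it
    bijective.\<close>
  define Z where "Z b = (\<lambda>x\<in>S. b x * g x) \<odot>\<^bsub>X\<^esub> x0" for b
  have "bij_betw (\<lambda>b. \<lambda>x\<in>S. b x * g x) A A"
  proof (rule bij_betw_byWitness[where f' = "\<lambda>b. \<lambda>x\<in>S. b x * h x"])
    have eq: "(\<lambda>x\<in>S. (\<lambda>x\<in>S. b x * u x) x * v x) = b"
      if b: "b \<in> A" and uv: "u \<in> A" "v \<in> A" "\<And>x. x \<in> S \<Longrightarrow> u x * v x = 1" for b u v
      using uv(3) by (intro mem_eqI[OF mult_mem[OF mult_mem[OF b uv(1)] uv(2)] b]) (simp add: mult.assoc)
    show "\<forall>b\<in>A. (\<lambda>x\<in>S. (\<lambda>x\<in>S. b x * g x) x * h x) = b" using eq g h ghx by blast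
    show "\<forall>b\<in>A. (\<lambda>x\<in>S. (\<lambda>x\<in>S. b x * h x) x * g x) = b"
      using eq[OF _ h g] ghx by (metis mult.commute)
  qed (use mult_mem g h in blast)+
  then have "bij_betw ((\<lambda>a. a \<odot>\<^bsub>X\<^esub> x0) \<circ> (\<lambda>b. \<lambda>x\<in>S. b x * g x)) A (carrier X)"
    using bij by (rule bij_betw_trans)
  then have Zbij: "bij_betw Z A (carrier X)" by (simp add: o_def Z_def[abs_def])
  have gA: "(\<lambda>x\<in>S. b x * g x) \<in> A" if "b \<in> A" for b by (rule mult_mem[OF that g])
  have Z: "scalar_iso A (self_module \<Omega> A) X Z"
    unfolding scalar_iso_def fun_module_simps
  proof (intro conjI ballI Zbij)
    fix a b assume a: "a \<in> A" and b: "b \<in> A"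
    have eq: "(\<lambda>x\<in>S. (\<lambda>x\<in>S. a x + b x) x * g x) = (\<lambda>x\<in>S. (\<lambda>x\<in>S. a x * g x) x + (\<lambda>x\<in>S. b x * g x) x)"
      by (intro restrict_ext) (simp add: distrib_right)
    show "Z (\<lambda>x\<in>S. a x + b x) = Z a \<oplus>\<^bsub>X\<^esub> Z b"
      unfolding Z_def eq by (rule X_smult_add[OF gA[OF a] gA[OF b] x0(1)])
    have eq: "(\<lambda>x\<in>S. (\<lambda>x\<in>S. a x * b x) x * g x) = (\<lambda>x\<in>S. a x * (\<lambda>x\<in>S. b x * g x) x)"
      by (intro restrict_ext) simp
    show "Z (\<lambda>x\<in>S. a x * b x) = a \<odot>\<^bsub>X\<^esub> Z b"
      unfolding Z_def eq by (rule X_smult_mult[OF a gA[OF b] x0(1)])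
  qed
  let ?T = "inv_into A Z"
  have Ti: "scalar_iso A X (self_module \<Omega> A) ?T"
    using scalar_iso_inv[OF Z] add_mem mult_mem by (simp add: fun_module_simps)
  have norms: "N (?T x) \<le> (1 + \<epsilon>)\<^sup>2 / (\<theta> * q) * nrm X x \<and> nrm X x \<le> q * N (?T x)"
    if x: "x \<in> carrier X" for x
  proof -
    have b: "?T x \<in> A" and Zb: "Z (?T x) = x"
      using Zbij x by (auto simp: bij_betw_def inv_into_into f_inv_into_f)
    have W: "W (\<lambda>t\<in>S. ?T x t * g t) = nrm X x / q" using Zb by (simp add: W_def Z_def)
    show ?thesis
      using upper[OF b] lower[OF b] \<theta> pq(2) unfolding W by (simp add: field_simps)
  qed
  show "\<exists>T p q. scalar_iso A X (self_module \<Omega> A) T \<and> 0 < p \<and> 0 < q \<and> p * q < 1 + \<delta> \<and>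
      (\<forall>x\<in>carrier X. N (T x) \<le> p * nrm X x \<and> nrm X x \<le> q * N (T x))"
  proof (rule exI[of _ ?T], rule exI[of _ "(1 + \<epsilon>)\<^sup>2 / (\<theta> * q)"], rule exI[of _ q], intro conjI Ti)
    show "(1 + \<epsilon>)\<^sup>2 / (\<theta> * q) * q < 1 + \<delta>" using \<theta>\<delta> pq(2) by simp
  qed (use norms \<theta> pq \<epsilon> in auto)
qed

end

theorem corollary4p6:
  fixes \<Omega> :: "'w topology"
    and A :: "('w \<Rightarrow> complex) set"
    and X :: "('w \<Rightarrow> complex, 'm) normed_module"
  assumes "uniform_algebra \<Omega> A"
    and "banach_module \<Omega> A X"
  shows
    "(singly_generated A X \<and> faithful \<Omega> A X \<and> function_module \<Omega> A X \<and>
        almost_isometric_spaces \<Omega> X (self_module \<Omega> A)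
      \<longleftrightarrow> almost_isometric_modules A X (self_module \<Omega> A)) \<and>
     (almost_isometric_modules A X (self_module \<Omega> A)
      \<longleftrightarrow> (\<exists>f \<in> modulus_closure_pos \<Omega> A. isometric_modules A X (principal_module \<Omega> A f)))"
proof -
  interpret unif_alg_module \<Omega> A X
    using assms
    by (intro unif_alg_module.intro unif_alg.intro unif_alg_module_axioms.intro)
       (auto simp: banach_module_def)
  have principal: "almost_isometric_modules A X (self_module \<Omega> A)
      \<longleftrightarrow> (\<exists>f \<in> modulus_closure_pos \<Omega> A. isometric_modules A X (principal_module \<Omega> A f))"
    using almost_isometric_imp_principal isometric_principal_imp_almost by blast
  have "singly_generated A X \<and> faithful \<Omega> A X \<and> function_module \<Omega> A X \<and>
        almost_isometric_spaces \<Omega> X (self_module \<Omega> A)"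
    if almost: "almost_isometric_modules A X (self_module \<Omega> A)"
  proof (intro conjI)
    obtain T where T: "scalar_iso A X (self_module \<Omega> A) T"
      using almost[unfolded almost_isometric_modules_iff, rule_format, OF zero_less_one] by blast
    show "singly_generated A X" "faithful \<Omega> A X"
      using self_iso_imp_generated_faithful[OF T] by auto
    \<comment> \<open>That \<open>X\<close> is a function module is seen from (iii), where it is
      isometric to the concrete module \<open>A f\<close>.\<close>
    obtain f where f: "f \<in> modulus_closure_pos \<Omega> A" "isometric_modules A X (principal_module \<Omega> A f)"
      using almost principal by blast
    show "function_module \<Omega> A X"
      using function_moduleI[OF assms(2) concrete_principal_module[OF f(1)]] f(2)
      unfolding principal_module_def by blast
    show "almost_isometric_spaces \<Omega> X (self_module \<Omega> A)"
      unfolding almost_isometric_spaces_iff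
    proof (intro allI impI)
      fix \<epsilon> :: real assume \<epsilon>: "\<epsilon> > 0"
      obtain T p q where "scalar_iso A X (self_module \<Omega> A) T" "0 < p" "0 < q" "p * q < 1 + \<epsilon>"
        "\<forall>x\<in>carrier X. N (T x) \<le> p * nrm X x \<and> nrm X x \<le> q * N (T x)"
        using almost[unfolded almost_isometric_modules_iff, rule_format, OF \<epsilon>] by blast
      moreover have "range (const_fun \<Omega>) \<subseteq> A" using const_fun_mem by blast
      ultimately show "\<exists>T p q. scalar_iso (range (const_fun \<Omega>)) X (self_module \<Omega> A) T \<and>
          0 < p \<and> 0 < q \<and> p * q < 1 + \<epsilon> \<and>
          (\<forall>x\<in>carrier X. N (T x) \<le> p * nrm X x \<and> nrm X x \<le> q * N (T x))"
        using scalar_iso_mono by blast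
    qed
  qed
  then show ?thesis using principal function_module_imp_almost by blast
qed

end
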